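(* Let $f_1,\dots,f_n:\mathbb{R}^p\to\mathbb{R}$ be twice differentiable and $F(\mathbf{x})=\frac1n\sum_{i=1}^n f_i(\mathbf{x})$. Assume that there are constants $0<K_i<\infty$ with $0\preceq\nabla^2 f_i(\mathbf{x})\preceq K_i\mathbb{I}$ for all $\mathbf{x}\in\mathbb{R}^p$ and $i=1,\dots,n$, and constants $0<\gamma\le K<\infty$ with $\gamma\mathbb{I}\preceq\nabla^2F(\mathbf{x})\preceq K\mathbb{I}$ for all $\mathbf{x}\in\mathbb{R}^p$; let $\mathbf{x}^*$ be the minimizer of $F$. Let $0<\theta_1<1$, $0<\theta_2<1$, $0<\delta<1$, $0<\epsilon_1\le1/2$, $0<\epsilon_2<1$, $0<\beta<1$, $\widehat\alpha\ge1$ and $$\sigma\ge\frac{4\tilde\kappa}{(1-\theta_1)(1-\theta_2)(1-\beta)}.$$ For any $\mathbf{x}^{(k)}\in\mathbb{R}^p$, perform one iteration of the algorithm described in the context (sub-sampled Hessian and gradient, inexact update with tolerances $\theta_1,\theta_2$) at $\mathbf{x}^{(k)}$. Then the following holds with probability $1-\delta$: (i) if the algorithm stops at this iteration ("STOP"), then $\|\nabla F(\mathbf{x}^{(k)})\|<(1+\sigma)\epsilon_2$; (ii) otherwise, $$F(\mathbf{x}^{(k+1)})-F(\mathbf{x}^* )\le(1-\rho)\big(F(\mathbf{x}^{(k)})-F(\mathbf{x}^* )\big),$$ where (1) if $\theta_1\le\sqrt{\frac{1-\epsilon_1}{4\tilde\kappa}}$, then $\rho=\frac{4\alpha_k\beta}{9\tilde\kappa}$;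 (2) otherwise, $\rho=\frac{8\alpha_k\beta(1-\theta_2)(1-\theta_1)^2(1-\epsilon_1)}{9\tilde\kappa^2}$. Moreover, in both cases (1) and (2), the step size is at least $$\alpha_k\ge\frac{(1-\theta_2)(1-\beta)(1-\epsilon_1)}{\kappa}.$$
   Context: Condition numbers: $\kappa=K/\gamma$. For an integer $1\le q\le n$, $\widehat K_q$ is the average of the $q$ largest values among $K_1,\dots,K_n$, and $\kappa_q=\widehat K_q/\gamma$. With $\mathcal{S}_H$ the Hessian sample, $\tilde\kappa=\kappa_1$ if $\mathcal{S}_H$ is drawn with replacement, and $\tilde\kappa=\kappa_{|\mathcal{S}_H|}$ if it is drawn without replacement. Algorithm (one iteration). (1) A collection $\mathcal{S}_H$ of indices of size $|\mathcal{S}_H|\ge 2\kappa_1\ln(p/\delta)/\epsilon_1^2$ is drawn from $\{1,\dots,n\}$ uniformly at random, with or without replacement, and $H(\mathbf{x}^{(k)})=\frac1{|\mathcal{S}_H|}\sum_{j\in\mathcal{S}_H}\nabla^2f_j(\mathbf{x}^{(k)})$. (2) With $G(\mathbf{x}^{(k)})$ a number such that $\|\nabla f_i(\mathbf{x}^{(k)})\|\le G(\mathbf{x}^{(k)})$ for all $i$, a collection $\mathcal{S}_{\mathbf{g}}$ of size $|\mathcal{S}_{\mathbf{g}}|\ge\frac{G(\mathbf{x}^{(k)})^2}{\epsilon_2^2}\big(1+\sqrt{8\ln(1/\delta)}\big)^2$ is drawn, independently of $\mathcal{S}_H$, from $\{1,\dots,n\}$ uniformly at random with replacement, and $\mathbf{g}(\mathbf{x}^{(k)})=\frac1{|\mathcal{S}_{\mathbf{g}}|}\sum_{j\in\mathcal{S}_{\mathbf{g}}}\nabla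 f_j(\mathbf{x}^{(k)})$. (3) If $\|\mathbf{g}(\mathbf{x}^{(k)})\|<\sigma\epsilon_2$, STOP. (4) Otherwise $\mathbf{x}^{(k+1)}=\mathbf{x}^{(k)}+\alpha_k\mathbf{p}_k$, where $\mathbf{p}_k$ is any vector satisfying both $$\|H(\mathbf{x}^{(k)})\mathbf{p}_k+\mathbf{g}(\mathbf{x}^{(k)})\|\le\theta_1\|\mathbf{g}(\mathbf{x}^{(k)})\|,\qquad \mathbf{p}_k^T\mathbf{g}(\mathbf{x}^{(k)})\le-(1-\theta_2)\,\mathbf{p}_k^TH(\mathbf{x}^{(k)})\mathbf{p}_k,$$ and $\alpha_k$ is the largest $\alpha\le\widehat\alpha$ such that $F(\mathbf{x}^{(k)}+\alpha\mathbf{p}_k)\le F(\mathbf{x}^{(k)})+\alpha\beta\,\mathbf{p}_k^T\mathbf{g}(\mathbf{x}^{(k)})$. Probabilities are over the draws of the samples, and "with probability $q$" means with probability at least $q$. $\|\cdot\|$ is the Euclidean norm, $\mathbb{I}$ is the identity matrix, and $A\preceq B$ means $B-A$ is symmetric positive semi-definite. *)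

theory Defs
  imports "HOL-Analysis.Analysis" "HOL-Probability.Probability"
begin

definition grad :: "(real ^ 'd \<Rightarrow> real) \<Rightarrow> real ^ 'd \<Rightarrow> real ^ 'd" where
  "grad f x = (THE D. GDERIV f x :> D)"

definition hessian :: "(real ^ 'd \<Rightarrow> real) \<Rightarrow> real ^ 'd \<Rightarrow> real ^ 'd ^ 'd" where
  "hessian f x = matrix (frechet_derivative (grad f) (at x))"

definition twice_differentiable :: "(real ^ 'd \<Rightarrow> real) \<Rightarrow> bool" where
  "twice_differentiable f \<longleftrightarrow>
     (\<forall>x. f differentiable (at x)) \<and> (\<forall>x. grad f differentiable (at x))"

definition pos_semidef :: "real ^ 'd ^ 'd \<Rightarrow> bool" where
  "pos_semidef A \<longleftrightarrow> transpose A = A \<and> (\<forall>v. 0 \<le> v \<bullet> (A *v v))"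

definition loewner_le :: "real ^ 'd ^ 'd \<Rightarrow> real ^ 'd ^ 'd \<Rightarrow> bool"  (infix "\<preceq>" 50) where
  "A \<preceq> B \<longleftrightarrow> pos_semidef (B - A)"

text \<open>The average of the \<open>q\<close> largest among \<open>Ks 1, \<dots>, Ks n\<close>, counted with
  multiplicity; meant for \<open>1 \<le> q \<le> n\<close>.\<close>

definition avg_largest :: "(nat \<Rightarrow> real) \<Rightarrow> nat \<Rightarrow> nat \<Rightarrow> real" where
  "avg_largest Ks n q = sum_list (take q (rev (sort (map Ks [1..<Suc n])))) / real q"

datatype sampling = With_Replacement | Without_Replacement

text \<open>A sample of size \<open>s\<close> is the list of the successive draws. The second set is nonempty only
  for \<open>s \<le> n\<close>; the uniform distribution on it makes the set of drawn indices uniform among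
  the subsets of size \<open>s\<close>.\<close>

fun samples :: "sampling \<Rightarrow> nat \<Rightarrow> nat \<Rightarrow> nat list set" where
  "samples With_Replacement n s = {S. set S \<subseteq> {1..n} \<and> length S = s}"
| "samples Without_Replacement n s = {S. set S \<subseteq> {1..n} \<and> length S = s \<and> distinct S}"

definition draw :: "sampling \<Rightarrow> nat \<Rightarrow> nat \<Rightarrow> nat list pmf" where
  "draw m n s = pmf_of_set (samples m n s)"

definition sample_mean :: "(nat \<Rightarrow> 'a::real_vector) \<Rightarrow> nat list \<Rightarrow> 'a" where
  "sample_mean v S = (1 / real (length S)) *\<^sub>R (\<Sum>j\<leftarrow>S. v j)"

text \<open>\<open>\<theta>\<^sub>1\<close> bounds the relative residual of \<open>H p = - g\<close>; \<open>\<theta>\<^sub>2\<close> is the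
  tolerance in the descent condition.\<close>

definition inexact_direction ::
  "real ^ 'd ^ 'd \<Rightarrow> real ^ 'd \<Rightarrow> real \<Rightarrow> real \<Rightarrow> real ^ 'd \<Rightarrow> bool" where
  "inexact_direction H g \<theta>\<^sub>1 \<theta>\<^sub>2 p \<longleftrightarrow>
     norm (H *v p + g) \<le> \<theta>\<^sub>1 * norm g \<and>
     p \<bullet> g \<le> - (1 - \<theta>\<^sub>2) * (p \<bullet> (H *v p))"

definition sufficient_decrease ::
  "(real ^ 'd \<Rightarrow> real) \<Rightarrow> real ^ 'd \<Rightarrow> real ^ 'd \<Rightarrow> real ^ 'd \<Rightarrow> real \<Rightarrow> real \<Rightarrow> bool" where
  "sufficient_decrease F x g p \<beta> \<alpha> \<longleftrightarrow> F (x + \<alpha> *\<^sub>R p) \<le> F x + \<alpha> * \<beta> * (p \<bullet> g)"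

definition largest_step ::
  "(real ^ 'd \<Rightarrow> real) \<Rightarrow> real ^ 'd \<Rightarrow> real ^ 'd \<Rightarrow> real ^ 'd \<Rightarrow> real \<Rightarrow> real \<Rightarrow> real \<Rightarrow> bool" where
  "largest_step F x g p \<beta> \<alpha>max \<alpha> \<longleftrightarrow>
     \<alpha> \<le> \<alpha>max \<and> sufficient_decrease F x g p \<beta> \<alpha> \<and>
     (\<forall>a. a \<le> \<alpha>max \<and> sufficient_decrease F x g p \<beta> a \<longrightarrow> a \<le> \<alpha>)"

end

theory Submission
  imports Defs "HOL-Combinatorics.Multiset_Permutations"
begin

text \<open>
  The probability \<open>\<delta>\<close> is spent on both samples, so the bad events of the Hessian sample and of the
  gradient sample cannot simply be added; they are independent, and each has room to spare. The
  constants of the statement allow \<open>H\<close> to be as small as \<open>(3/4 - \<epsilon>\<^sub>1/2) \<gamma>\<close> instead of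
  \<open>(1 - \<epsilon>\<^sub>1) \<gamma>\<close>, for which the matrix Chernoff bound gives the failure probability
  \<open>p (\<delta>/p)\<^bsup>1.15\<^esup>\<close>. The gradient sample fails with probability at most \<open>\<delta>\<^sup>4\<close> by
  McDiarmid's inequality and at most \<open>(1 + sqrt (8 ln (1/\<delta>)))\<^sup>-\<^sup>2\<close> by Chebyshev's. For small
  \<open>\<delta>\<close>, and for all \<open>\<delta>\<close> if \<open>p \<ge> 2\<close>, these bounds suffice. In dimension one, where the
  Chernoff bound is too weak for \<open>\<delta>\<close> close to 1, the step only requires
  \<open>H \<ge> 2/3 (1 - \<epsilon>\<^sub>1) \<gamma>\<close>, and Cantelli's inequality takes over.

  The matrix Chernoff bound rests on \<open>tr ((A B)\<^sup>N) \<le> tr (A\<^sup>N B\<^sup>N)\<close> for symmetric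
  \<open>A, B\<close> and \<open>N\<close> a power of two, a discrete form of the Golden--Thompson inequality which needs
  neither matrix exponentials nor the spectral theorem.
\<close>

subsection \<open>Trace inequalities for powers of symmetric matrices\<close>

text \<open>The hard regime is \<delta> close to 1. With \<open>L = ln (1 / \<delta>)\<close> and
  \<open>t = sqrt (8 * L)\<close>, the success probability to be reached is about
  \<open>L = t^2 / 8\<close>, while Chebyshev's inequality guarantees a good gradient only with
  probability about \<open>2 * t\<close>. If the Hessian succeeds only with a probability of order
  \<open>L\<close> as well, the product is too small as \<open>t\<close> tends to 0; one of the two
  factors has to stay away from 0. For \<open>p \<ge> 2\<close> the surplus exponent 0.15 does this,
  since \<open>p\<close> to the power -0.15 is below 0.91. In dimension one there is a dichotomy on
  \<open>q = s\<^sub>H * \<gamma> / K1\<close>, the number of draws relative to the condition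
  number. If \<open>q \<ge> 1/2\<close>, Cantelli's inequality leaves a fixed probability 1/19 for
  the Hessian. If \<open>q < 1/2\<close>, then \<kappa>t exceeds 2, and since \<sigma> grows with
  \<kappa>t, the gradient may be overestimated by twice the usual error; this weaker demand is met
  with probability at least 4/9.\<close>

lemma bounded_bilinear_matrix_mult:
  "bounded_bilinear ((**) :: real^'n^'m \<Rightarrow> real^'p^'n \<Rightarrow> real^'p^'m)"
  unfolding bilinear_conv_bounded_bilinear[symmetric] bilinear_def
  by (auto intro!: linearI simp: matrix_matrix_mult_def vec_eq_iff algebra_simps sum.distrib sum_distrib_left)

interpretation mm: bounded_bilinear "(**) :: real^'n^'m \<Rightarrow> real^'p^'n \<Rightarrow> real^'p^'m"
  by (rule bounded_bilinear_matrix_mult)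

lemma trace_scaleR: "trace (c *\<^sub>R (A::real^'n^'n)) = c * trace A"
  by (simp add: trace_def sum_distrib_left)

lemma trace_sum: "trace (\<Sum>i\<in>I. (f i :: real^'n^'n)) = (\<Sum>i\<in>I. trace (f i))"
  unfolding trace_def sum_component by (rule sum.swap)

lemma transpose_add: "transpose (A + B) = transpose A + transpose (B :: real^'n^'m)"
  by (simp add: transpose_def vec_eq_iff)

lemma transpose_diff: "transpose (A - B) = transpose A - transpose (B :: real^'n^'m)"
  by (simp add: transpose_def vec_eq_iff)

text \<open>The inner product on matrices is the Hilbert-Schmidt one and \<open>norm\<close> the
  Frobenius norm, so Cauchy-Schwarz yields trace inequalities.\<close>

lemma trace_transpose_mult: "trace (transpose A ** B) = (A :: real^'n^'m) \<bullet> B"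
proof -
  have "trace (transpose A ** B) = (\<Sum>j\<in>UNIV. \<Sum>i\<in>UNIV. A$i$j * B$i$j)"
    by (simp add: trace_def matrix_matrix_mult_def transpose_def)
  also have "\<dots> = A \<bullet> B"
    by (subst sum.swap) (simp add: inner_vec_def)
  finally show ?thesis .
qed

lemma trace_mult_symmetric: "transpose A = A \<Longrightarrow> trace (A ** B) = (A :: real^'n^'n) \<bullet> B"
  by (metis trace_transpose_mult)

lemma inner_matrix_vector_transpose: "(A *v x) \<bullet> y = x \<bullet> (transpose A *v y)" for A :: "real^'n^'m"
  by (metis adjoint_matrix adjoint_works inner_commute matrix_vector_mul_linear)

lemma symmetric_inner: "transpose A = A \<Longrightarrow> (A *v x) \<bullet> y = x \<bullet> (A *v y)" for A :: "real^'n^'n"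
  by (metis inner_matrix_vector_transpose)

primrec matpow :: "real^'n^'n \<Rightarrow> nat \<Rightarrow> real^'n^'n" where
  "matpow A 0 = mat 1"
| "matpow A (Suc k) = A ** matpow A k"

lemma matpow_add: "matpow A (i + j) = matpow A i ** matpow A j"
  by (induction i) (simp_all add: matrix_mul_assoc)

lemma matpow_Suc2: "matpow A (Suc k) = matpow A k ** A"
  using matpow_add[of A k 1] by simp

lemma matpow_mult: "matpow A (i * j) = matpow (matpow A i) j"
  by (induction j) (simp_all add: matpow_add)

lemma matpow_double: "matpow A (2 * k) = matpow (A ** A) k"
  using matpow_mult[of A 2 k] by (simp add: numeral_2_eq_2)

lemma transpose_matpow: "transpose (matpow A k) = matpow (transpose A) k"
  by (induction k) (simp_all add: matrix_transpose_mul matpow_Suc2[symmetric])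

lemma symmetric_matpow: "transpose A = A \<Longrightarrow> transpose (matpow A k) = matpow A k"
  by (simp add: transpose_matpow)

lemma matpow_mult_shift: "A ** matpow (B ** A) k = matpow (A ** B) k ** A"
  by (induction k) (simp_all add: matrix_mul_assoc[symmetric])

lemma trace_matpow_mult_commute: "trace (matpow (A ** B) k) = trace (matpow (B ** A) k)" for A B :: "real^'n^'n"
proof (cases k)
  case (Suc j)
  have "trace (matpow (A ** B) (Suc j)) = trace (A ** (B ** matpow (A ** B) j))"
    by (simp add: matrix_mul_assoc)
  also have "\<dots> = trace ((B ** matpow (A ** B) j) ** A)"
    by (rule trace_mul_sym)
  also have "\<dots> = trace (matpow (B ** A) (Suc j))"
    by (simp only: matpow_mult_shift matpow_Suc2 matrix_mul_assoc)
  finally show ?thesis using Suc by simp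
qed simp

text \<open>The two bounds feed each other: squaring the matrix in the second one produces a product of two
  symmetric matrices, to which the first one applies.\<close>

lemma trace_power_bounds:
  shows "\<And>P Q :: real^'n^'n. transpose P = P \<Longrightarrow> transpose Q = Q \<Longrightarrow>
            (trace (matpow (P ** Q) (2 ^ j)))\<^sup>2 \<le> trace (matpow P (2 * 2 ^ j)) * trace (matpow Q (2 * 2 ^ j))"
    and "\<And>M :: real^'n^'n. \<bar>trace (matpow M (2 * 2 ^ j))\<bar> \<le> trace (matpow (transpose M ** M) (2 ^ j))"
proof (induction j)
  case 0
  {
    case (1 P Q)
    have "(P \<bullet> Q)\<^sup>2 \<le> (P \<bullet> P) * (Q \<bullet> Q)" by (rule Cauchy_Schwarz_ineq)
    with 1 show ?case by (simp add: trace_mult_symmetric numeral_2_eq_2)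
  next
    case (2 M)
    have "\<bar>transpose M \<bullet> M\<bar> \<le> norm (transpose M) * norm M" by (rule Cauchy_Schwarz_ineq2)
    also have "norm (transpose M) = norm M"
      by (metis norm_eq_sqrt_inner trace_transpose_mult trace_mul_sym transpose_transpose)
    also have "norm M * norm M = M \<bullet> M" by (simp add: dot_square_norm power2_eq_square)
    finally have "\<bar>trace (M ** M)\<bar> \<le> trace (transpose M ** M)"
      by (metis trace_transpose_mult transpose_transpose)
    thus ?case by (simp add: numeral_2_eq_2)
  }
next
  case (Suc j)
  {
    case (1 P Q)
    have *: "\<bar>trace (matpow (P ** Q) (2 ^ Suc j))\<bar> \<le> trace (matpow (P ** P ** (Q ** Q)) (2 ^ j))"
    proof -
      have "\<bar>trace (matpow (P ** Q) (2 ^ Suc j))\<bar> \<le> trace (matpow (transpose (P ** Q) ** (P ** Q)) (2 ^ j))"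
        using Suc(2)[of "P ** Q"] by simp
      \<comment> \<open>By cyclicity of the trace \<open>Q P P Q\<close> may be traded for
        \<open>P P Q Q\<close>, a product of two symmetric matrices.\<close>
      also have "transpose (P ** Q) ** (P ** Q) = Q ** (P ** P ** Q)"
        using 1 by (simp add: matrix_transpose_mul matrix_mul_assoc)
      also have "trace (matpow (Q ** (P ** P ** Q)) (2 ^ j)) = trace (matpow ((P ** P ** Q) ** Q) (2 ^ j))"
        by (rule trace_matpow_mult_commute)
      finally show ?thesis by (simp add: matrix_mul_assoc)
    qed
    have "(trace (matpow (P ** Q) (2 ^ Suc j)))\<^sup>2 \<le> (trace (matpow (P ** P ** (Q ** Q)) (2 ^ j)))\<^sup>2"
      using power_mono[OF *, of 2] by simp
    also have "\<dots> \<le> trace (matpow (P ** P) (2 * 2 ^ j)) * trace (matpow (Q ** Q) (2 * 2 ^ j))"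
      using 1 by (intro Suc(1)) (simp_all add: matrix_transpose_mul)
    finally show ?case by (simp only: power_Suc matpow_double)
  next
    case (2 M)
    \<comment> \<open>Powers of \<open>?P\<close> and \<open>?Q\<close> have equal traces, so the
      product bound for them is a perfect square.\<close>
    let ?P = "transpose M ** M" and ?Q = "M ** transpose M"
    have t: "trace (matpow ?Q k) = trace (matpow ?P k)" for k
      by (rule trace_matpow_mult_commute)
    have "\<bar>trace (matpow M (2 * 2 ^ Suc j))\<bar> = \<bar>trace (matpow (M ** M) (2 * 2 ^ j))\<bar>"
      by (simp only: power_Suc matpow_double)
    also have "\<dots> \<le> trace (matpow (transpose (M ** M) ** (M ** M)) (2 ^ j))"
      by (rule Suc(2))
    also have "transpose (M ** M) ** (M ** M) = transpose M ** (transpose M ** M ** M)"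
      by (simp add: matrix_transpose_mul matrix_mul_assoc)
    also have "trace (matpow \<dots> (2 ^ j)) = trace (matpow (?P ** ?Q) (2 ^ j))"
      by (subst trace_matpow_mult_commute) (simp add: matrix_mul_assoc)
    finally have *: "\<bar>trace (matpow M (2 * 2 ^ Suc j))\<bar> \<le> trace (matpow (?P ** ?Q) (2 ^ j))" .
    have "(trace (matpow (?P ** ?Q) (2 ^ j)))\<^sup>2 \<le> trace (matpow ?P (2 * 2 ^ j)) * trace (matpow ?Q (2 * 2 ^ j))"
      by (rule Suc(1)) (simp_all add: matrix_transpose_mul)
    also have "\<dots> = (trace (matpow ?P (2 * 2 ^ j)))\<^sup>2"
      by (simp add: t power2_eq_square)
    finally have "\<bar>trace (matpow (?P ** ?Q) (2 ^ j))\<bar> \<le> \<bar>trace (matpow ?P (2 * 2 ^ j))\<bar>"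
      by (simp add: abs_le_square_iff)
    moreover have "0 \<le> trace (matpow ?P (2 * 2 ^ j))"
      unfolding mult_2 matpow_add
      by (subst trace_mult_symmetric) (simp_all add: symmetric_matpow matrix_transpose_mul)
    ultimately show ?case using * by simp
  }
qed

text \<open>Squaring the factors halves the exponent: the second bound above replaces
  \<open>A B\<close> by its Gram matrix, which is cyclically equivalent to the product of
  \<open>A A\<close> and \<open>B B\<close>. At exponent 1 both sides agree.\<close>

lemma trace_matpow_mult_le:
  assumes "transpose A = A" "transpose B = B"
  shows "trace (matpow (A ** B) (2 ^ k)) \<le> trace (matpow A (2 ^ k) ** matpow B (2 ^ k))"
  using assms
proof (induction k arbitrary: A B)
  case (Suc k)
  have "trace (matpow (A ** B) (2 ^ Suc k)) \<le> trace (matpow (transpose (A ** B) ** (A ** B)) (2 ^ k))"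
    using trace_power_bounds(2)[of "A ** B" k] by simp
  also have "transpose (A ** B) ** (A ** B) = B ** (A ** A ** B)"
    using Suc.prems by (simp add: matrix_transpose_mul matrix_mul_assoc)
  also have "trace (matpow \<dots> (2 ^ k)) = trace (matpow ((A ** A) ** (B ** B)) (2 ^ k))"
    by (subst trace_matpow_mult_commute) (simp add: matrix_mul_assoc)
  also have "\<dots> \<le> trace (matpow (A ** A) (2 ^ k) ** matpow (B ** B) (2 ^ k))"
    using Suc.prems by (intro Suc.IH) (simp_all add: matrix_transpose_mul)
  finally show ?case by (simp add: matpow_double)
qed simp

text \<open>This is the tangent inequality at \<open>D\<close> of the function sending
  \<open>A\<close> to \<open>tr (A^N)\<close>. For \<open>N = 2 M\<close>, completing the square
  with \<open>D^M\<close> and \<open>D^(M-1) C\<close> reduces it to the same inequality for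
  \<open>D D\<close> and \<open>C C\<close> with exponent \<open>M\<close>.\<close>

lemma trace_power_gradient:
  assumes "transpose C = C" "transpose D = D"
  shows "2 ^ k * trace (matpow D (2 ^ k - 1) ** C) \<le> (2 ^ k - 1) * trace (matpow D (2 ^ k)) + trace (matpow C (2 ^ k))"
  using assms
proof (induction k arbitrary: C D)
  case (Suc k)
  let ?a = "trace (matpow D (2 ^ Suc k))" and ?b = "trace (matpow C (2 ^ Suc k))"
  let ?x = "trace (matpow D (2 ^ Suc k - 1) ** C)"
  let ?R = "matpow D (2 ^ k - 1) ** C" and ?S = "matpow D (2 ^ k)"
  let ?y = "trace (matpow (D ** D) (2 ^ k - 1) ** (C ** C))"
  have S: "transpose ?S = ?S" using Suc.prems by (simp add: symmetric_matpow)
  have R: "transpose ?R = C ** matpow D (2 ^ k - 1)"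
    using Suc.prems by (simp add: symmetric_matpow matrix_transpose_mul)
  have e: "2 ^ Suc k - 1 = 2 ^ k + (2 ^ k - 1 :: nat)" by simp
  have "?x = ?S \<bullet> ?R"
    unfolding e matpow_add using S by (simp add: trace_mult_symmetric[symmetric] matrix_mul_assoc)
  moreover have "?a = ?S \<bullet> ?S"
    using S by (simp add: trace_mult_symmetric[symmetric] mult_2 matpow_add)
  moreover have "?y = ?R \<bullet> ?R"
  proof -
    have "?R \<bullet> ?R = trace (C ** (matpow D (2 ^ k - 1) ** matpow D (2 ^ k - 1) ** C))"
      by (simp only: trace_transpose_mult[symmetric] R matrix_mul_assoc)
    also have "\<dots> = trace ((matpow D (2 ^ k - 1) ** matpow D (2 ^ k - 1) ** C) ** C)"
      by (rule trace_mul_sym)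
    also have "\<dots> = ?y"
      by (simp only: matpow_double[symmetric] mult_2 matpow_add matrix_mul_assoc)
    finally show ?thesis by simp
  qed
  moreover have "0 \<le> (?S - ?R) \<bullet> (?S - ?R)" by simp
  ultimately have x: "2 * ?x \<le> ?a + ?y"
    by (simp add: inner_diff_left inner_diff_right inner_commute)
  have "2 ^ k * ?y \<le> (2 ^ k - 1) * trace (matpow (D ** D) (2 ^ k)) + trace (matpow (C ** C) (2 ^ k))"
    using Suc.prems by (intro Suc.IH) (simp_all add: matrix_transpose_mul)
  hence "2 ^ k * ?y \<le> (2 ^ k - 1) * ?a + ?b" by (simp add: matpow_double)
  moreover have "2 ^ k * (2 * ?x) \<le> 2 ^ k * (?a + ?y)" using x by (intro mult_left_mono) auto
  ultimately show ?case by (simp add: algebra_simps)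
qed simp

lemma convex_symmetric: "convex {A :: real^'n^'n. transpose A = A}"
  by (auto simp: convex_def transpose_add transpose_scalar)

text \<open>A function above its tangents is convex: the tangent inequality at the convex
  combination \<open>D\<close> is averaged over the two end points. Hoeffding's comparison of the
  sampling schemes needs this convexity.\<close>

lemma convex_on_trace_power:
  "convex_on {A :: real^'n^'n. transpose A = A} (\<lambda>A. trace (matpow A (2 ^ k)))"
proof (rule convex_onI[OF _ convex_symmetric])
  fix t :: real and A B :: "real^'n^'n"
  assume t: "0 < t" "t < 1" and AB: "A \<in> {A. transpose A = A}" "B \<in> {A. transpose A = A}"
  let ?N = "2 ^ k :: nat"
  define D where "D = (1 - t) *\<^sub>R A + t *\<^sub>R B"
  have D: "transpose D = D" using AB by (simp add: D_def transpose_add transpose_scalar)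
  have e: "matpow D ?N = matpow D (?N - 1) ** D" by (simp flip: matpow_Suc2)
  define P where "P = matpow D (?N - 1)"
  have "trace (P ** D) = (1 - t) * trace (P ** A) + t * trace (P ** B)"
    by (simp add: D_def mm.add_right mm.scaleR_right trace_add trace_scaleR)
  moreover have "2 ^ k * trace (P ** A) \<le> (2 ^ k - 1) * trace (matpow D ?N) + trace (matpow A ?N)"
    using trace_power_gradient[of A D k] AB D by (simp add: P_def)
  moreover have "2 ^ k * trace (P ** B) \<le> (2 ^ k - 1) * trace (matpow D ?N) + trace (matpow B ?N)"
    using trace_power_gradient[of B D k] AB D by (simp add: P_def)
  ultimately have "2 ^ k * trace (matpow D ?N) \<le> (2 ^ k - 1) * trace (matpow D ?N)
     + (1 - t) * trace (matpow A ?N) + t * trace (matpow B ?N)"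
  proof -
    assume a: "trace (P ** D) = (1 - t) * trace (P ** A) + t * trace (P ** B)"
    assume b: "2 ^ k * trace (P ** A) \<le> (2 ^ k - 1) * trace (matpow D ?N) + trace (matpow A ?N)"
    assume c: "2 ^ k * trace (P ** B) \<le> (2 ^ k - 1) * trace (matpow D ?N) + trace (matpow B ?N)"
    have "2 ^ k * trace (P ** D) = (1 - t) * (2 ^ k * trace (P ** A)) + t * (2 ^ k * trace (P ** B))"
      by (simp add: a algebra_simps)
    also have "\<dots> \<le> (1 - t) * ((2 ^ k - 1) * trace (matpow D ?N) + trace (matpow A ?N))
       + t * ((2 ^ k - 1) * trace (matpow D ?N) + trace (matpow B ?N))"
      using t by (intro add_mono mult_left_mono b c) auto
    also have "\<dots> = (2 ^ k - 1) * trace (matpow D ?N) + (1 - t) * trace (matpow A ?N) + t * trace (matpow B ?N)"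
      by (simp add: algebra_simps)
    finally show ?thesis by (simp add: e P_def)
  qed
  thus "trace (matpow ((1 - t) *\<^sub>R A + t *\<^sub>R B) ?N) \<le> (1 - t) * trace (matpow A ?N) + t * trace (matpow B ?N)"
    unfolding D_def[symmetric] by (simp add: left_diff_distrib)
qed

subsection \<open>Positive semidefinite matrices\<close>

lemmas matrix_ring_simps = mm.add_left mm.add_right mm.diff_left mm.diff_right mm.minus_left mm.minus_right
  mm.scaleR_left mm.scaleR_right matrix_mul_assoc

section \<open>Frobenius norm and contractions\<close>

lemma norm_matrix_transpose: "norm (transpose A) = norm (A :: real^'n^'n)"
  by (metis norm_eq_sqrt_inner trace_transpose_mult trace_mul_sym transpose_transpose)

lemma norm_matrix_sq_columns: "(norm (A :: real^'n^'n))\<^sup>2 = (\<Sum>j\<in>UNIV. (norm (column j A))\<^sup>2)"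
proof -
  have "(norm A)\<^sup>2 = transpose A \<bullet> transpose A"
    by (metis norm_matrix_transpose power2_norm_eq_inner)
  also have "\<dots> = (\<Sum>j\<in>UNIV. transpose A $ j \<bullet> transpose A $ j)"
    by (rule inner_vec_def)
  also have "\<dots> = (\<Sum>j\<in>UNIV. (norm (column j A))\<^sup>2)"
    by (simp add: power2_norm_eq_inner transpose_def column_def)
  finally show ?thesis .
qed

text \<open>The squared Frobenius norm sums the squared column norms, and a contraction on the left
  shrinks every column.\<close>

lemma norm_contraction_mult_le:
  fixes A E :: "real^'n^'n"
  assumes "\<And>v. norm (A *v v) \<le> norm v"
  shows "norm (A ** E) \<le> norm E"
proof -
  have "column j (A ** E) = A *v column j E" for j
    by (simp add: column_def matrix_matrix_mult_def matrix_vector_mult_def vec_eq_iff)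
  hence "(norm (A ** E))\<^sup>2 \<le> (norm E)\<^sup>2"
    unfolding norm_matrix_sq_columns[of E] norm_matrix_sq_columns[of "A ** E"]
    using assms by (auto intro!: sum_mono power_mono)
  thus ?thesis by simp
qed

lemma norm_mult_contraction_le:
  fixes A E :: "real^'n^'n"
  assumes "\<And>v. norm (transpose A *v v) \<le> norm v"
  shows "norm (E ** A) \<le> norm E"
  by (metis assms matrix_transpose_mul norm_contraction_mult_le norm_matrix_transpose)

lemma contraction_matpow:
  assumes "\<And>v. norm (A *v v) \<le> norm v"
  shows "norm (matpow A k *v v) \<le> norm v"
  by (induction k) (auto simp: matrix_vector_mul_assoc[symmetric] intro: order_trans assms)

text \<open>Telescoping puts \<open>C\<close> on the left and powers of \<open>D\<close> on the
  right of the differences, hence contraction is asked of \<open>C\<close> and of the transpose of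
  \<open>D\<close>. In the application \<open>D\<close> is a product of two symmetric matrices, in
  general not symmetric.\<close>

lemma norm_matpow_diff_le:
  assumes C: "\<And>v. norm (C *v v) \<le> norm v" and D: "\<And>v. norm (transpose D *v v) \<le> norm v"
  shows "norm (matpow C k - matpow D k) \<le> real k * norm (C - D)"
proof (induction k)
  case (Suc k)
  have "matpow C (Suc k) - matpow D (Suc k) = C ** (matpow C k - matpow D k) + (C - D) ** matpow D k"
    by (simp add: matrix_ring_simps)
  also have "norm \<dots> \<le> norm (matpow C k - matpow D k) + norm (C - D)"
    by (intro norm_triangle_mono norm_contraction_mult_le norm_mult_contraction_le C)
       (simp add: transpose_matpow contraction_matpow D del: transpose_matrix_vector)
  also have "\<dots> \<le> real (Suc k) * norm (C - D)"
    using Suc by (simp add: algebra_simps)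
  finally show ?case .
qed simp

lemma norm_mat_1: "norm (mat 1 :: real^'n^'n) = sqrt (real CARD('n))"
  by (simp add: norm_eq_sqrt_inner trace_transpose_mult[symmetric] trace_I)

lemma abs_trace_le: "\<bar>trace (A :: real^'n^'n)\<bar> \<le> sqrt (real CARD('n)) * norm A"
proof -
  have "trace A = mat 1 \<bullet> A" by (simp flip: trace_transpose_mult)
  thus ?thesis using Cauchy_Schwarz_ineq2[of "mat 1" A] by (simp add: norm_mat_1)
qed

lemma norm_matrix_vector_le: "norm (A *v v) \<le> norm A * norm (v :: real^'n)" for A :: "real^'n^'m"
proof -
  have "(norm (A *v v))\<^sup>2 = (\<Sum>i\<in>UNIV. (A $ i \<bullet> v)\<^sup>2)"
    unfolding power2_norm_eq_inner by (simp add: inner_vec_def[of "A *v v"] matrix_vector_mul_component power2_eq_square)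
  also have "\<dots> \<le> (\<Sum>i\<in>UNIV. (A $ i \<bullet> A $ i) * (v \<bullet> v))"
    by (intro sum_mono Cauchy_Schwarz_ineq)
  also have "\<dots> = (norm A * norm v)\<^sup>2"
    by (simp add: power_mult_distrib power2_norm_eq_inner inner_vec_def[of A] sum_distrib_right)
  finally show ?thesis by (rule power2_le_imp_le) simp
qed

section \<open>The cone of positive semidefinite matrices\<close>

lemma pos_semidef_symmetric: "pos_semidef A \<Longrightarrow> transpose A = A"
  by (simp add: pos_semidef_def)

lemma pos_semidef_add: "pos_semidef A \<Longrightarrow> pos_semidef B \<Longrightarrow> pos_semidef (A + B)"
  by (simp add: pos_semidef_def transpose_add matrix_vector_mult_add_rdistrib inner_add_right)

lemma pos_semidef_scaleR: "pos_semidef A \<Longrightarrow> 0 \<le> c \<Longrightarrow> pos_semidef (c *\<^sub>R A)"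
  by (simp add: pos_semidef_def transpose_scalar scaleR_matrix_vector_assoc[symmetric])

lemma pos_semidef_0: "pos_semidef 0"
  by (simp add: pos_semidef_def transpose_def vec_eq_iff)

lemma pos_semidef_mat_1: "pos_semidef (mat 1)"
  by (simp add: pos_semidef_def)

lemma pos_semidef_sum: "(\<And>i. i \<in> I \<Longrightarrow> pos_semidef (f i)) \<Longrightarrow> pos_semidef (sum f I)"
  by (induction I rule: infinite_finite_induct) (auto simp: pos_semidef_0 pos_semidef_add)

lemma pos_semidef_sum_list: "(\<And>x. x \<in> set xs \<Longrightarrow> pos_semidef (f x)) \<Longrightarrow> pos_semidef (\<Sum>x\<leftarrow>xs. f x)"
  by (induction xs) (auto simp: pos_semidef_0 pos_semidef_add)

lemma pos_semidef_conj:
  assumes "pos_semidef Q" "transpose A = A"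
  shows "pos_semidef (A ** Q ** A)"
proof -
  have "0 \<le> (A *v v) \<bullet> (Q *v (A *v v))" for v using assms(1) by (simp add: pos_semidef_def)
  thus ?thesis using assms
    by (simp add: pos_semidef_def matrix_transpose_mul matrix_mul_assoc symmetric_inner
         flip: matrix_vector_mul_assoc)
qed

lemma pos_semidef_trace_nonneg:
  assumes "pos_semidef A" shows "0 \<le> trace A"
proof -
  have "0 \<le> axis i 1 \<bullet> (A *v axis i 1)" for i using assms by (simp add: pos_semidef_def)
  hence "0 \<le> A $ i $ i" for i
    by (simp add: inner_axis' matrix_vector_mult_basis column_def)
  thus ?thesis by (simp add: trace_def sum_nonneg)
qed

text \<open>By cyclicity the even power splits into a conjugation \<open>A^k Q A^k\<close>. Hence
  \<open>tr (A^N X)\<close> is monotone in \<open>X\<close> for even \<open>N\<close>, without a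
  square root of \<open>Q\<close>.\<close>

lemma trace_matpow_mult_nonneg:
  assumes "transpose A = A" "pos_semidef Q"
  shows "0 \<le> trace (matpow A (2 * k) ** Q)"
proof -
  have "trace (matpow A (2 * k) ** Q) = trace (matpow A k ** (matpow A k ** Q))"
    by (simp add: mult_2 matpow_add matrix_mul_assoc)
  also have "\<dots> = trace ((matpow A k ** Q) ** matpow A k)" by (rule trace_mul_sym)
  also have "0 \<le> \<dots>"
    by (intro pos_semidef_trace_nonneg pos_semidef_conj assms symmetric_matpow)
  finally show ?thesis .
qed

text \<open>A product of commuting semidefinite matrices would call for square roots; writing it as
  a sum of two conjugates avoids them.\<close>

lemma pos_semidef_mult_complement:
  assumes "pos_semidef X" "pos_semidef (mat 1 - X)"
  shows "pos_semidef (X - X ** X)"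
proof -
  have "X - X ** X = X ** (mat 1 - X) ** X + (mat 1 - X) ** X ** (mat 1 - X)"
    by (simp add: matrix_ring_simps)
  thus ?thesis using assms by (simp add: pos_semidef_add pos_semidef_conj pos_semidef_symmetric)
qed

lemma pos_semidef_norm_le:
  assumes "pos_semidef X" "pos_semidef (c *\<^sub>R mat 1 - X)" "0 < c"
  shows "(norm (X *v v))\<^sup>2 \<le> c * (v \<bullet> (X *v v))" and "norm (X *v v) \<le> c * norm v"
proof -
  define Y where "Y = (1/c) *\<^sub>R X"
  have "mat 1 - Y = (1/c) *\<^sub>R (c *\<^sub>R mat 1 - X)" using \<open>0 < c\<close> by (simp add: Y_def scaleR_diff_right)
  hence "pos_semidef (Y - Y ** Y)"
    using assms by (intro pos_semidef_mult_complement) (simp_all add: Y_def pos_semidef_scaleR)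
  hence "0 \<le> v \<bullet> (Y *v v) - v \<bullet> (Y *v (Y *v v))"
    by (simp add: pos_semidef_def matrix_vector_mult_diff_rdistrib inner_diff_right matrix_vector_mul_assoc)
  also have "v \<bullet> (Y *v (Y *v v)) = (norm (Y *v v))\<^sup>2"
    using assms(1) by (simp add: Y_def power2_norm_eq_inner symmetric_inner pos_semidef_def transpose_scalar)
  finally have "c * c * (norm (Y *v v))\<^sup>2 \<le> c * c * (v \<bullet> (Y *v v))"
    using \<open>0 < c\<close> by (intro mult_left_mono) auto
  thus *: "(norm (X *v v))\<^sup>2 \<le> c * (v \<bullet> (X *v v))"
    using \<open>0 < c\<close> by (simp add: Y_def scaleR_matrix_vector_assoc[symmetric] power_mult_distrib power_divide power2_eq_square)
  have "0 \<le> v \<bullet> ((c *\<^sub>R mat 1 - X) *v v)" using assms(2) by (simp add: pos_semidef_def)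
  hence "v \<bullet> (X *v v) \<le> c * (norm v)\<^sup>2"
    by (simp add: matrix_vector_mult_diff_rdistrib inner_diff_right scaleR_matrix_vector_assoc[symmetric] power2_norm_eq_inner)
  hence "c * (v \<bullet> (X *v v)) \<le> c * (c * (norm v)\<^sup>2)" using \<open>0 < c\<close> by (intro mult_left_mono) auto
  hence "(norm (X *v v))\<^sup>2 \<le> (c * norm v)\<^sup>2"
    using * by (simp add: power_mult_distrib power2_eq_square mult_ac)
  thus "norm (X *v v) \<le> c * norm v"
    using \<open>0 < c\<close> by (simp add: abs_le_square_iff[symmetric])
qed

text \<open>On the interval from 0 to 1 the convex function \<open>(1 - y x)^k\<close> lies below
  its chord. In place of a spectral theorem there is an induction on \<open>k\<close>: the gap for
  \<open>Suc k\<close> is \<open>B\<close> times the gap for \<open>k\<close> plus a multiple of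
  \<open>X - X X\<close>.\<close>

lemma power_chord:
  assumes X: "pos_semidef X" "pos_semidef (mat 1 - X)" and y: "0 \<le> y" "y \<le> 1"
  shows "pos_semidef (mat 1 - (1 - (1 - y) ^ k) *\<^sub>R X - matpow (mat 1 - y *\<^sub>R X) k)"
proof -
  define B where "B = mat 1 - y *\<^sub>R X"
  define Z where "Z = X - X ** X"
  have Z: "pos_semidef Z" unfolding Z_def by (rule pos_semidef_mult_complement[OF X])
  have B: "transpose B = B" using X(1) by (simp add: B_def transpose_diff transpose_scalar pos_semidef_symmetric)
  have BX: "B ** X = X - y *\<^sub>R (X ** X)" "X ** B = X - y *\<^sub>R (X ** X)"
    by (simp_all add: B_def matrix_ring_simps)
  have BZ: "B ** Z = Z ** B"
    by (simp add: Z_def mm.diff_left mm.diff_right mm.scaleR_left mm.scaleR_right matrix_mul_assoc BX)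
       (simp add: BX mm.diff_right mm.scaleR_right flip: matrix_mul_assoc)
  \<comment> \<open>Conjugation by \<open>B\<close> raises the exponent by two, hence two base
    cases; commutation with \<open>B\<close> is carried along to identify \<open>B (B^i Z) B\<close>
    with \<open>B^(i+2) Z\<close>.\<close>
  have "pos_semidef (matpow B i ** Z) \<and> matpow B i ** Z ** B = B ** (matpow B i ** Z)" for i
  proof (induction i rule: nat_induct2)
    case 0
    show ?case by (simp add: Z BZ)
  next
    case 1
    \<comment> \<open>A single factor \<open>B\<close> is not a conjugation, so this case has its
      own decomposition into semidefinite terms.\<close>
    have "B ** Z = (1 - y) *\<^sub>R Z + y *\<^sub>R ((mat 1 - X) ** X ** (mat 1 - X))"
      by (simp add: B_def Z_def matrix_ring_simps scaleR_diff_right scaleR_diff_left scaleR_add_right)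
    hence "pos_semidef (B ** Z)"
      using y X Z by (auto intro!: pos_semidef_add pos_semidef_scaleR pos_semidef_conj pos_semidef_symmetric)
    thus ?case by (simp add: BZ matrix_mul_assoc)
  next
    case (step i)
    define V where "V = matpow B i ** Z"
    have V: "pos_semidef V" "V ** B = B ** V" using step by (auto simp: V_def)
    have e: "matpow B (i + 2) ** Z = B ** V ** B"
      by (simp add: V_def[symmetric] V(2) flip: matrix_mul_assoc)
    have "B ** V ** B ** B = B ** (B ** V ** B)"
      by (simp add: V(2) flip: matrix_mul_assoc)
    thus ?case unfolding e using V B by (simp add: pos_semidef_conj)
  qed
  hence W: "pos_semidef (matpow B i ** Z)" for i by blast
  define c where "c k = 1 - (1 - y) ^ k" for k
  have c: "0 \<le> c k" for k using y by (simp add: c_def power_le_one)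
  \<comment> \<open>The factor \<open>B^i\<close> strengthens the induction: passing from
    \<open>Suc k\<close> to \<open>k\<close> leaves one more \<open>B\<close> in front of the
    gap.\<close>
  have "pos_semidef (matpow B i ** (mat 1 - c k *\<^sub>R X - matpow B k))" for i
  proof (induction k arbitrary: i)
    case (Suc k)
    have "c (Suc k) = y + c k - y * c k" by (simp add: c_def algebra_simps)
    hence "mat 1 - c (Suc k) *\<^sub>R X - matpow B (Suc k)
        = (y * c k) *\<^sub>R Z + B ** (mat 1 - c k *\<^sub>R X - matpow B k)"
      by (simp add: mm.diff_right mm.scaleR_right BX Z_def)
         (simp add: B_def scaleR_diff_right scaleR_diff_left scaleR_add_left mult.commute)
    hence e: "matpow B i ** (mat 1 - c (Suc k) *\<^sub>R X - matpow B (Suc k))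
        = (y * c k) *\<^sub>R (matpow B i ** Z) + matpow B (Suc i) ** (mat 1 - c k *\<^sub>R X - matpow B k)"
      by (simp only: matpow_Suc2[of B i] mm.add_right mm.scaleR_right matrix_mul_assoc[of _ B])
    show ?case
      unfolding e using y by (intro pos_semidef_add pos_semidef_scaleR W Suc.IH mult_nonneg_nonneg c)
  qed (simp add: c_def pos_semidef_0)
  from this[of 0] show ?thesis by (simp add: c_def B_def)
qed

text \<open>Jensen's inequality by repeated Cauchy-Schwarz: the square of \<open>v . A^N v\<close>
  is at most \<open>|A^N v|^2 = v . A^(2N) v\<close>.\<close>

lemma inner_matpow_ge:
  assumes A: "pos_semidef A" and v: "norm v = 1"
  shows "(v \<bullet> (A *v v)) ^ (2 ^ k) \<le> v \<bullet> (matpow A (2 ^ k) *v v)"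
proof (induction k)
  case (Suc k)
  note sym = pos_semidef_symmetric[OF A]
  let ?q = "v \<bullet> (matpow A (2 ^ k) *v v)"
  have "0 \<le> v \<bullet> (A *v v)" using A by (simp add: pos_semidef_def)
  hence "(v \<bullet> (A *v v)) ^ (2 ^ Suc k) \<le> ?q\<^sup>2"
    using power_mono[OF Suc, of 2] by (simp add: power_mult[symmetric] mult.commute)
  also have "\<dots> \<le> (norm (matpow A (2 ^ k) *v v))\<^sup>2"
    using Cauchy_Schwarz_ineq[of v "matpow A (2 ^ k) *v v"] v by (simp add: power2_norm_eq_inner[symmetric])
  also have "\<dots> = v \<bullet> (matpow A (2 ^ Suc k) *v v)"
    by (simp add: power2_norm_eq_inner symmetric_inner symmetric_matpow sym mult_2 matpow_add matrix_vector_mul_assoc)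
  finally show ?case .
qed simp

text \<open>This stands in for bounding the largest eigenvalue by the trace. The last doubling
  passes through the Frobenius norm, hence the exponent \<open>2 ^ Suc k\<close>.\<close>

lemma trace_matpow_ge:
  assumes A: "pos_semidef A" and v: "norm v = 1"
  shows "(v \<bullet> (A *v v)) ^ (2 ^ Suc k) \<le> trace (matpow A (2 ^ Suc k))"
proof -
  note sym = pos_semidef_symmetric[OF A]
  let ?Q = "matpow A (2 ^ k)"
  have "(v \<bullet> (A *v v)) ^ (2 ^ Suc k) \<le> v \<bullet> (matpow A (2 ^ Suc k) *v v)" by (rule inner_matpow_ge[OF A v])
  also have "\<dots> = (norm (?Q *v v))\<^sup>2"
    by (simp add: power2_norm_eq_inner symmetric_inner symmetric_matpow sym mult_2 matpow_add matrix_vector_mul_assoc)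
  also have "\<dots> \<le> (norm ?Q)\<^sup>2"
    using norm_matrix_vector_le[of ?Q v] v by (intro power_mono) auto
  also have "\<dots> = trace (matpow A (2 ^ Suc k))"
    by (simp add: power2_norm_eq_inner trace_transpose_mult[symmetric] symmetric_matpow sym mult_2 matpow_add)
  finally show ?thesis .
qed

text \<open>The effect of one further draw \<open>Y\<close> on the sum \<open>S\<close>. To first
  order \<open>C\<close> is the product of \<open>A\<close> and \<open>B\<close>; the
  Golden-Thompson step separates their powers, and the chord makes the bound linear in
  \<open>Y\<close>, ready to be averaged over the draw. The hypothesis on
  \<open>\<theta> * (a + 1)\<close> keeps all three matrices between 0 and the identity.\<close>

lemma trace_power_step:
  fixes S Y :: "real^'n^'n"
  assumes S: "pos_semidef S" "pos_semidef (a *\<^sub>R mat 1 - S)" "norm S \<le> M"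
    and Y: "pos_semidef Y" "pos_semidef (mat 1 - Y)"
    and N: "N = 2 ^ Suc k" "0 < \<theta>" "\<theta> * (a + 1) \<le> real N" "0 \<le> a"
  shows "trace (matpow (mat 1 - (\<theta> / N) *\<^sub>R (Y + S)) N)
    \<le> trace (matpow (mat 1 - (\<theta> / N) *\<^sub>R S) N)
      - (1 - (1 - \<theta> / N) ^ N) * trace (matpow (mat 1 - (\<theta> / N) *\<^sub>R S) N ** Y)
      + \<theta>\<^sup>2 * sqrt (real CARD('n)) * M / N"
proof -
  have Npos: "0 < real N" by (simp add: N)
  define y where "y = \<theta> / N"
  have y: "0 < y" "y * (a + 1) \<le> 1" using N Npos by (simp_all add: y_def field_simps)
  moreover have "y \<le> y * (a + 1)" using y N(4) by (simp add: mult_left_mono)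
  ultimately have y1: "y \<le> 1" by linarith
  define A where "A = mat 1 - y *\<^sub>R S"
  define B where "B = mat 1 - y *\<^sub>R Y"
  define C where "C = mat 1 - y *\<^sub>R (Y + S)"
  have between: "pos_semidef (mat 1 - y *\<^sub>R T) \<and> pos_semidef (mat 1 - (mat 1 - y *\<^sub>R T))"
    if "pos_semidef T" "pos_semidef (b *\<^sub>R mat 1 - T)" "y * b \<le> 1" for b T
  proof -
    have "mat 1 - y *\<^sub>R T = (1 - y * b) *\<^sub>R mat 1 + y *\<^sub>R (b *\<^sub>R mat 1 - T)"
      by (simp add: scaleR_diff_right scaleR_diff_left)
    moreover have "pos_semidef \<dots>"
      using that y by (intro pos_semidef_add pos_semidef_scaleR pos_semidef_mat_1) auto
    moreover have "mat 1 - (mat 1 - y *\<^sub>R T) = y *\<^sub>R T" by simp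
    ultimately show ?thesis using that y by (metis pos_semidef_scaleR less_imp_le)
  qed
  have contr: "norm (T *v v) \<le> norm v" if "pos_semidef T" "pos_semidef (mat 1 - T)" for T and v :: "real^'n"
    using pos_semidef_norm_le(2)[of T 1 v] that by simp
  have A: "pos_semidef A" "pos_semidef (mat 1 - A)"
    unfolding A_def using between[of S a] S y by (auto simp: algebra_simps)
  have B: "pos_semidef B" "pos_semidef (mat 1 - B)"
    unfolding B_def using between[of Y 1] Y y1 by auto
  have "(a + 1) *\<^sub>R mat 1 - (Y + S) = (a *\<^sub>R mat 1 - S) + (mat 1 - Y)"
    by (simp add: scaleR_add_left)
  hence "pos_semidef ((a + 1) *\<^sub>R mat 1 - (Y + S))" using pos_semidef_add S Y by metis
  hence C: "pos_semidef C" "pos_semidef (mat 1 - C)"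
    unfolding C_def using between[of "Y + S" "a + 1"] S Y y by (auto intro: pos_semidef_add)
  \<comment> \<open>The defect is of second order in \<open>y = \<theta> / N\<close>; over
    \<open>N\<close> factors it accumulates to order \<open>1 / N\<close>.\<close>
  have "C - A ** B = - ((y * y) *\<^sub>R (S ** Y))"
    by (simp add: A_def B_def C_def matrix_ring_simps scaleR_add_right scaleR_diff_right)
  hence "norm (C - A ** B) = (y * y) * norm (S ** Y)" by simp
  also have "\<dots> \<le> (y * y) * M"
    using norm_mult_contraction_le[of Y S] contr[OF Y] Y(1) S(3)
    by (intro mult_left_mono) (auto simp: pos_semidef_symmetric simp del: transpose_matrix_vector)
  finally have CAB: "norm (C - A ** B) \<le> (y * y) * M" .
  have "norm (matpow C N - matpow (A ** B) N) \<le> real N * norm (C - A ** B)"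
  proof (rule norm_matpow_diff_le)
    fix v :: "real^'n"
    show "norm (C *v v) \<le> norm v" by (rule contr[OF C])
    have "norm (B *v (A *v v)) \<le> norm v" using contr[OF A, of v] contr[OF B, of "A *v v"] by linarith
    thus "norm (transpose (A ** B) *v v) \<le> norm v"
      using A B by (simp add: matrix_transpose_mul pos_semidef_symmetric matrix_vector_mul_assoc del: transpose_matrix_vector)
  qed
  also have "\<dots> \<le> real N * ((y * y) * M)" using CAB Npos by simp
  finally have "sqrt (real CARD('n)) * norm (matpow C N - matpow (A ** B) N)
      \<le> sqrt (real CARD('n)) * (real N * ((y * y) * M))" by (intro mult_left_mono) auto
  hence "trace (matpow C N - matpow (A ** B) N) \<le> sqrt (real CARD('n)) * (real N * ((y * y) * M))"
    using abs_trace_le[of "matpow C N - matpow (A ** B) N"] by linarith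
  also have "\<dots> = \<theta>\<^sup>2 * sqrt (real CARD('n)) * M / N"
    using Npos by (simp add: y_def power2_eq_square field_simps)
  finally have 1: "trace (matpow C N) \<le> trace (matpow (A ** B) N) + \<theta>\<^sup>2 * sqrt (real CARD('n)) * M / N"
    by (simp add: trace_sub)
  have 2: "trace (matpow (A ** B) N) \<le> trace (matpow A N ** matpow B N)"
    unfolding N(1) using A B by (intro trace_matpow_mult_le) (auto simp: pos_semidef_symmetric)
  have "0 \<le> trace (matpow A N ** (mat 1 - (1 - (1 - y) ^ N) *\<^sub>R Y - matpow B N))"
    unfolding N(1) power_Suc B_def using A(1) Y y y1
    by (intro trace_matpow_mult_nonneg power_chord) (auto simp: pos_semidef_symmetric)
  also have "\<dots> = trace (matpow A N) - (1 - (1 - y) ^ N) * trace (matpow A N ** Y) - trace (matpow A N ** matpow B N)"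
    by (simp only: mm.diff_right mm.scaleR_right trace_sub trace_scaleR matrix_mul_rid)
  finally show ?thesis using 1 2 by (simp add: A_def B_def C_def y_def)
qed

subsection \<open>Sampling with and without replacement\<close>

abbreviation draw_mean :: "sampling \<Rightarrow> nat \<Rightarrow> nat \<Rightarrow> (nat list \<Rightarrow> real) \<Rightarrow> real" where
  "draw_mean m n s \<equiv> measure_pmf.expectation (draw m n s)"

abbreviation draw_prob :: "sampling \<Rightarrow> nat \<Rightarrow> nat \<Rightarrow> nat list set \<Rightarrow> real" where
  "draw_prob m n s \<equiv> measure_pmf.prob (draw m n s)"

abbreviation "iid_mean \<equiv> draw_mean With_Replacement"
abbreviation "iid_prob \<equiv> draw_prob With_Replacement"

lemma finite_samples: "finite (samples m n s)"
proof (rule finite_subset)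
  show "samples m n s \<subseteq> {S. set S \<subseteq> {1..n} \<and> length S = s}" by (cases m) auto
  show "finite {S. set S \<subseteq> {1..n} \<and> length S = s}" by (rule finite_lists_length_eq) simp
qed

lemma samples_nonempty:
  assumes "n \<ge> 1" "m = Without_Replacement \<Longrightarrow> s \<le> n"
  shows "samples m n s \<noteq> {}"
proof (cases m)
  case With_Replacement
  have "replicate s 1 \<in> samples m n s" using assms With_Replacement by auto
  thus ?thesis by blast
next
  case Without_Replacement
  have "[1..<Suc s] \<in> samples m n s" using assms Without_Replacement by auto
  thus ?thesis by blast
qed

lemma expectation_draw:
  assumes "n \<ge> 1" "m = Without_Replacement \<Longrightarrow> s \<le> n"
  shows "draw_mean m n s \<phi> = (\<Sum>S\<in>samples m n s. \<phi> S :: real) / real (card (samples m n s))"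
  unfolding draw_def using assms by (intro integral_pmf_of_set samples_nonempty finite_samples)

lemma integrable_draw:
  assumes "n \<ge> 1" "m = Without_Replacement \<Longrightarrow> s \<le> n"
  shows "integrable (measure_pmf (draw m n s)) (\<phi> :: _ \<Rightarrow> real)"
  using assms by (intro integrable_measure_pmf_finite) (simp add: draw_def set_pmf_of_set samples_nonempty finite_samples)

lemma expectation_draw_mono:
  assumes "n \<ge> 1" "m = Without_Replacement \<Longrightarrow> s \<le> n"
    and "\<And>S. S \<in> samples m n s \<Longrightarrow> \<phi> S \<le> (\<psi> S :: real)"
  shows "draw_mean m n s \<phi> \<le> draw_mean m n s \<psi>"
  using assms(3)
  by (subst (1 2) expectation_draw[OF assms(1)]) (auto intro!: divide_right_mono sum_mono assms(2))

lemma prob_draw_le_expectation: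
  assumes "n \<ge> 1" "m = Without_Replacement \<Longrightarrow> s \<le> n"
    and "\<And>S. S \<in> samples m n s \<Longrightarrow> 0 \<le> \<phi> S"
    and "\<And>S. S \<in> samples m n s \<Longrightarrow> S \<in> B \<Longrightarrow> c \<le> \<phi> S" and "0 < (c::real)"
  shows "draw_prob m n s B \<le> draw_mean m n s \<phi> / c"
proof -
  have "draw_prob m n s B = draw_mean m n s (indicator B)"
    by simp
  also have "\<dots> \<le> draw_mean m n s (\<lambda>S. \<phi> S / c)"
    using assms by (intro expectation_draw_mono) (auto simp: indicator_def field_simps)
  finally show ?thesis by simp
qed

lemma expectation_draw_replacement_0: "iid_mean n 0 \<phi> = (\<phi> [] :: real)"
proof -
  have "{S. set S \<subseteq> {1..n} \<and> S = []} = {[]}" by auto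
  thus ?thesis by (simp add: draw_def pmf_of_set_singleton)
qed

text \<open>This recursion takes the place of independence of the draws: moments for sampling with
  replacement are obtained by induction along it.\<close>

lemma expectation_draw_replacement_Suc:
  assumes n: "n \<ge> 1"
  shows "iid_mean n (Suc s) \<phi>
    = iid_mean n s (\<lambda>S. (\<Sum>j=1..n. \<phi> (j # S) :: real) / real n)"
proof -
  let ?L = "\<lambda>s. samples With_Replacement n s"
  have e: "?L (Suc s) = (\<lambda>(S, j). j # S) ` (?L s \<times> {1..n})"
    unfolding samples.simps by (rule lists_length_Suc_eq)
  have inj: "inj_on (\<lambda>(S, j). j # S) (?L s \<times> {1..n})" by (auto simp: inj_on_def)
  have c: "card (?L (Suc s)) = card (?L s) * n"
    unfolding e card_image[OF inj] by (simp add: card_cartesian_product)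
  have "(\<Sum>S\<in>?L (Suc s). \<phi> S) = (\<Sum>S\<in>?L s. \<Sum>j=1..n. \<phi> (j # S))"
    unfolding e by (subst sum.reindex[OF inj]) (simp add: sum.cartesian_product case_prod_beta' o_def)
  thus ?thesis
    using n by (subst (1 2) expectation_draw) (auto simp: c sum_divide_distrib[symmetric] simp del: samples.simps)
qed

text \<open>Every set of size \<open>s\<close> is listed by exactly \<open>fact s\<close>
  duplicate-free samples.\<close>

lemma expectation_draw_no_replacement:
  assumes "n \<ge> 1" "s \<le> n"
  shows "draw_mean Without_Replacement n s (\<lambda>S. \<psi> (set S))
    = (\<Sum>J\<in>{J. J \<subseteq> {1..n} \<and> card J = s}. \<psi> J :: real) / real (n choose s)"
proof -
  let ?L = "samples Without_Replacement n s" and ?J = "{J. J \<subseteq> {1..n} \<and> card J = s}"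
  have fJ: "finite ?J" by (rule finite_subset[of _ "Pow {1..n}"]) auto
  have sum: "(\<Sum>S\<in>?L. h (set S)) = fact s * (\<Sum>J\<in>?J. h J)" for h :: "nat set \<Rightarrow> real"
  proof -
    have "(\<Sum>S\<in>?L. h (set S)) = (\<Sum>J\<in>?J. \<Sum>S\<in>{S \<in> ?L. set S = J}. h (set S))"
      by (rule sum.group[symmetric, OF finite_samples fJ]) (auto simp: distinct_card)
    also have "\<dots> = (\<Sum>J\<in>?J. \<Sum>S\<in>permutations_of_set J. h J)"
    proof (intro sum.cong refl)
      fix J assume "J \<in> ?J"
      thus "{S \<in> ?L. set S = J} = permutations_of_set J"
        by (auto simp: permutations_of_set_def distinct_card)
    qed (simp add: permutations_of_set_def)
    also have "\<dots> = (\<Sum>J\<in>?J. fact s * h J)"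
      by (intro sum.cong refl) (auto simp: finite_subset card_permutations_of_set)
    finally show ?thesis by (simp add: sum_distrib_left)
  qed
  have "real (card ?L) = fact s * real (n choose s)"
    using sum[of "\<lambda>_. 1"] n_subsets[of "{1..n}" s] by simp
  thus ?thesis using assms by (subst expectation_draw) (simp_all add: sum del: samples.simps)
qed

section \<open>Hoeffding's comparison of sampling without and with replacement\<close>

lemma sum_subsets_swap:
  assumes "finite A"
  shows "(\<Sum>J\<in>{J. J \<subseteq> A \<and> card J = Suc k}. \<Sum>j\<in>J. g (J - {j}) j)
       = (\<Sum>J\<in>{J. J \<subseteq> A \<and> card J = k}. \<Sum>j\<in>A - J. g J j :: real)"
proof -
  have f: "finite {J. J \<subseteq> A \<and> card J = i}" for i
    using assms by (auto intro: finite_subset[of _ "Pow A"])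
  have fin: "J \<subseteq> A \<Longrightarrow> finite J" for J using assms finite_subset by blast
  \<comment> \<open>Double counting: deleting \<open>j\<close> from a set of size
    \<open>Suc k\<close> is inverse to inserting an outside \<open>j\<close> into a set of size
    \<open>k\<close>.\<close>
  show ?thesis
    using f fin assms
    by (simp add: sum.Sigma)
       (rule sum.reindex_bij_witness[where i = "\<lambda>(J, j). (insert j J, j)" and j = "\<lambda>(J, j). (J - {j}, j)"],
        auto simp: insert_absorb card_insert_if)
qed

text \<open>Dropping \<open>j\<close> and repeating \<open>i\<close>, over the
  \<open>k * Suc k\<close> ordered pairs of distinct indices of \<open>J\<close>, gives vectors
  whose average is \<open>sum X J\<close>; Jensen's inequality does the rest.\<close>

lemma convex_exchange_average:
  fixes X :: "'i \<Rightarrow> 'b::real_vector"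
  assumes \<phi>: "convex_on C \<phi>" and C: "subspace C" "\<And>j. j \<in> J \<Longrightarrow> X j \<in> C" and J: "finite J" "card J = Suc k"
  shows "real k * real (Suc k) * \<phi> (sum X J) \<le> (\<Sum>j\<in>J. \<Sum>i\<in>J - {j}. \<phi> (X i + sum X (J - {j})))"
proof (cases "k = 0")
  case True
  hence "card (J - {j}) = 0" if "j \<in> J" for j using that J by simp
  hence "J - {j} = {}" if "j \<in> J" for j using that J by (metis card_0_eq finite_Diff)
  hence "(\<Sum>j\<in>J. \<Sum>i\<in>J - {j}. \<phi> (X i + sum X (J - {j}))) = 0"
    by (intro sum.neutral ballI) (metis empty_iff)
  thus ?thesis using True by simp
next
  case False
  define P where "P = (SIGMA j:J. J - {j})"
  define w where "w = 1 / (real k * real (Suc k))"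
  have P: "finite P" using J by (simp add: P_def)
  have ck: "card (J - {j}) = k" if "j \<in> J" for j using that J by simp
  have cP: "card P = k * Suc k" using J ck by (simp add: P_def card_SigmaI)
  hence "P \<noteq> {}" using False by auto
  have wP: "(\<Sum>p\<in>P. w) = 1" using False by (simp add: cP w_def del: of_nat_Suc mult_Suc_right)
  define y where "y = (\<lambda>(j, i). X i + sum X (J - {j}))"
  have yC: "y p \<in> C" if "p \<in> P" for p
    using that C by (auto simp: y_def P_def intro!: subspace_add subspace_sum)
  have "(\<Sum>p\<in>P. y p) = (\<Sum>j\<in>J. \<Sum>i\<in>J - {j}. X i + sum X (J - {j}))"
    unfolding P_def y_def using J by (simp add: sum.Sigma)
  also have "\<dots> = (\<Sum>j\<in>J. (real k + 1) *\<^sub>R (sum X J - X j))"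
  proof (rule sum.cong)
    fix j assume j: "j \<in> J"
    have e: "sum X (J - {j}) = sum X J - X j" using j J by (simp add: sum_diff1)
    show "(\<Sum>i\<in>J - {j}. X i + sum X (J - {j})) = (real k + 1) *\<^sub>R (sum X J - X j)"
      by (simp add: sum.distrib ck[OF j] e scaleR_add_left sum_constant_scaleR del: sum_constant)
  qed simp
  also have "\<dots> = (real k + 1) *\<^sub>R (real (Suc k) *\<^sub>R sum X J - sum X J)"
    by (simp add: scaleR_sum_right[symmetric] sum_subtractf J sum_constant_scaleR del: sum_constant)
  also have "\<dots> = (real k * real (Suc k)) *\<^sub>R sum X J"
    by (simp add: scaleR_add_left algebra_simps)
  finally have "sum X J = (\<Sum>p\<in>P. w *\<^sub>R y p)"
    using False by (simp add: scaleR_sum_right[symmetric] w_def)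
  moreover have "\<phi> (\<Sum>p\<in>P. w *\<^sub>R y p) \<le> (\<Sum>p\<in>P. w * \<phi> (y p))"
    by (rule convex_on_sum[OF P \<open>P \<noteq> {}\<close> \<phi> wP]) (simp add: w_def, rule yC)
  ultimately have "\<phi> (sum X J) \<le> w * (\<Sum>p\<in>P. \<phi> (y p))" by (simp add: sum_distrib_left)
  hence "real k * real (Suc k) * \<phi> (sum X J) \<le> (\<Sum>p\<in>P. \<phi> (y p))"
    using False by (simp add: w_def field_simps del: of_nat_Suc)
  also have "\<dots> = (\<Sum>j\<in>J. \<Sum>i\<in>J - {j}. \<phi> (X i + sum X (J - {j})))"
    unfolding P_def y_def using J by (simp add: sum.Sigma case_prod_beta')
  finally show ?thesis .
qed

text \<open>On the right an index \<open>i\<close> is drawn independently of a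
  \<open>k\<close>-subset. If \<open>i\<close> lies outside, the union is a subset of size
  \<open>Suc k\<close>, counted \<open>Suc k\<close> times in all; if it lies inside, the exchange
  inequality gives \<open>k * Suc k * T \<le> (n - k) * U\<close>.\<close>

lemma convex_subset_sum_step:
  fixes X :: "'i \<Rightarrow> 'b::real_vector"
  assumes \<phi>: "convex_on C \<phi>" and C: "subspace C" "\<And>j. j \<in> A \<Longrightarrow> X j \<in> C"
    and A: "finite A" "k < card A"
  shows "(\<Sum>J\<in>{J. J \<subseteq> A \<and> card J = Suc k}. \<phi> (sum X J)) / real (card A choose Suc k)
    \<le> (\<Sum>i\<in>A. (\<Sum>J\<in>{J. J \<subseteq> A \<and> card J = k}. \<phi> (X i + sum X J)) / real (card A choose k)) / real (card A)"
proof -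
  define n where "n = card A"
  define \<J> where "\<J> k = {J. J \<subseteq> A \<and> card J = k}" for k
  define T where "T = (\<Sum>J\<in>\<J> (Suc k). \<phi> (sum X J))"
  define U where "U = (\<Sum>J\<in>\<J> k. \<Sum>i\<in>J. \<phi> (X i + sum X J))"
  have fin: "J \<in> \<J> i \<Longrightarrow> finite J" for i J using A finite_subset by (auto simp: \<J>_def)
  have out: "(\<Sum>J\<in>\<J> k. \<Sum>i\<in>A - J. \<phi> (X i + sum X J)) = real (Suc k) * T"
  proof -
    have "(\<Sum>J\<in>\<J> k. \<Sum>i\<in>A - J. \<phi> (X i + sum X J)) = (\<Sum>J\<in>\<J> (Suc k). \<Sum>j\<in>J. \<phi> (X j + sum X (J - {j})))"
      unfolding \<J>_def using A by (intro sum_subsets_swap[symmetric])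
    also have "\<dots> = (\<Sum>J\<in>\<J> (Suc k). \<Sum>j\<in>J. \<phi> (sum X J))"
      by (intro sum.cong refl arg_cong[where f = \<phi>]) (simp add: fin sum.remove[symmetric])
    also have "\<dots> = real (Suc k) * T" by (simp add: T_def \<J>_def sum_distrib_left)
    finally show ?thesis .
  qed
  have "real k * real (Suc k) * T \<le> (\<Sum>J\<in>\<J> (Suc k). \<Sum>j\<in>J. \<Sum>i\<in>J - {j}. \<phi> (X i + sum X (J - {j})))"
    unfolding T_def sum_distrib_left
    by (intro sum_mono convex_exchange_average[OF \<phi> C(1)]) (auto simp: \<J>_def C intro: finite_subset[OF _ A(1)])
  also have "\<dots> = (\<Sum>J\<in>\<J> k. \<Sum>j\<in>A - J. \<Sum>i\<in>J. \<phi> (X i + sum X J))"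
    unfolding \<J>_def using A by (intro sum_subsets_swap)
  also have "\<dots> = real (n - k) * U"
    unfolding U_def sum_distrib_left
  proof (rule sum.cong[OF refl])
    fix J assume J: "J \<in> \<J> k"
    have "card (A - J) = n - k" using J fin[OF J] by (simp add: \<J>_def n_def card_Diff_subset)
    thus "(\<Sum>j\<in>A - J. \<Sum>i\<in>J. \<phi> (X i + sum X J)) = (\<Sum>i\<in>J. real (n - k) * \<phi> (X i + sum X J))"
      by (simp add: sum_distrib_left)
  qed
  finally have U: "real k * real (Suc k) * T \<le> real (n - k) * U" .
  have "(\<Sum>i\<in>A. \<Sum>J\<in>\<J> k. \<phi> (X i + sum X J)) = (\<Sum>J\<in>\<J> k. \<Sum>i\<in>A. \<phi> (X i + sum X J))"
    by (rule sum.swap)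
  also have "\<dots> = (\<Sum>J\<in>\<J> k. (\<Sum>i\<in>A - J. \<phi> (X i + sum X J)) + (\<Sum>i\<in>J. \<phi> (X i + sum X J)))"
    by (intro sum.cong refl sum.subset_diff) (use A in \<open>auto simp: \<J>_def\<close>)
  also have "\<dots> = real (Suc k) * T + U" by (simp add: sum.distrib out U_def)
  finally have total: "(\<Sum>i\<in>A. \<Sum>J\<in>\<J> k. \<phi> (X i + sum X J)) = real (Suc k) * T + U" .
  have nk: "real (n - k) = real n - real k" "real k < real n" using A by (auto simp: n_def)
  have "Suc k * (n choose Suc k) = (n - k) * (n choose k)"
    by (metis binomial_absorb_comp binomial_absorption mult.commute)
  hence bin: "real (Suc k) * real (n choose Suc k) = (real n - real k) * real (n choose k)"
    using nk by (metis of_nat_mult)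
  have pos: "0 < real (n choose k)" "0 < real (n choose Suc k)" using A by (auto simp: n_def)
  have "real n * real (Suc k) * T \<le> (real n - real k) * (real (Suc k) * T + U)"
    using U nk by (simp add: algebra_simps)
  hence "real (Suc k) * T / (real n - real k) \<le> (real (Suc k) * T + U) / real n"
    using nk by (simp add: field_simps)
  hence "real (Suc k) * T / (real n - real k) / real (n choose k) \<le> (real (Suc k) * T + U) / real n / real (n choose k)"
    using pos by (intro divide_right_mono) auto
  moreover have "real (Suc k) * T / (real n - real k) / real (n choose k) = T / real (n choose Suc k)"
  proof -
    have "real (Suc k) * T / (real n - real k) / real (n choose k)
        = real (Suc k) * T / (real (Suc k) * real (n choose Suc k))"
      unfolding bin by (rule divide_divide_eq_left)
    thus ?thesis by (simp del: of_nat_Suc binomial_Suc_Suc)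
  qed
  ultimately show ?thesis
    unfolding sum_divide_distrib[symmetric] using total
    by (simp add: T_def \<J>_def n_def mult.commute)
qed

text \<open>Hoeffding's comparison, one draw at a time: exchanging a drawn index for another one averages a
  sample with a repeated index to one without, and a convex function can only decrease.\<close>

lemma expectation_no_replacement_le:
  fixes X :: "nat \<Rightarrow> 'b::real_vector"
  assumes \<phi>: "convex_on C \<phi>" and C: "subspace C" "\<And>j. j \<in> {1..n} \<Longrightarrow> X j \<in> C"
    and n: "n \<ge> 1" "m = Without_Replacement \<Longrightarrow> s \<le> n"
  shows "draw_mean m n s (\<lambda>S. \<phi> (\<Sum>j\<leftarrow>S. X j))
     \<le> iid_mean n s (\<lambda>S. \<phi> (\<Sum>j\<leftarrow>S. X j))"
proof (cases m)
  case Without_Replacement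
  have *: "(\<Sum>J\<in>{J. J \<subseteq> {1..n} \<and> card J = s}. \<phi> (sum X J)) / real (n choose s)
     \<le> iid_mean n s (\<lambda>S. \<phi> (\<Sum>j\<leftarrow>S. X j))" if "s \<le> n"
    using \<phi> that
  proof (induction s arbitrary: \<phi>)
    case 0
    have "{J. J \<subseteq> {1..n} \<and> card J = 0} = {{}}" using finite_subset[of _ "{1..n}"] by auto
    thus ?case by (simp add: expectation_draw_replacement_0)
  next
    case (Suc s)
    \<comment> \<open>After conditioning on the first draw \<open>i\<close>, the induction
      hypothesis is applied to the translate of \<open>\<phi>\<close> by \<open>X i\<close>;
      translation stays within \<open>C\<close> because \<open>C\<close> is a subspace.\<close>
    have cvx: "convex_on C (\<lambda>y. \<phi> (X i + y))" if i: "i \<in> {1..n}" for i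
    proof (rule convex_onI)
      show "convex C" using C(1) by (rule subspace_imp_convex)
      fix t :: real and x y assume t: "0 < t" "t < 1" and xy: "x \<in> C" "y \<in> C"
      have "\<phi> ((1 - t) *\<^sub>R (X i + x) + t *\<^sub>R (X i + y)) \<le> (1 - t) * \<phi> (X i + x) + t * \<phi> (X i + y)"
        using t xy i C by (intro convex_onD[OF Suc.prems(1)]) (auto intro: subspace_add)
      moreover have "(1 - t) *\<^sub>R (X i + x) + t *\<^sub>R (X i + y) = X i + ((1 - t) *\<^sub>R x + t *\<^sub>R y)"
        by (simp add: algebra_simps)
      ultimately show "\<phi> (X i + ((1 - t) *\<^sub>R x + t *\<^sub>R y)) \<le> (1 - t) * \<phi> (X i + x) + t * \<phi> (X i + y)" by simp
    qed
    have "(\<Sum>J\<in>{J. J \<subseteq> {1..n} \<and> card J = Suc s}. \<phi> (sum X J)) / real (n choose Suc s)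
      \<le> (\<Sum>i\<in>{1..n}. (\<Sum>J\<in>{J. J \<subseteq> {1..n} \<and> card J = s}. \<phi> (X i + sum X J)) / real (n choose s)) / real n"
      using convex_subset_sum_step[OF Suc.prems(1) C, where A = "{1..n}" and k = s] Suc.prems by simp
    also have "\<dots> \<le> (\<Sum>i\<in>{1..n}. iid_mean n s (\<lambda>S. \<phi> (X i + (\<Sum>j\<leftarrow>S. X j)))) / real n"
      using Suc.prems by (intro divide_right_mono sum_mono Suc.IH cvx) auto
    also have "\<dots> = iid_mean n (Suc s) (\<lambda>S. \<phi> (\<Sum>j\<leftarrow>S. X j))"
      using n(1) by (subst expectation_draw_replacement_Suc, simp, simp,
        subst Bochner_Integration.integral_sum, auto intro!: integrable_draw)
    finally show ?case .
  qed
  have "draw_mean m n s (\<lambda>S. \<phi> (\<Sum>j\<leftarrow>S. X j))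
      = draw_mean m n s (\<lambda>S. \<phi> (sum X (set S)))"
    using n Without_Replacement
    by (subst (1 2) expectation_draw) (auto simp: sum_list_distinct_conv_sum_set intro!: sum.cong arg_cong2[where f = "(/)"])
  thus ?thesis using * n Without_Replacement by (simp add: expectation_draw_no_replacement[where \<psi> = "\<lambda>J. \<phi> (sum X J)"])
qed simp

subsection \<open>The matrix Chernoff bound\<close>

lemma matpow_mat_1: "matpow (mat 1) k = mat 1"
  by (induction k) simp_all

lemma convex_on_trace_power_affine:
  "convex_on {A :: real^'n^'n. transpose A = A} (\<lambda>A. trace (matpow (mat 1 - c *\<^sub>R A) (2 ^ k)))"
proof (rule convex_onI[OF _ convex_symmetric])
  fix t :: real and A B :: "real^'n^'n"
  assume t: "0 < t" "t < 1" and AB: "A \<in> {A. transpose A = A}" "B \<in> {A. transpose A = A}"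
  have "mat 1 - c *\<^sub>R ((1 - t) *\<^sub>R A + t *\<^sub>R B) = (1 - t) *\<^sub>R (mat 1 - c *\<^sub>R A) + t *\<^sub>R (mat 1 - c *\<^sub>R B)"
    by (simp add: algebra_simps)
  thus "trace (matpow (mat 1 - c *\<^sub>R ((1 - t) *\<^sub>R A + t *\<^sub>R B)) (2 ^ k))
      \<le> (1 - t) * trace (matpow (mat 1 - c *\<^sub>R A) (2 ^ k)) + t * trace (matpow (mat 1 - c *\<^sub>R B) (2 ^ k))"
    using convex_onD[OF convex_on_trace_power[of k], of t "mat 1 - c *\<^sub>R A" "mat 1 - c *\<^sub>R B"] t AB
    by (simp add: transpose_diff transpose_scalar)
qed

lemma subspace_symmetric: "subspace {A :: real^'n^'n. transpose A = A}"
  by (auto simp: subspace_def transpose_add transpose_scalar) (simp add: transpose_def vec_eq_iff)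

lemma sum_list_between_0_1:
  fixes Y :: "nat \<Rightarrow> real^'d^'d"
  assumes "\<And>j. j \<in> set S \<Longrightarrow> pos_semidef (Y j) \<and> pos_semidef (mat 1 - Y j)"
  shows "pos_semidef (\<Sum>j\<leftarrow>S. Y j) \<and> pos_semidef (real (length S) *\<^sub>R mat 1 - (\<Sum>j\<leftarrow>S. Y j))
     \<and> norm (\<Sum>j\<leftarrow>S. Y j) \<le> real (length S) * sqrt (real CARD('d))"
  using assms
proof (induction S)
  case (Cons j S)
  have Y: "pos_semidef (Y j)" "pos_semidef (mat 1 - Y j)" using Cons.prems by auto
  have IH: "pos_semidef (\<Sum>j\<leftarrow>S. Y j) \<and> pos_semidef (real (length S) *\<^sub>R mat 1 - (\<Sum>j\<leftarrow>S. Y j))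
     \<and> norm (\<Sum>j\<leftarrow>S. Y j) \<le> real (length S) * sqrt (real CARD('d))" using Cons by simp
  have "norm (Y j ** mat 1) \<le> norm (mat 1 :: real^'d^'d)"
    using pos_semidef_norm_le(2)[of "Y j" 1] Y by (intro norm_contraction_mult_le) simp
  hence "norm (Y j) \<le> sqrt (real CARD('d))" by (simp add: norm_mat_1)
  hence "norm (\<Sum>j\<leftarrow>j # S. Y j) \<le> real (length (j # S)) * sqrt (real CARD('d))"
    using IH norm_triangle_ineq[of "Y j" "\<Sum>j\<leftarrow>S. Y j"] by (simp add: algebra_simps)
  moreover have "real (length (j # S)) *\<^sub>R mat 1 - (\<Sum>j\<leftarrow>j # S. Y j)
      = (mat 1 - Y j) + (real (length S) *\<^sub>R mat 1 - (\<Sum>j\<leftarrow>S. Y j))"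
    by (simp add: algebra_simps)
  ultimately show ?case using IH Y by (simp only:) (simp add: pos_semidef_add)
qed (simp add: pos_semidef_0)

text \<open>Averaging the one-draw bound over \<open>j\<close> replaces \<open>Y j\<close> by the
  mean, which is at least \<nu>; each draw thus multiplies the expected trace by
  \<open>q = 1 - c * \<nu>\<close> up to \<open>err\<close>, and errors only add up since
  \<open>q \<le> 1\<close>. The fixed bound \<open>t\<close> on the sample size keeps
  \<open>err\<close> and the side condition constant during the induction.\<close>

lemma expectation_trace_power_le:
  fixes Y :: "nat \<Rightarrow> real^'d^'d"
  assumes n: "n \<ge> 1"
    and Y: "\<And>j. j \<in> {1..n} \<Longrightarrow> pos_semidef (Y j) \<and> pos_semidef (mat 1 - Y j)"
    and \<nu>: "pos_semidef ((1 / real n) *\<^sub>R (\<Sum>j=1..n. Y j) - \<nu> *\<^sub>R mat 1)" "0 \<le> \<nu>" "\<nu> \<le> 1"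
    and N: "N = 2 ^ Suc k" "0 < \<theta>" "\<theta> * (real t + 1) \<le> real N" and s: "s \<le> t"
  shows "iid_mean n s
      (\<lambda>S. trace (matpow (mat 1 - (\<theta> / N) *\<^sub>R (\<Sum>j\<leftarrow>S. Y j)) N))
    \<le> real CARD('d) * (1 - (1 - (1 - \<theta> / N) ^ N) * \<nu>) ^ s + real s * (\<theta>\<^sup>2 * real CARD('d) * real t / N)"
  using s
proof (induction s)
  case 0
  show ?case by (simp add: expectation_draw_replacement_0 trace_I matpow_mat_1)
next
  case (Suc s)
  define \<phi> where "\<phi> z = trace (matpow (mat 1 - (\<theta> / N) *\<^sub>R z) N)" for z :: "real^'d^'d"
  define c where "c = 1 - (1 - \<theta> / N) ^ N"
  define err where "err = \<theta>\<^sup>2 * real CARD('d) * real t / N"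
  define q where "q = 1 - c * \<nu>"
  let ?E = "iid_mean n s"
  have Npos: "0 < real N" by (simp add: N)
  have "\<theta> \<le> \<theta> * (real t + 1)" using N(2) by (simp add: mult_left_mono)
  hence "\<theta> / N \<le> 1" using N(3) Npos by (simp add: field_simps)
  hence c: "0 \<le> c" "c \<le> 1" using N(2) Npos by (simp_all add: c_def power_le_one)
  hence q: "0 \<le> q" "q \<le> 1" using \<nu> by (simp_all add: q_def mult_le_one)
  have err: "0 \<le> err" by (simp add: err_def)
  have step: "(\<Sum>j=1..n. \<phi> (Y j + (\<Sum>j\<leftarrow>S. Y j))) / real n \<le> q * \<phi> (\<Sum>j\<leftarrow>S. Y j) + err"
    if S: "S \<in> samples With_Replacement n s" for S
  proof -
    let ?S = "\<Sum>j\<leftarrow>S. Y j"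
    have len: "length S = s" "set S \<subseteq> {1..n}" using S by auto
    have ps: "pos_semidef ?S" "pos_semidef (real s *\<^sub>R mat 1 - ?S)" "norm ?S \<le> real s * sqrt (real CARD('d))"
      using sum_list_between_0_1[of S Y, OF Y, OF subsetD[OF len(2)]] len(1) by simp_all
    define A where "A = mat 1 - (\<theta> / N) *\<^sub>R ?S"
    have A: "transpose A = A" using ps(1) by (simp add: A_def transpose_diff transpose_scalar pos_semidef_symmetric)
    have "real s * sqrt (real CARD('d)) \<le> real t * sqrt (real CARD('d))"
      using Suc.prems by (intro mult_right_mono) auto
    hence nS: "norm ?S \<le> real t * sqrt (real CARD('d))" by (rule order_trans[OF ps(3)])
    have "\<theta> * (real s + 1) \<le> \<theta> * (real t + 1)" using Suc.prems N(2) by (intro mult_left_mono) auto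
    hence \<theta>s: "\<theta> * (real s + 1) \<le> real N" using N(3) by simp
    have "\<theta>\<^sup>2 * sqrt (real CARD('d)) * (real t * sqrt (real CARD('d)))
        = \<theta>\<^sup>2 * (sqrt (real CARD('d)) * sqrt (real CARD('d))) * real t"
      by (simp only: mult_ac)
    hence err_eq: "\<theta>\<^sup>2 * sqrt (real CARD('d)) * (real t * sqrt (real CARD('d))) / real N = err"
      by (simp add: err_def)
    have "\<phi> (Y j + ?S) \<le> \<phi> ?S - c * trace (matpow A N ** Y j) + err" if "j \<in> {1..n}" for j
      using trace_power_step[OF ps(1,2) nS conjunct1[OF Y[OF that]] conjunct2[OF Y[OF that]] N(1,2) \<theta>s of_nat_0_le_iff]
      unfolding err_eq \<phi>_def c_def A_def .
    hence "(\<Sum>j=1..n. \<phi> (Y j + ?S)) \<le> (\<Sum>j=1..n. \<phi> ?S - c * trace (matpow A N ** Y j) + err)"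
      by (intro sum_mono) auto
    also have "\<dots> = real n * \<phi> ?S - c * trace (matpow A N ** (\<Sum>j=1..n. Y j)) + real n * err"
      by (simp add: sum.distrib sum_subtractf sum_distrib_left[symmetric] mm.sum_right trace_sum)
    finally have 1: "(\<Sum>j=1..n. \<phi> (Y j + ?S)) / real n
        \<le> \<phi> ?S - c * (trace (matpow A N ** (\<Sum>j=1..n. Y j)) / real n) + err"
      using n by (simp add: field_simps)
    have "0 \<le> trace (matpow A N ** ((1 / real n) *\<^sub>R (\<Sum>j=1..n. Y j) - \<nu> *\<^sub>R mat 1))"
      unfolding N(1) power_Suc by (intro trace_matpow_mult_nonneg A \<nu>)
    also have "\<dots> = trace (matpow A N ** (\<Sum>j=1..n. Y j)) / real n - \<nu> * \<phi> ?S"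
      by (simp add: mm.diff_right mm.scaleR_right trace_sub trace_scaleR \<phi>_def A_def)
    finally have "c * (\<nu> * \<phi> ?S) \<le> c * (trace (matpow A N ** (\<Sum>j=1..n. Y j)) / real n)"
      using c by (intro mult_left_mono) auto
    thus ?thesis using 1 by (simp add: q_def algebra_simps)
  qed
  have "iid_mean n (Suc s) (\<lambda>S. \<phi> (\<Sum>j\<leftarrow>S. Y j))
      = ?E (\<lambda>S. (\<Sum>j=1..n. \<phi> (Y j + (\<Sum>j\<leftarrow>S. Y j))) / real n)"
    using n by (simp add: expectation_draw_replacement_Suc)
  also have "\<dots> \<le> ?E (\<lambda>S. q * \<phi> (\<Sum>j\<leftarrow>S. Y j) + err)"
    using step n by (intro expectation_draw_mono) auto
  also have "\<dots> = q * ?E (\<lambda>S. \<phi> (\<Sum>j\<leftarrow>S. Y j)) + err"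
    using n by (subst Bochner_Integration.integral_add) (auto intro!: integrable_draw)
  also have "\<dots> \<le> q * (real CARD('d) * q ^ s + real s * err) + err"
    using Suc q by (intro add_right_mono mult_left_mono) (auto simp: \<phi>_def q_def c_def err_def)
  also have "\<dots> \<le> real CARD('d) * q ^ Suc s + real (Suc s) * err"
    using mult_right_mono[OF q(2), of "real s * err"] err by (simp add: algebra_simps)
  finally show ?case by (simp add: \<phi>_def q_def c_def err_def)
qed

lemma pow_two_limit: "(\<lambda>k. (1 + x / real (2 ^ Suc k)) ^ (2 ^ Suc k)) \<longlonglongrightarrow> exp (x :: real)"
proof -
  have "filterlim (\<lambda>k. 2 ^ Suc k :: nat) sequentially sequentially"
    by (intro filterlim_subseq) (auto simp: strict_mono_def)
  from filterlim_compose[OF tendsto_exp_limit_sequentially[of x] this] show ?thesis .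
qed

text \<open>The traces of the powers \<open>(1 - \<theta> Z / N)\<^sup>N\<close>, with \<open>N\<close> a power of two, replace the
  trace of the matrix exponential; the error of order \<open>1 / N\<close> vanishes in the limit.\<close>

lemma matrix_chernoff:
  fixes Y :: "nat \<Rightarrow> real^'d^'d"
  assumes n: "n \<ge> 1" "m = Without_Replacement \<Longrightarrow> s \<le> n"
    and Y: "\<And>j. j \<in> {1..n} \<Longrightarrow> pos_semidef (Y j) \<and> pos_semidef (mat 1 - Y j)"
    and \<nu>: "pos_semidef ((1 / real n) *\<^sub>R (\<Sum>j=1..n. Y j) - \<nu> *\<^sub>R mat 1)" "0 \<le> \<nu>" "\<nu> \<le> 1"
    and \<theta>: "0 < \<theta>"
  shows "draw_prob m n s {S. \<exists>v. norm v = 1 \<and> v \<bullet> ((\<Sum>j\<leftarrow>S. Y j) *v v) \<le> t}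
    \<le> real CARD('d) * exp (\<theta> * t - (1 - exp (- \<theta>)) * \<nu> * real s)"
proof -
  let ?P = "draw_prob m n s {S. \<exists>v. norm v = 1 \<and> v \<bullet> ((\<Sum>j\<leftarrow>S. Y j) *v v) \<le> t}"
  let ?N = "\<lambda>k. 2 ^ Suc k :: nat"
  let ?R = "\<lambda>k. real CARD('d) * (1 - (1 - (1 + (- \<theta>) / ?N k) ^ ?N k) * \<nu>) ^ s + real s * (\<theta>\<^sup>2 * real CARD('d) * real s / ?N k)"
  have lim: "filterlim (\<lambda>k. real (?N k)) at_top sequentially"
    by (rule filterlim_compose[OF filterlim_real_sequentially filterlim_subseq]) (auto simp: strict_mono_def)
  have bound: "?P * (1 + (- \<theta> * t) / ?N k) ^ ?N k
      \<le> ?R k"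
    if big: "\<theta> * (real s + 1) \<le> real (?N k)" "\<theta> * \<bar>t\<bar> < real (?N k)" for k
  proof -
    let ?\<phi> = "\<lambda>Z :: real^'d^'d. trace (matpow (mat 1 - (\<theta> / ?N k) *\<^sub>R Z) (?N k))"
    \<comment> \<open>On the event, some unit vector has Rayleigh quotient at least \<open>b\<close>
      for the matrix inside the power, so the trace is at least \<open>b ^ N\<close> and Markov's
      inequality applies. For large \<open>N\<close>, \<open>b\<close> is positive.\<close>
    define b where "b = 1 + (- \<theta> * t) / ?N k"
    have "\<theta> * t \<le> \<theta> * \<bar>t\<bar>" using \<theta> by simp
    hence b: "0 < b" using big(2) by (simp add: b_def field_simps)
    have psd: "pos_semidef (mat 1 - (\<theta> / ?N k) *\<^sub>R (\<Sum>j\<leftarrow>S. Y j))" if "S \<in> samples m n s" for S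
    proof -
      have S: "length S = s" "set S \<subseteq> {1..n}" using that by (cases m; simp)+
      have p: "pos_semidef (real s *\<^sub>R mat 1 - (\<Sum>j\<leftarrow>S. Y j))"
        using sum_list_between_0_1[of S Y, OF Y, OF subsetD[OF S(2)]] S(1) by simp
      have "\<theta> * real s \<le> \<theta> * (real s + 1)" using \<theta> by simp
      hence le: "\<theta> / ?N k * real s \<le> 1" using big(1) by (simp add: field_simps)
      have "mat 1 - (\<theta> / ?N k) *\<^sub>R (\<Sum>j\<leftarrow>S. Y j)
          = (1 - \<theta> / ?N k * real s) *\<^sub>R mat 1 + (\<theta> / ?N k) *\<^sub>R (real s *\<^sub>R mat 1 - (\<Sum>j\<leftarrow>S. Y j))"
        by (simp add: scaleR_diff_right scaleR_diff_left)
      also have "pos_semidef \<dots>"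
        using \<theta> le p by (intro pos_semidef_add pos_semidef_scaleR pos_semidef_mat_1) auto
      finally show ?thesis .
    qed
    have "?P \<le> draw_mean m n s (\<lambda>S. ?\<phi> (\<Sum>j\<leftarrow>S. Y j)) / b ^ ?N k"
    proof (rule prob_draw_le_expectation[OF n])
      fix S assume S: "S \<in> samples m n s"
      show "0 \<le> ?\<phi> (\<Sum>j\<leftarrow>S. Y j)"
        using trace_matpow_mult_nonneg[of "mat 1 - (\<theta> / ?N k) *\<^sub>R (\<Sum>j\<leftarrow>S. Y j)" "mat 1" "2 ^ k"] psd[OF S]
        by (simp add: pos_semidef_symmetric pos_semidef_mat_1)
      assume "S \<in> {S. \<exists>v. norm v = 1 \<and> v \<bullet> ((\<Sum>j\<leftarrow>S. Y j) *v v) \<le> t}"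
      then obtain v where v: "norm v = 1" "v \<bullet> ((\<Sum>j\<leftarrow>S. Y j) *v v) \<le> t" by blast
      have "v \<bullet> v = 1" using v(1) by (simp add: dot_square_norm)
      hence e: "v \<bullet> ((mat 1 - (\<theta> / ?N k) *\<^sub>R (\<Sum>j\<leftarrow>S. Y j)) *v v) = 1 - \<theta> / ?N k * (v \<bullet> ((\<Sum>j\<leftarrow>S. Y j) *v v))"
        by (simp add: matrix_vector_mult_diff_rdistrib inner_diff_right scaleR_matrix_vector_assoc[symmetric])
      have "\<theta> / ?N k * (v \<bullet> ((\<Sum>j\<leftarrow>S. Y j) *v v)) \<le> \<theta> / ?N k * t"
        using v(2) \<theta> by (intro mult_left_mono) auto
      hence "b \<le> v \<bullet> ((mat 1 - (\<theta> / ?N k) *\<^sub>R (\<Sum>j\<leftarrow>S. Y j)) *v v)" unfolding e b_def by simp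
      hence "b ^ ?N k \<le> (v \<bullet> ((mat 1 - (\<theta> / ?N k) *\<^sub>R (\<Sum>j\<leftarrow>S. Y j)) *v v)) ^ ?N k"
        using b by (intro power_mono) auto
      also have "\<dots> \<le> ?\<phi> (\<Sum>j\<leftarrow>S. Y j)" by (rule trace_matpow_ge[OF psd[OF S] v(1)])
      finally show "b ^ ?N k \<le> ?\<phi> (\<Sum>j\<leftarrow>S. Y j)" .
    qed (use b in auto)
    hence "?P * b ^ ?N k \<le> draw_mean m n s (\<lambda>S. ?\<phi> (\<Sum>j\<leftarrow>S. Y j))"
      using b by (simp add: field_simps)
    also have "\<dots> \<le> iid_mean n s (\<lambda>S. ?\<phi> (\<Sum>j\<leftarrow>S. Y j))"
      using Y n by (intro expectation_no_replacement_le[OF convex_on_trace_power_affine subspace_symmetric])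
                   (auto simp: pos_semidef_symmetric)
    also have "\<dots> \<le> real CARD('d) * (1 - (1 - (1 - \<theta> / ?N k) ^ ?N k) * \<nu>) ^ s + real s * (\<theta>\<^sup>2 * real CARD('d) * real s / ?N k)"
      by (rule expectation_trace_power_le[OF n(1) Y \<nu> refl \<theta> big(1) order_refl])
    finally show ?thesis by (simp add: b_def)
  qed
  have lim1: "(\<lambda>k. ?P * (1 + (- \<theta> * t) / ?N k) ^ ?N k) \<longlonglongrightarrow> ?P * exp (- \<theta> * t)"
    by (intro tendsto_intros pow_two_limit)
  have "(\<lambda>k. \<theta>\<^sup>2 * real CARD('d) * real s / ?N k) \<longlonglongrightarrow> 0"
    by (rule real_tendsto_divide_at_top[OF tendsto_const lim])
  hence lim2: "(\<lambda>k. ?R k)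
      \<longlonglongrightarrow> real CARD('d) * (1 - (1 - exp (- \<theta>)) * \<nu>) ^ s + real s * 0"
    by (intro tendsto_intros pow_two_limit)
  have "\<forall>\<^sub>F k in sequentially. \<theta> * (real s + 1) \<le> real (?N k)"
    using lim unfolding filterlim_at_top by blast
  moreover have "\<forall>\<^sub>F k in sequentially. \<theta> * \<bar>t\<bar> < real (?N k)"
    using lim unfolding filterlim_at_top_dense by blast
  ultimately have ev: "\<forall>\<^sub>F k in sequentially. ?P * (1 + (- \<theta> * t) / ?N k) ^ ?N k
      \<le> ?R k"
    by eventually_elim (rule bound)
  have "?P * exp (- \<theta> * t) \<le> real CARD('d) * (1 - (1 - exp (- \<theta>)) * \<nu>) ^ s + real s * 0"
    by (rule tendsto_le[OF sequentially_bot lim2 lim1 ev])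
  also have "\<dots> \<le> real CARD('d) * exp (- ((1 - exp (- \<theta>)) * \<nu>)) ^ s"
  proof -
    have "0 \<le> (1 - exp (- \<theta>)) * \<nu>" "(1 - exp (- \<theta>)) * \<nu> \<le> 1"
      using \<theta> \<nu> by (auto intro: mult_le_one)
    thus ?thesis using exp_ge_add_one_self[of "- ((1 - exp (- \<theta>)) * \<nu>)"]
      by (auto intro!: mult_left_mono power_mono)
  qed
  also have "\<dots> = real CARD('d) * exp (- ((1 - exp (- \<theta>)) * \<nu> * real s))"
    by (simp add: exp_of_nat_mult[symmetric] mult_ac)
  finally have "?P * exp (- \<theta> * t) * exp (\<theta> * t)
      \<le> real CARD('d) * exp (- ((1 - exp (- \<theta>)) * \<nu> * real s)) * exp (\<theta> * t)"
    by (intro mult_right_mono) auto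
  moreover have "exp (- \<theta> * t) * exp (\<theta> * t) = 1" by (simp flip: exp_add)
  moreover have "exp (- ((1 - exp (- \<theta>)) * \<nu> * real s)) * exp (\<theta> * t) = exp (\<theta> * t - (1 - exp (- \<theta>)) * \<nu> * real s)"
    by (simp flip: exp_add)
  ultimately show ?thesis by (simp only: mult.assoc mult_1_right)
qed

subsection \<open>Concentration of sample means\<close>

text \<open>Conditioning on the first draw, the cross term vanishes because the vectors sum to
  0.\<close>

lemma expectation_draw_norm_sq:
  fixes w :: "nat \<Rightarrow> 'b::real_inner"
  assumes n: "n \<ge> 1" and w: "(\<Sum>j=1..n. w j) = 0"
  shows "iid_mean n s (\<lambda>S. (norm (\<Sum>j\<leftarrow>S. w j))\<^sup>2)
     = real s * ((\<Sum>j=1..n. (norm (w j))\<^sup>2) / real n)"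
proof (induction s)
  case (Suc s)
  define V where "V = (\<Sum>j=1..n. (norm (w j))\<^sup>2) / real n"
  have "(\<Sum>j=1..n. (norm (w j + z))\<^sup>2) / real n = V + (norm z)\<^sup>2" for z
  proof -
    have "(\<Sum>j=1..n. (norm (w j + z))\<^sup>2) = (\<Sum>j=1..n. (norm (w j))\<^sup>2 + 2 * (w j \<bullet> z) + (norm z)\<^sup>2)"
      by (intro sum.cong refl) (simp add: power2_norm_eq_inner inner_add_left inner_add_right inner_commute)
    also have "\<dots> = (\<Sum>j=1..n. (norm (w j))\<^sup>2) + 2 * ((\<Sum>j=1..n. w j) \<bullet> z) + real n * (norm z)\<^sup>2"
      by (simp add: sum.distrib inner_sum_left sum_distrib_left)
    finally show ?thesis using n w by (simp add: V_def add_divide_distrib)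
  qed
  hence "iid_mean n (Suc s) (\<lambda>S. (norm (\<Sum>j\<leftarrow>S. w j))\<^sup>2)
      = iid_mean n s (\<lambda>S. V + (norm (\<Sum>j\<leftarrow>S. w j))\<^sup>2)"
    using n by (simp add: expectation_draw_replacement_Suc)
  also have "\<dots> = V + real s * V"
    using n Suc by (subst Bochner_Integration.integral_add) (auto intro!: integrable_draw simp: V_def)
  finally show ?case unfolding V_def[symmetric] by (simp add: algebra_simps)
qed (simp add: expectation_draw_replacement_0)

lemma sum_norm_sq_deviation:
  fixes v :: "nat \<Rightarrow> 'b::real_inner"
  assumes n: "n \<ge> 1" and \<mu>: "\<mu> = (1 / real n) *\<^sub>R (\<Sum>j=1..n. v j)"
  shows "(\<Sum>j=1..n. v j - \<mu>) = 0"
    and "(\<Sum>j=1..n. (norm (v j - \<mu>))\<^sup>2) / real n = (\<Sum>j=1..n. (norm (v j))\<^sup>2) / real n - (norm \<mu>)\<^sup>2"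
proof -
  have s: "(\<Sum>j=1..n. v j) = real n *\<^sub>R \<mu>" using n by (simp add: \<mu>)
  show "(\<Sum>j=1..n. v j - \<mu>) = 0"
    using s by (simp add: sum_subtractf sum_constant_scaleR del: sum_constant)
  have "(\<Sum>j=1..n. (norm (v j - \<mu>))\<^sup>2) = (\<Sum>j=1..n. (norm (v j))\<^sup>2 - 2 * (v j \<bullet> \<mu>) + (norm \<mu>)\<^sup>2)"
    by (intro sum.cong refl) (simp add: power2_norm_eq_inner inner_diff_left inner_diff_right inner_commute)
  also have "\<dots> = (\<Sum>j=1..n. (norm (v j))\<^sup>2) - 2 * ((\<Sum>j=1..n. v j) \<bullet> \<mu>) + real n * (norm \<mu>)\<^sup>2"
    by (simp add: sum.distrib sum_subtractf inner_sum_left sum_distrib_left)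
  also have "\<dots> = (\<Sum>j=1..n. (norm (v j))\<^sup>2) - real n * (norm \<mu>)\<^sup>2"
    unfolding s by (simp add: power2_norm_eq_inner)
  finally show "(\<Sum>j=1..n. (norm (v j - \<mu>))\<^sup>2) / real n = (\<Sum>j=1..n. (norm (v j))\<^sup>2) / real n - (norm \<mu>)\<^sup>2"
    using n by (simp add: diff_divide_distrib)
qed

lemma sample_mean_diff:
  assumes "S \<noteq> []"
  shows "sample_mean v S - \<mu> = (1 / real (length S)) *\<^sub>R (\<Sum>j\<leftarrow>S. v j - \<mu>)"
proof -
  have "(\<Sum>j\<leftarrow>S. v j - \<mu>) = (\<Sum>j\<leftarrow>S. v j) - real (length S) *\<^sub>R \<mu>"
    by (induction S) (simp_all add: algebra_simps)
  thus ?thesis using assms by (simp add: sample_mean_def scaleR_diff_right)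
qed

lemma expectation_sample_mean_deviation:
  fixes v :: "nat \<Rightarrow> 'b::real_inner"
  assumes n: "n \<ge> 1" "s \<ge> 1" and \<mu>: "\<mu> = (1 / real n) *\<^sub>R (\<Sum>j=1..n. v j)"
  shows "iid_mean n s (\<lambda>S. (norm (sample_mean v S - \<mu>))\<^sup>2)
     = ((\<Sum>j=1..n. (norm (v j))\<^sup>2) / real n - (norm \<mu>)\<^sup>2) / real s"
proof -
  have "iid_mean n s (\<lambda>S. (norm (sample_mean v S - \<mu>))\<^sup>2)
     = iid_mean n s (\<lambda>S. (norm (\<Sum>j\<leftarrow>S. v j - \<mu>))\<^sup>2 / (real s)\<^sup>2)"
  proof (intro antisym expectation_draw_mono n)
    fix S assume "S \<in> samples With_Replacement n s"
    hence "S \<noteq> []" "length S = s" using n by auto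
    thus "(norm (sample_mean v S - \<mu>))\<^sup>2 \<le> (norm (\<Sum>j\<leftarrow>S. v j - \<mu>))\<^sup>2 / (real s)\<^sup>2"
      "(norm (sample_mean v S - \<mu>))\<^sup>2 \<ge> (norm (\<Sum>j\<leftarrow>S. v j - \<mu>))\<^sup>2 / (real s)\<^sup>2"
      by (simp_all add: sample_mean_diff power_divide)
  qed simp_all
  also have "\<dots> = real s * ((\<Sum>j=1..n. (norm (v j - \<mu>))\<^sup>2) / real n) / (real s)\<^sup>2"
    using expectation_draw_norm_sq[OF n(1) sum_norm_sq_deviation(1)[OF n(1) \<mu>], of s] by simp
  finally show ?thesis
    using n by (simp only: sum_norm_sq_deviation(2)[OF n(1) \<mu>]) (simp add: power2_eq_square)
qed

section \<open>Exponential moments and McDiarmid's inequality\<close>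

lemma Hoeffdings_lemma_uniform:
  fixes h :: "nat \<Rightarrow> real"
  assumes n: "n \<ge> 1" and h: "\<And>i j. i \<in> {1..n} \<Longrightarrow> j \<in> {1..n} \<Longrightarrow> h i - h j \<le> D" and l: "l > 0"
  shows "(\<Sum>j=1..n. exp (l * h j)) / real n \<le> exp (l * ((\<Sum>j=1..n. h j) / real n) + l\<^sup>2 * D\<^sup>2 / 8)"
proof -
  define M where "M = measure_pmf (pmf_of_set {1..n})"
  \<comment> \<open>Only differences of \<open>h\<close> are bounded, so the interval for
    Hoeffding's lemma is anchored at the minimum.\<close>
  define a where "a = Min (h ` {1..n})"
  have ne: "h ` {1..n} \<noteq> {}" using n by simp
  have "a \<in> h ` {1..n}" unfolding a_def using ne by (intro Min_in) auto
  then obtain i0 where i0: "i0 \<in> {1..n}" "h i0 = a" by auto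
  have ab: "h j \<in> {a..a + D}" if "j \<in> {1..n}" for j
    using that h[of j i0] i0 by (auto simp: a_def)
  interpret interval_bounded_random_variable M h a "a + D"
    unfolding M_def using ab n
    by unfold_locales (auto simp: AE_measure_pmf_iff set_pmf_of_set measure_pmf.prob_space_axioms
        measure_pmf.emeasure_space_1)
  define \<mu> where "\<mu> = (\<Sum>j=1..n. h j) / real n"
  have E: "measure_pmf.expectation (pmf_of_set {1..n}) g = (\<Sum>j=1..n. g j) / real n" for g :: "nat \<Rightarrow> real"
    using n by (simp add: integral_pmf_of_set)
  have "expectation h = \<mu>" unfolding M_def \<mu>_def by (rule E)
  hence *: "nn_integral M (\<lambda>x. exp (l * (h x - \<mu>))) \<le> ennreal (exp (l\<^sup>2 * D\<^sup>2 / 8))"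
    using Hoeffdings_lemma_nn_integral[OF l] by simp
  have "nn_integral M (\<lambda>x. exp (l * (h x - \<mu>))) = ennreal (expectation (\<lambda>x. exp (l * (h x - \<mu>))))"
    unfolding M_def using n
    by (intro nn_integral_eq_integral integrable_measure_pmf_finite) (auto simp: set_pmf_of_set)
  hence "expectation (\<lambda>x. exp (l * (h x - \<mu>))) \<le> exp (l\<^sup>2 * D\<^sup>2 / 8)"
    using * by (simp add: ennreal_le_iff)
  hence "(\<Sum>j=1..n. exp (l * (h j - \<mu>))) / real n \<le> exp (l\<^sup>2 * D\<^sup>2 / 8)"
    unfolding M_def E .
  also have "(\<Sum>j=1..n. exp (l * (h j - \<mu>))) = (\<Sum>j=1..n. exp (l * h j)) * exp (- l * \<mu>)"
    unfolding sum_distrib_right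
    by (intro sum.cong refl) (simp add: exp_add[symmetric] right_diff_distrib)
  finally have "(\<Sum>j=1..n. exp (l * h j)) / real n * exp (- l * \<mu>) \<le> exp (l\<^sup>2 * D\<^sup>2 / 8)" by simp
  hence "(\<Sum>j=1..n. exp (l * h j)) / real n * exp (- l * \<mu>) * exp (l * \<mu>) \<le> exp (l\<^sup>2 * D\<^sup>2 / 8) * exp (l * \<mu>)"
    by (intro mult_right_mono) auto
  moreover have "exp (- l * \<mu>) * exp (l * \<mu>) = 1" by (simp flip: exp_add)
  ultimately have "(\<Sum>j=1..n. exp (l * h j)) / real n \<le> exp (l\<^sup>2 * D\<^sup>2 / 8) * exp (l * \<mu>)"
    by (simp only: mult.assoc mult_1_right)
  thus ?thesis unfolding \<mu>_def[symmetric] by (simp add: exp_add mult.commute)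
qed

text \<open>McDiarmid's martingale argument for the norm of a sum: conditioning on the first draw, the
  conditional expectation of the norm varies by at most \<open>D\<close>.\<close>

lemma expectation_exp_norm_sum_le:
  fixes w :: "nat \<Rightarrow> 'b::real_normed_vector"
  assumes n: "n \<ge> 1" and w: "\<And>i j. i \<in> {1..n} \<Longrightarrow> j \<in> {1..n} \<Longrightarrow> norm (w i - w j) \<le> D" and l: "l > 0"
  shows "iid_mean n s (\<lambda>S. exp (l * norm (c + (\<Sum>j\<leftarrow>S. w j))))
    \<le> exp (l * iid_mean n s (\<lambda>S. norm (c + (\<Sum>j\<leftarrow>S. w j))) + real s * (l\<^sup>2 * D\<^sup>2 / 8))"
\<comment> \<open>The offset \<open>c\<close> collects the draws already conditioned on.\<close>
proof (induction s arbitrary: c)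
  case (Suc s)
  let ?E = "iid_mean n s"
  define h where "h j = ?E (\<lambda>S. norm (c + w j + (\<Sum>j\<leftarrow>S. w j)))" for j
  have int: "integrable (measure_pmf (draw With_Replacement n s)) \<phi>" for \<phi> :: "_ \<Rightarrow> real"
    using n by (intro integrable_draw) auto
  have hD: "h i - h j \<le> D" if "i \<in> {1..n}" "j \<in> {1..n}" for i j
  proof -
    have "h i \<le> ?E (\<lambda>S. norm (c + w j + (\<Sum>j\<leftarrow>S. w j)) + D)"
      unfolding h_def
    proof (intro expectation_draw_mono n)
      fix S
      have "norm (c + w i + (\<Sum>j\<leftarrow>S. w j)) \<le> norm (c + w j + (\<Sum>j\<leftarrow>S. w j)) + norm (w i - w j)"
        using norm_triangle_ineq[of "c + w j + (\<Sum>j\<leftarrow>S. w j)" "w i - w j"] by (simp add: algebra_simps)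
      thus "norm (c + w i + (\<Sum>j\<leftarrow>S. w j)) \<le> norm (c + w j + (\<Sum>j\<leftarrow>S. w j)) + D"
        using w[OF that] by simp
    qed auto
    also have "\<dots> = h j + D" by (simp add: h_def int)
    finally show ?thesis by simp
  qed
  have "iid_mean n (Suc s) (\<lambda>S. exp (l * norm (c + (\<Sum>j\<leftarrow>S. w j))))
      = (\<Sum>j=1..n. ?E (\<lambda>S. exp (l * norm (c + w j + (\<Sum>j\<leftarrow>S. w j))))) / real n"
    using n by (simp add: expectation_draw_replacement_Suc Bochner_Integration.integral_sum int add.assoc)
  also have "\<dots> \<le> (\<Sum>j=1..n. exp (l * h j + real s * (l\<^sup>2 * D\<^sup>2 / 8))) / real n"
    unfolding h_def by (intro divide_right_mono sum_mono Suc.IH) auto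
  also have "\<dots> = (\<Sum>j=1..n. exp (l * h j)) / real n * exp (real s * (l\<^sup>2 * D\<^sup>2 / 8))"
    by (simp add: exp_add sum_distrib_right)
  also have "\<dots> \<le> exp (l * ((\<Sum>j=1..n. h j) / real n) + l\<^sup>2 * D\<^sup>2 / 8) * exp (real s * (l\<^sup>2 * D\<^sup>2 / 8))"
    by (intro mult_right_mono Hoeffdings_lemma_uniform n hD l) auto
  also have "\<dots> = exp (l * ((\<Sum>j=1..n. h j) / real n) + real (Suc s) * (l\<^sup>2 * D\<^sup>2 / 8))"
    by (simp add: exp_add[symmetric] algebra_simps)
  also have "(\<Sum>j=1..n. h j) / real n = iid_mean n (Suc s) (\<lambda>S. norm (c + (\<Sum>j\<leftarrow>S. w j)))"
    using n by (simp add: h_def expectation_draw_replacement_Suc Bochner_Integration.integral_sum int add.assoc)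
  finally show ?case .
qed (simp add: expectation_draw_replacement_0)

lemma expectation_le_sqrt_second_moment:
  fixes Z :: "'a \<Rightarrow> real"
  assumes "integrable (measure_pmf p) Z" "integrable (measure_pmf p) (\<lambda>x. (Z x)\<^sup>2)"
  shows "measure_pmf.expectation p Z \<le> sqrt (measure_pmf.expectation p (\<lambda>x. (Z x)\<^sup>2))"
proof -
  have "0 \<le> measure_pmf.variance p Z" by (rule measure_pmf.variance_positive)
  also have "\<dots> = measure_pmf.expectation p (\<lambda>x. (Z x)\<^sup>2) - (measure_pmf.expectation p Z)\<^sup>2"
    using assms by (rule measure_pmf.variance_eq)
  finally show ?thesis by (intro real_le_rsqrt) simp
qed

text \<open>\<open>G / sqrt (real s)\<close> bounds the expected deviation through the second
  moment, and \<tau> is the excess controlled by the exponential moment. Exchanging one draw moves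
  the sum by at most \<open>2 * G\<close>.\<close>

lemma prob_sample_mean_deviation:
  fixes v :: "nat \<Rightarrow> 'b::real_inner"
  assumes n: "n \<ge> 1" "s \<ge> 1" and \<mu>: "\<mu> = (1 / real n) *\<^sub>R (\<Sum>j=1..n. v j)"
    and G: "\<And>j. j \<in> {1..n} \<Longrightarrow> norm (v j) \<le> G" "0 < G"
    and \<tau>: "0 < \<tau>" "G / sqrt (real s) + \<tau> \<le> \<epsilon>"
  shows "iid_prob n s {S. \<epsilon> < norm (sample_mean v S - \<mu>)}
      \<le> exp (- \<tau>\<^sup>2 * real s / (2 * G\<^sup>2))"
proof -
  let ?p = "draw With_Replacement n s" and ?E = "iid_mean n s"
  define w where "w j = v j - \<mu>" for j
  define Z where "Z S = norm (\<Sum>j\<leftarrow>S. w j)" for S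
  \<comment> \<open>The minimiser of the exponent
    \<open>- l s \<tau> + s l^2 G^2 / 2\<close>.\<close>
  define l where "l = \<tau> / G\<^sup>2"
  have l: "0 < l" using \<tau> G by (simp add: l_def)
  have int: "integrable (measure_pmf ?p) \<phi>" for \<phi> :: "_ \<Rightarrow> real"
    using n by (intro integrable_draw) auto
  have "(\<Sum>j=1..n. (norm (w j))\<^sup>2) / real n \<le> (\<Sum>j=1..n. (norm (v j))\<^sup>2) / real n"
    unfolding w_def sum_norm_sq_deviation(2)[OF n(1) \<mu>] by simp
  also have "\<dots> \<le> (\<Sum>j=1..n. G\<^sup>2) / real n"
    using G by (intro divide_right_mono sum_mono power_mono) auto
  finally have V: "(\<Sum>j=1..n. (norm (w j))\<^sup>2) / real n \<le> G\<^sup>2" using n by simp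
  have "?E (\<lambda>S. (Z S)\<^sup>2) \<le> real s * G\<^sup>2"
    using mult_left_mono[OF V, of "real s"] expectation_draw_norm_sq[OF n(1) sum_norm_sq_deviation(1)[OF n(1) \<mu>], of s]
    by (simp add: Z_def w_def)
  hence "?E Z \<le> sqrt (real s * G\<^sup>2)"
    using expectation_le_sqrt_second_moment[OF int int, of Z] real_sqrt_le_mono order_trans by blast
  also have "\<dots> = real s / sqrt (real s) * G" using G n by (simp add: real_sqrt_mult real_div_sqrt)
  also have "\<dots> = real s * (G / sqrt (real s))" by simp
  finally have EZ: "?E Z \<le> real s * (G / sqrt (real s))" .
  have wD: "norm (w i - w j) \<le> 2 * G" if "i \<in> {1..n}" "j \<in> {1..n}" for i j
    using norm_triangle_ineq4[of "v i" "v j"] G(1)[OF that(1)] G(1)[OF that(2)] by (simp add: w_def)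
  have "measure_pmf.prob ?p {S. \<epsilon> < norm (sample_mean v S - \<mu>)} \<le> ?E (\<lambda>S. exp (l * Z S)) / exp (l * (real s * \<epsilon>))"
  proof (rule prob_draw_le_expectation[OF n(1)])
    fix S assume S: "S \<in> samples With_Replacement n s" "S \<in> {S. \<epsilon> < norm (sample_mean v S - \<mu>)}"
    hence "S \<noteq> []" "length S = s" using n by auto
    hence "norm (sample_mean v S - \<mu>) = Z S / real s" by (simp add: sample_mean_diff Z_def w_def)
    hence "Z S = real s * norm (sample_mean v S - \<mu>)" using n by (simp add: field_simps)
    hence "real s * \<epsilon> \<le> Z S" using S by (auto intro: mult_left_mono)
    thus "exp (l * (real s * \<epsilon>)) \<le> exp (l * Z S)" using l by simp
  qed auto
  also have "\<dots> \<le> exp (l * ?E Z + real s * (l\<^sup>2 * (2 * G)\<^sup>2 / 8)) / exp (l * (real s * \<epsilon>))"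
    using expectation_exp_norm_sum_le[where w = w and D = "2 * G" and l = l and s = s and c = 0, OF n(1) wD l]
    by (intro divide_right_mono) (auto simp: Z_def[abs_def])
  also have "\<dots> = exp (l * ?E Z + real s * (l\<^sup>2 * (2 * G)\<^sup>2 / 8) - l * (real s * \<epsilon>))"
    by (simp add: exp_diff)
  also have "\<dots> \<le> exp (l * (real s * (\<epsilon> - \<tau>)) + real s * (l\<^sup>2 * (2 * G)\<^sup>2 / 8) - l * (real s * \<epsilon>))"
  proof -
    have "real s * (G / sqrt (real s)) \<le> real s * (\<epsilon> - \<tau>)" using \<tau> by (intro mult_left_mono) auto
    thus ?thesis using EZ l by simp
  qed
  also have "l * (real s * (\<epsilon> - \<tau>)) + real s * (l\<^sup>2 * (2 * G)\<^sup>2 / 8) - l * (real s * \<epsilon>) = - \<tau>\<^sup>2 * real s / (2 * G\<^sup>2)"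
    using G by (simp add: l_def power2_eq_square field_simps)
  finally show ?thesis .
qed

section \<open>Averages of the largest values\<close>

lemma sum_list_map_descending:
  "(\<Sum>x\<leftarrow>rev (sort (map Ks [1..<Suc n])). g x) = (\<Sum>j=1..n. g (Ks j) :: real)"
proof -
  have "(\<Sum>x\<leftarrow>rev (sort (map Ks [1..<Suc n])). g x) = sum_mset (image_mset g (mset (rev (sort (map Ks [1..<Suc n])))))"
    by (metis mset_map sum_mset_sum_list)
  also have "mset (rev (sort (map Ks [1..<Suc n]))) = mset (map Ks [1..<Suc n])" by simp
  also have "sum_mset (image_mset g (mset (map Ks [1..<Suc n]))) = (\<Sum>j\<leftarrow>[1..<Suc n]. g (Ks j))"
    by (simp add: comp_def flip: mset_map sum_mset_sum_list del: upt_Suc)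
  also have "\<dots> = (\<Sum>j\<in>set [1..<Suc n]. g (Ks j))" by (rule sum_list_distinct_conv_sum_set) simp
  also have "set [1..<Suc n] = {1..n}" by auto
  finally show ?thesis .
qed

text \<open>The \<open>q\<close>-th largest value separates the \<open>q\<close> largest values from the others.\<close>

lemma avg_largest_threshold:
  assumes "1 \<le> q" "q \<le> n"
  obtains c where "real q * avg_largest Ks n q = (\<Sum>j=1..n. max (Ks j - c) 0) + real q * c"
    and "c \<le> avg_largest Ks n q"
    and "real n * avg_largest Ks n q \<ge> (\<Sum>j=1..n. Ks j)"
proof -
  define xs where "xs = rev (sort (map Ks [1..<Suc n]))"
  have len: "length xs = n" by (simp add: xs_def)
  have desc: "xs ! j \<le> xs ! i" if "i \<le> j" "j < n" for i j
  proof -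
    have "sorted_wrt (\<ge>) xs" unfolding xs_def sorted_wrt_rev by simp
    thus ?thesis using that len by (cases "i = j") (auto simp: sorted_wrt_iff_nth_less)
  qed
  define c where "c = xs ! (q - 1)"
  have T: "real q * avg_largest Ks n q = sum_list (take q xs)"
    using assms by (simp add: avg_largest_def xs_def)
  have hi: "c \<le> x" if "x \<in> set (take q xs)" for x
    using that assms len desc by (auto simp: c_def in_set_conv_nth)
  have lo: "x \<le> c" if "x \<in> set (drop q xs)" for x
    using that assms len desc by (auto simp: c_def in_set_conv_nth)
  have "(\<Sum>x\<leftarrow>take q xs. max (x - c) 0) = (\<Sum>x\<leftarrow>take q xs. x - c)"
    using hi by (intro arg_cong[where f = sum_list] map_cong) auto
  also have "\<dots> = sum_list (take q xs) - real q * c"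
    using assms len by (simp add: sum_list_subtractf sum_list_triv)
  finally have take: "(\<Sum>x\<leftarrow>take q xs. max (x - c) 0) = sum_list (take q xs) - real q * c" .
  have "(\<Sum>x\<leftarrow>drop q xs. max (x - c) 0) = (\<Sum>x\<leftarrow>drop q xs. 0)"
    using lo by (intro arg_cong[where f = sum_list] map_cong) auto
  hence "(\<Sum>x\<leftarrow>take q xs @ drop q xs. max (x - c) 0) = sum_list (take q xs) - real q * c"
    unfolding map_append sum_list_append take by simp
  hence 1: "(\<Sum>j=1..n. max (Ks j - c) 0) = sum_list (take q xs) - real q * c"
    using sum_list_map_descending[where Ks = Ks and n = n and g = "\<lambda>x. max (x - c) 0"] by (simp add: xs_def)
  have "0 \<le> (\<Sum>j=1..n. max (Ks j - c) 0)" by (intro sum_nonneg) auto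
  hence "real q * c \<le> real q * avg_largest Ks n q" using 1 T by simp
  hence 2: "c \<le> avg_largest Ks n q" using assms by simp
  have "(\<Sum>j=1..n. Ks j) \<le> (\<Sum>j=1..n. max (Ks j - c) 0 + c)" by (intro sum_mono) auto
  also have "\<dots> = real q * avg_largest Ks n q + (real n - real q) * c"
    using 1 T by (simp add: sum.distrib algebra_simps)
  also have "\<dots> \<le> real q * avg_largest Ks n q + (real n - real q) * avg_largest Ks n q"
    using 2 assms by (intro add_left_mono mult_left_mono) auto
  finally have "real n * avg_largest Ks n q \<ge> (\<Sum>j=1..n. Ks j)" by (simp add: algebra_simps)
  thus ?thesis using that[of c] 1 2 T by simp
qed

lemma avg_largest_ge_mean:
  assumes "1 \<le> q" "q \<le> n" shows "(\<Sum>j=1..n. Ks j) / real n \<le> avg_largest Ks n q"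
proof -
  obtain c where "real n * avg_largest Ks n q \<ge> (\<Sum>j=1..n. Ks j)"
    using avg_largest_threshold[OF assms] by metis
  thus ?thesis using assms by (simp add: field_simps)
qed

text \<open>Each \<open>Ks j\<close> is at most \<open>max (Ks j - c) 0 + c\<close>, and the sum of
  the nonnegative parts may be extended from \<open>J\<close> to all indices.\<close>

lemma sum_le_avg_largest:
  assumes "J \<subseteq> {1..n}" "card J = q" "1 \<le> q"
  shows "(\<Sum>j\<in>J. Ks j) \<le> real q * avg_largest Ks n q"
proof -
  have "q \<le> n" using card_mono[OF _ assms(1)] assms(2) by simp
  then obtain c where c: "real q * avg_largest Ks n q = (\<Sum>j=1..n. max (Ks j - c) 0) + real q * c"
    using avg_largest_threshold[OF assms(3)] by metis
  have "(\<Sum>j\<in>J. Ks j) \<le> (\<Sum>j\<in>J. max (Ks j - c) 0 + c)" by (intro sum_mono) auto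
  also have "\<dots> = (\<Sum>j\<in>J. max (Ks j - c) 0) + real q * c" using assms by (simp add: sum.distrib)
  also have "\<dots> \<le> (\<Sum>j=1..n. max (Ks j - c) 0) + real q * c"
    using assms by (intro add_right_mono sum_mono2) auto
  finally show ?thesis by (simp add: c)
qed

lemma le_avg_largest_1:
  assumes "j \<in> {1..n}" shows "Ks j \<le> avg_largest Ks n 1"
  using sum_le_avg_largest[of "{j}" n 1 Ks] assms by simp

text \<open>The maximum is one of the \<open>q\<close> largest values and the others are positive.
  Later this turns a small number of draws, relative to \<open>K1\<close>, into a lower bound for
  \<kappa>t.\<close>

lemma avg_largest_1_le:
  assumes pos: "\<And>j. j \<in> {1..n} \<Longrightarrow> 0 < Ks j" and q: "1 \<le> q" "q \<le> n"
  shows "avg_largest Ks n 1 \<le> real q * avg_largest Ks n q"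
proof -
  define xs where "xs = rev (sort (map Ks [1..<Suc n]))"
  have "length xs = n" "set xs = Ks ` {1..n}" by (auto simp: xs_def)
  hence "\<forall>x\<in>set xs. 0 < x" "xs \<noteq> []" using q pos by auto
  then obtain y ys where xs: "xs = y # ys" and nn: "\<forall>x\<in>set xs. 0 < x" by (cases xs) auto
  have "0 \<le> sum_list (take (q - 1) ys)"
    using nn by (intro sum_list_nonneg) (auto simp: xs dest!: in_set_takeD less_imp_le)
  moreover have "take q xs = y # take (q - 1) ys" "take 1 xs = [y]"
    using q by (simp_all add: xs take_Cons')
  ultimately show ?thesis unfolding avg_largest_def xs_def[symmetric] using q by simp
qed

section \<open>Second moments of scalar means and Cantelli's inequality\<close>

lemma expectation_sum_real:
  fixes v :: "nat \<Rightarrow> real"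
  assumes n: "n \<ge> 1"
  shows "iid_mean n s (\<lambda>S. \<Sum>j\<leftarrow>S. v j) = real s * ((\<Sum>j=1..n. v j) / real n)"
proof (induction s)
  case (Suc s)
  have "iid_mean n (Suc s) (\<lambda>S. \<Sum>j\<leftarrow>S. v j)
      = iid_mean n s (\<lambda>S. (\<Sum>j=1..n. v j) / real n + (\<Sum>j\<leftarrow>S. v j))"
    using n by (simp add: expectation_draw_replacement_Suc sum.distrib add_divide_distrib)
  also have "\<dots> = (\<Sum>j=1..n. v j) / real n + real s * ((\<Sum>j=1..n. v j) / real n)"
    using n Suc by (subst Bochner_Integration.integral_add) (auto intro!: integrable_draw)
  finally show ?case by (simp only: of_nat_Suc distrib_right mult_1_left add.commute)
qed (simp add: expectation_draw_replacement_0)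

text \<open>The centre \<open>c\<close> is free because one-sided and asymmetric events are
  estimated by a second moment about a point other than the mean.\<close>

lemma expectation_sample_mean_sq:
  fixes v :: "nat \<Rightarrow> real"
  assumes n: "n \<ge> 1" "s \<ge> 1" and \<mu>: "\<mu> = (\<Sum>j=1..n. v j) / real n"
  shows "iid_mean n s (\<lambda>S. ((\<Sum>j\<leftarrow>S. v j) / real s - c)\<^sup>2)
     = ((\<Sum>j=1..n. (v j)\<^sup>2) / real n - \<mu>\<^sup>2) / real s + (\<mu> - c)\<^sup>2"
proof -
  let ?E = "iid_mean n s"
  have int: "integrable (measure_pmf (draw With_Replacement n s)) \<phi>" for \<phi> :: "_ \<Rightarrow> real"
    using n by (intro integrable_draw) auto
  define Z where "Z S = (\<Sum>j\<leftarrow>S. v j) / real s" for S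
  have EZ: "?E Z = \<mu>" using expectation_sum_real[OF n(1), of s v] n by (simp add: Z_def[abs_def] \<mu>)
  have norm_Z: "?E (\<lambda>S. (norm (sample_mean v S - \<mu>))\<^sup>2) = ?E (\<lambda>S. (Z S - \<mu>)\<^sup>2)"
  proof (intro antisym expectation_draw_mono n)
    fix S assume "S \<in> samples With_Replacement n s"
    hence "sample_mean v S = Z S" by (simp add: sample_mean_def Z_def)
    thus "(norm (sample_mean v S - \<mu>))\<^sup>2 \<le> (Z S - \<mu>)\<^sup>2" "(Z S - \<mu>)\<^sup>2 \<le> (norm (sample_mean v S - \<mu>))\<^sup>2"
      by simp_all
  qed simp_all
  have var: "?E (\<lambda>S. (Z S - \<mu>)\<^sup>2) = ((\<Sum>j=1..n. (v j)\<^sup>2) / real n - \<mu>\<^sup>2) / real s"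
  proof -
    have "\<mu> = (1 / real n) *\<^sub>R (\<Sum>j=1..n. v j)" by (simp add: \<mu>)
    from expectation_sample_mean_deviation[OF n this] show ?thesis
      unfolding norm_Z by (simp only: real_norm_def power2_abs)
  qed
  have "(Z S - c)\<^sup>2 = (Z S - \<mu>)\<^sup>2 + 2 * (\<mu> - c) * (Z S - \<mu>) + (\<mu> - c)\<^sup>2" for S
    by (simp add: power2_eq_square algebra_simps)
  hence "?E (\<lambda>S. (Z S - c)\<^sup>2) = ?E (\<lambda>S. (Z S - \<mu>)\<^sup>2 + 2 * (\<mu> - c) * (Z S - \<mu>) + (\<mu> - c)\<^sup>2)" by simp
  also have "\<dots> = ?E (\<lambda>S. (Z S - \<mu>)\<^sup>2) + 2 * (\<mu> - c) * (?E Z - \<mu>) + (\<mu> - c)\<^sup>2"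
    by (simp add: int)
  also have "\<dots> = ((\<Sum>j=1..n. (v j)\<^sup>2) / real n - \<mu>\<^sup>2) / real s + (\<mu> - c)\<^sup>2"
    by (simp add: EZ var)
  finally show ?thesis by (simp add: Z_def)
qed

text \<open>Cantelli's inequality; Chebyshev's would lose the factor needed when \<open>\<delta>\<close> is close to 1.\<close>

lemma prob_sample_mean_lower:
  fixes a :: "nat \<Rightarrow> real"
  assumes n: "n \<ge> 1" "s \<ge> 1" "m = Without_Replacement \<Longrightarrow> s \<le> n"
    and a: "\<And>j. j \<in> {1..n} \<Longrightarrow> 0 \<le> a j \<and> a j \<le> M" and \<gamma>: "0 < \<gamma>" "\<gamma> \<le> (\<Sum>j=1..n. a j) / real n"
    and r: "0 \<le> r" "r < 1"
  shows "draw_prob m n s {S. (\<Sum>j\<leftarrow>S. a j) / real s \<le> r * \<gamma>} \<le> 1 / (1 + real s * \<gamma> / M * (1 - r)\<^sup>2)"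
proof -
  define \<mu> where "\<mu> = (\<Sum>j=1..n. a j) / real n"
  \<comment> \<open>A bound for the variance of the mean with replacement:
    \<open>a j \<le> M\<close> makes the second moment of a single draw at most
    \<open>M * \<mu>\<close>.\<close>
  define V where "V = M * \<mu> / real s"
  define d where "d = \<mu> - r * \<gamma>"
  \<comment> \<open>The centre minimising \<open>(V + (c - \<mu>)^2) / (d + c - \<mu>)^2\<close>;
    the minimum is \<open>V / (V + d^2)\<close>.\<close>
  define c where "c = \<mu> + V / d"
  have \<mu>: "\<gamma> \<le> \<mu>" using \<gamma> by (simp add: \<mu>_def)
  have M: "0 < M"
  proof (rule ccontr)
    assume "\<not> 0 < M"
    hence "(\<Sum>j=1..n. a j) \<le> (\<Sum>j=1..n. 0)" using a by (intro sum_mono) (meson not_less order_trans)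
    hence "\<mu> \<le> 0" by (simp add: \<mu>_def divide_nonpos_nonneg)
    thus False using \<mu> \<gamma> by simp
  qed
  have "r * \<gamma> < 1 * \<gamma>" using r \<gamma> by (intro mult_strict_right_mono) auto
  hence d: "0 < d" using \<mu> by (simp add: d_def)
  have V: "0 < V" using M \<mu> \<gamma> n by (simp add: V_def)
  have "(\<Sum>j=1..n. (a j)\<^sup>2) \<le> (\<Sum>j=1..n. M * a j)"
    using a by (intro sum_mono) (auto simp: power2_eq_square intro!: mult_right_mono)
  hence "(\<Sum>j=1..n. (a j)\<^sup>2) / real n \<le> (\<Sum>j=1..n. M * a j) / real n" by (intro divide_right_mono) auto
  hence "(\<Sum>j=1..n. (a j)\<^sup>2) / real n \<le> M * \<mu>" by (simp add: \<mu>_def flip: sum_distrib_left)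
  moreover have "0 \<le> \<mu>\<^sup>2" by simp
  ultimately have "(\<Sum>j=1..n. (a j)\<^sup>2) / real n - \<mu>\<^sup>2 \<le> M * \<mu>" by linarith
  hence "((\<Sum>j=1..n. (a j)\<^sup>2) / real n - \<mu>\<^sup>2) / real s \<le> M * \<mu> / real s"
    by (intro divide_right_mono) auto
  hence var: "((\<Sum>j=1..n. (a j)\<^sup>2) / real n - \<mu>\<^sup>2) / real s \<le> V" by (simp add: V_def)
  \<comment> \<open>Convexity carries the moment bound over to sampling without replacement.\<close>
  have cvx: "convex_on UNIV (\<lambda>x. (x / real s - c)\<^sup>2)"
  proof (rule convex_onI)
    fix t x y :: real assume t: "0 < t" "t < 1"
    define A B where "A = x / real s - c" and "B = y / real s - c"
    have "((1 - t) *\<^sub>R x + t *\<^sub>R y) / real s - c = (1 - t) * A + t * B"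
      by (simp add: A_def B_def add_divide_distrib diff_divide_distrib algebra_simps)
    moreover have "(1 - t) * A\<^sup>2 + t * B\<^sup>2 - ((1 - t) * A + t * B)\<^sup>2 = t * (1 - t) * (A - B)\<^sup>2"
      by (simp add: power2_eq_square algebra_simps)
    moreover have "0 \<le> t * (1 - t) * (A - B)\<^sup>2" using t by simp
    ultimately show "(((1 - t) *\<^sub>R x + t *\<^sub>R y) / real s - c)\<^sup>2 \<le> (1 - t) * (x / real s - c)\<^sup>2 + t * (y / real s - c)\<^sup>2"
      by (simp add: A_def B_def)
  qed simp
  have "draw_prob m n s {S. (\<Sum>j\<leftarrow>S. a j) / real s \<le> r * \<gamma>}
      \<le> draw_mean m n s (\<lambda>S. ((\<Sum>j\<leftarrow>S. a j) / real s - c)\<^sup>2) / (d + V / d)\<^sup>2"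
  proof (rule prob_draw_le_expectation[OF n(1,3)])
    fix S assume "S \<in> {S. (\<Sum>j\<leftarrow>S. a j) / real s \<le> r * \<gamma>}"
    hence "d + V / d \<le> c - (\<Sum>j\<leftarrow>S. a j) / real s" by (simp add: c_def d_def)
    hence "(d + V / d)\<^sup>2 \<le> (c - (\<Sum>j\<leftarrow>S. a j) / real s)\<^sup>2" using d V by (intro power_mono) auto
    thus "(d + V / d)\<^sup>2 \<le> ((\<Sum>j\<leftarrow>S. a j) / real s - c)\<^sup>2" by (simp add: power2_commute)
  next
    have "0 < d + V / d" using d V by (simp add: add_pos_pos)
    thus "0 < (d + V / d)\<^sup>2" by (rule zero_less_power)
  qed simp_all
  also have "\<dots> \<le> iid_mean n s (\<lambda>S. ((\<Sum>j\<leftarrow>S. a j) / real s - c)\<^sup>2) / (d + V / d)\<^sup>2"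
    using n by (intro divide_right_mono expectation_no_replacement_le[OF cvx]) auto
  also have "\<dots> \<le> (V + (V / d)\<^sup>2) / (d + V / d)\<^sup>2"
    using expectation_sample_mean_sq[OF n(1,2) \<mu>_def, of c] var by (intro divide_right_mono) (auto simp: c_def)
  also have "\<dots> = 1 / (1 + d * d / V)"
  proof -
    have "(V + (V / d)\<^sup>2) / (d + V / d)\<^sup>2 = V / (V + d * d)"
    proof -
      have "V + (V / d)\<^sup>2 = V * (V + d * d) / (d * d)" using d by (simp add: field_simps power2_eq_square)
      moreover have "(d + V / d)\<^sup>2 = (V + d * d) * (V + d * d) / (d * d)" using d by (simp add: field_simps power2_eq_square)
      moreover have "0 < V + d * d" using d V by (simp add: add_pos_pos)
      ultimately show ?thesis using d by simp
    qed
    also have "\<dots> = 1 / (1 + d * d / V)" using d V by (simp add: field_simps)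
    finally show ?thesis .
  qed
  \<comment> \<open>Since \<open>d \<ge> \<mu> * (1 - r)\<close> and \<open>V\<close> is linear in
    \<mu>, the lower bound on \<open>d * d / V\<close> is linear in \<mu>, and \<mu> may be lowered
    to \<gamma>.\<close>
  also have "\<dots> \<le> 1 / (1 + real s * \<gamma> / M * (1 - r)\<^sup>2)"
  proof -
    have "r * \<gamma> \<le> r * \<mu>" using \<mu> r by (intro mult_left_mono)
    hence "\<mu> * (1 - r) \<le> d" by (simp add: d_def algebra_simps)
    hence "(\<mu> * (1 - r)) * (\<mu> * (1 - r)) \<le> d * d" using \<mu> \<gamma> r d by (intro mult_mono) auto
    hence "(\<mu> * (1 - r)) * (\<mu> * (1 - r)) / V \<le> d * d / V" using V by (intro divide_right_mono) auto
    moreover have "(\<mu> * (1 - r)) * (\<mu> * (1 - r)) / V = real s * \<mu> / M * (1 - r)\<^sup>2"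
      using M \<mu> \<gamma> n by (simp add: V_def power2_eq_square field_simps)
    moreover have "real s * \<gamma> / M * (1 - r)\<^sup>2 \<le> real s * \<mu> / M * (1 - r)\<^sup>2"
      using M \<mu> by (intro mult_right_mono divide_right_mono mult_left_mono) auto
    ultimately have "real s * \<gamma> / M * (1 - r)\<^sup>2 \<le> d * d / V" by linarith
    moreover have "0 \<le> real s * \<gamma> / M * (1 - r)\<^sup>2" using M \<gamma> by simp
    ultimately show ?thesis by (intro divide_left_mono) (auto intro!: add_pos_nonneg mult_pos_pos)
  qed
  finally show ?thesis .
qed

subsection \<open>Gradients and Hessians\<close>

lemma GDERIV_grad:
  assumes "f differentiable (at x)"
  shows "GDERIV f x :> grad f x"
proof -
  obtain f' where f': "(f has_derivative f') (at x)" using assms by (auto simp: differentiable_def)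
  hence "linear f'" by (rule has_derivative_linear)
  \<comment> \<open>The Riesz representative of the functional \<open>f'\<close> is its adjoint at
    1.\<close>
  hence "f' h = h \<bullet> adjoint f' 1" for h by (simp add: adjoint_works)
  hence "f' = (\<lambda>h. h \<bullet> adjoint f' 1)" by blast
  hence ex: "GDERIV f x :> adjoint f' 1" using f' by (simp add: gderiv_def)
  moreover have "D = adjoint f' 1" if "GDERIV f x :> D" for D
  proof -
    have "(\<lambda>h. h \<bullet> D) = (\<lambda>h. h \<bullet> adjoint f' 1)"
      using that ex unfolding gderiv_def by (rule has_derivative_unique)
    hence "h \<bullet> D = h \<bullet> adjoint f' 1" for h by (rule fun_cong)
    thus ?thesis using vector_eq_ldot[of D "adjoint f' 1"] by blast
  qed
  ultimately show ?thesis unfolding grad_def by (rule theI)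
qed

lemma grad_unique:
  assumes "GDERIV f x :> D" shows "grad f x = D"
proof -
  have "f differentiable (at x)" using assms by (auto simp: gderiv_def differentiable_def)
  hence "(\<lambda>h. h \<bullet> grad f x) = (\<lambda>h. h \<bullet> D)"
    using GDERIV_grad[of f x] assms unfolding gderiv_def by (intro has_derivative_unique)
  hence "h \<bullet> grad f x = h \<bullet> D" for h by (rule fun_cong)
  thus ?thesis using vector_eq_ldot[of "grad f x" D] by blast
qed

lemma grad_has_derivative:
  assumes "grad f differentiable (at x)"
  shows "(grad f has_derivative (\<lambda>h. hessian f x *v h)) (at x)"
proof -
  have "(grad f has_derivative frechet_derivative (grad f) (at x)) (at x)"
    using assms by (simp add: frechet_derivative_works)
  moreover from this have "linear (frechet_derivative (grad f) (at x))" by (rule has_derivative_linear)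
  ultimately show ?thesis by (simp add: hessian_def matrix_works)
qed

lemma hessian_unique:
  assumes "(grad f has_derivative (\<lambda>h. A *v h)) (at x)" shows "hessian f x = A"
  using frechet_derivative_at[OF assms, symmetric] by (simp add: hessian_def)

lemma average_derivatives:
  assumes f: "\<And>i. i \<in> {1..n} \<Longrightarrow> twice_differentiable (f i)"
    and F: "F = (\<lambda>y. (1 / real n) * (\<Sum>i=1..n. f i y))"
  shows "grad F y = (1 / real n) *\<^sub>R (\<Sum>i=1..n. grad (f i) y)"
    and "hessian F y = (1 / real n) *\<^sub>R (\<Sum>i=1..n. hessian (f i) y)"
    and "twice_differentiable F"
proof -
  have gF: "GDERIV F z :> (1 / real n) *\<^sub>R (\<Sum>i=1..n. grad (f i) z)" for z
  proof -
    have "(f i has_derivative (\<lambda>h. h \<bullet> grad (f i) z)) (at z)" if "i \<in> {1..n}" for i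
      using f[OF that] GDERIV_grad by (auto simp: twice_differentiable_def gderiv_def)
    hence "(F has_derivative (\<lambda>h. (1 / real n) * (\<Sum>i=1..n. h \<bullet> grad (f i) z))) (at z)"
      unfolding F by (intro has_derivative_mult_right has_derivative_sum) auto
    thus ?thesis by (simp add: gderiv_def inner_sum_right)
  qed
  have grad: "grad F = (\<lambda>z. (1 / real n) *\<^sub>R (\<Sum>i=1..n. grad (f i) z))"
    using grad_unique[OF gF] by blast
  thus "grad F y = (1 / real n) *\<^sub>R (\<Sum>i=1..n. grad (f i) y)" by simp
  have hF: "(grad F has_derivative (\<lambda>h. ((1 / real n) *\<^sub>R (\<Sum>i=1..n. hessian (f i) z)) *v h)) (at z)" for z
  proof -
    have "(grad (f i) has_derivative (\<lambda>h. hessian (f i) z *v h)) (at z)" if "i \<in> {1..n}" for i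
      using f[OF that] grad_has_derivative by (auto simp: twice_differentiable_def)
    hence "(grad F has_derivative (\<lambda>h. (1 / real n) *\<^sub>R (\<Sum>i=1..n. hessian (f i) z *v h))) (at z)"
      unfolding grad by (intro has_derivative_scaleR_right has_derivative_sum) auto
    moreover have "(\<Sum>i\<in>I. A i) *v h = (\<Sum>i\<in>I. A i *v h)" for A :: "nat \<Rightarrow> real^'a^'a" and I h
      by (induction I rule: infinite_finite_induct) (auto simp: matrix_vector_mult_add_rdistrib)
    ultimately show ?thesis by (simp add: scaleR_matrix_vector_assoc[symmetric])
  qed
  show "hessian F y = (1 / real n) *\<^sub>R (\<Sum>i=1..n. hessian (f i) y)"
    by (rule hessian_unique[OF hF])
  show "twice_differentiable F"
    using gF hF by (auto simp: twice_differentiable_def gderiv_def differentiable_def)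
qed

text \<open>Taylor's formula along the line through \<open>x\<close> and \<open>x + p\<close>. The
  Lagrange remainder asks only for existence of the second derivative, not for a continuous
  Hessian.\<close>

lemma second_order_expansion:
  assumes "twice_differentiable F"
  obtains t where "F (x + p) = F x + p \<bullet> grad F x + (p \<bullet> (hessian F (x + t *\<^sub>R p) *v p)) / 2"
proof -
  define df where "df k t = (if k = 0 then F (x + t *\<^sub>R p) else if k = 1 then p \<bullet> grad F (x + t *\<^sub>R p)
      else p \<bullet> (hessian F (x + t *\<^sub>R p) *v p))" for k :: nat and t
  have df: "df 0 = (\<lambda>t. F (x + t *\<^sub>R p))" "df (Suc 0) = (\<lambda>t. p \<bullet> grad F (x + t *\<^sub>R p))"
    "df 2 = (\<lambda>t. p \<bullet> (hessian F (x + t *\<^sub>R p) *v p))"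
    by (auto simp: df_def)
  have line: "((\<lambda>t. x + t *\<^sub>R p) has_derivative (\<lambda>h. h *\<^sub>R p)) (at t)" for t
    by (auto intro!: derivative_eq_intros)
  have "((\<lambda>t. F (x + t *\<^sub>R p)) has_derivative (\<lambda>h. (h *\<^sub>R p) \<bullet> grad F (x + t *\<^sub>R p))) (at t)" for t
    using assms GDERIV_grad[of F "x + t *\<^sub>R p"]
    by (intro has_derivative_compose[OF line]) (auto simp: twice_differentiable_def gderiv_def)
  hence 0: "DERIV (df 0) t :> df 1 t" for t
    by (simp add: df has_field_derivative_def mult_commute_abs)
  have "((\<lambda>t. grad F (x + t *\<^sub>R p)) has_derivative (\<lambda>h. hessian F (x + t *\<^sub>R p) *v (h *\<^sub>R p))) (at t)" for t
    using assms grad_has_derivative[of F "x + t *\<^sub>R p"]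
    by (intro has_derivative_compose[OF line]) (auto simp: twice_differentiable_def)
  hence "((\<lambda>t. p \<bullet> grad F (x + t *\<^sub>R p)) has_derivative (\<lambda>h. p \<bullet> (hessian F (x + t *\<^sub>R p) *v (h *\<^sub>R p)))) (at t)" for t
    by (intro has_derivative_inner_right)
  hence 1: "DERIV (df 1) t :> df 2 t" for t
    by (simp add: df has_field_derivative_def mult_commute_abs matrix_vector_mult_scaleR)
  have "\<exists>t>0. t < 1 \<and> df 0 1 = (\<Sum>m<2. df m 0 / fact m * 1 ^ m) + df 2 t / fact 2 * 1 ^ 2"
  proof (rule Maclaurin)
    show "\<forall>m t. m < 2 \<and> 0 \<le> t \<and> t \<le> 1 \<longrightarrow> DERIV (df m) t :> df (Suc m) t"
    proof (intro allI impI)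
      fix m :: nat and t :: real assume "m < 2 \<and> 0 \<le> t \<and> t \<le> 1"
      hence "m = 0 \<or> m = 1" by auto
      thus "DERIV (df m) t :> df (Suc m) t" using 0[of t] 1[of t] by (auto simp: numeral_2_eq_2)
    qed
  qed auto
  then obtain t where "df 0 1 = (\<Sum>m<2. df m 0 / fact m * 1 ^ m) + df 2 t / fact 2 * 1 ^ 2" by blast
  thus ?thesis by (intro that[of t]) (simp add: df_def numeral_2_eq_2)
qed

lemma loewner_le_mat_iff:
  shows "A \<preceq> c *\<^sub>R mat 1 \<Longrightarrow> v \<bullet> (A *v v) \<le> c * (norm v)\<^sup>2"
    and "c *\<^sub>R mat 1 \<preceq> A \<Longrightarrow> c * (norm v)\<^sup>2 \<le> v \<bullet> (A *v v)"
  by (simp_all add: loewner_le_def pos_semidef_def matrix_vector_mult_diff_rdistrib inner_diff_right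
      scaleR_matrix_vector_assoc[symmetric] power2_norm_eq_inner)

lemma quadratic_upper_bound:
  assumes "twice_differentiable F" "\<And>y. hessian F y \<preceq> K *\<^sub>R mat 1"
  shows "F (x + p) \<le> F x + p \<bullet> grad F x + K / 2 * (norm p)\<^sup>2"
proof -
  obtain t where "F (x + p) = F x + p \<bullet> grad F x + (p \<bullet> (hessian F (x + t *\<^sub>R p) *v p)) / 2"
    using second_order_expansion[OF assms(1)] .
  thus ?thesis using loewner_le_mat_iff(1)[OF assms(2), of p "x + t *\<^sub>R p"] by simp
qed

text \<open>The Polyak-Lojasiewicz inequality: the strongly convex lower bound for
  \<open>F z\<close> is minimised over the displacement by completing a square.\<close>

lemma gap_le_grad_norm:
  assumes "twice_differentiable F" "\<And>y. \<gamma> *\<^sub>R mat 1 \<preceq> hessian F y" "0 < \<gamma>"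
  shows "F x - F z \<le> (norm (grad F x))\<^sup>2 / (2 * \<gamma>)"
proof -
  define p where "p = z - x"
  let ?g = "grad F x"
  obtain t where "F (x + p) = F x + p \<bullet> ?g + (p \<bullet> (hessian F (x + t *\<^sub>R p) *v p)) / 2"
    using second_order_expansion[OF assms(1)] .
  hence "F x - F z \<le> - (p \<bullet> ?g) - \<gamma> / 2 * (norm p)\<^sup>2"
    using loewner_le_mat_iff(2)[OF assms(2), of p "x + t *\<^sub>R p"] by (simp add: p_def)
  also have "\<dots> \<le> (norm ?g)\<^sup>2 / (2 * \<gamma>)"
  proof -
    have "0 \<le> (norm (?g + \<gamma> *\<^sub>R p))\<^sup>2" by simp
    also have "\<dots> = (norm ?g)\<^sup>2 + 2 * \<gamma> * (p \<bullet> ?g) + \<gamma> * \<gamma> * (norm p)\<^sup>2"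
      by (simp add: power2_norm_eq_inner inner_add_left inner_add_right inner_commute algebra_simps)
    finally show ?thesis using \<open>0 < \<gamma>\<close> by (simp add: field_simps)
  qed
  finally show ?thesis .
qed

subsection \<open>Inexact Newton directions\<close>

text \<open>By \<open>upper\<close> and \<open>dec\<close> the step \<open>\<alpha>0\<close> passes
  the sufficient decrease test, so the largest passing step is no smaller. Progress is then read off
  from the test at \<open>\<alpha>\<close> itself.\<close>

lemma iteration_conclusion:
  assumes upper: "\<And>p. F (x + p) \<le> F x + p \<bullet> d + K / 2 * (norm p)\<^sup>2"
    and step: "largest_step F x g p \<beta> \<alpha>max \<alpha>"
    and \<alpha>0: "0 < \<alpha>0" "\<alpha>0 \<le> \<alpha>max" and \<beta>: "0 < \<beta>"
    and dec: "p \<bullet> d + \<alpha>0 * K / 2 * (norm p)\<^sup>2 \<le> \<beta> * (p \<bullet> g)"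
    and desc: "c * (F x - Fs) \<le> - (p \<bullet> g)"
  shows "F (x + \<alpha> *\<^sub>R p) - Fs \<le> (1 - \<alpha> * \<beta> * c) * (F x - Fs)" "\<alpha>0 \<le> \<alpha>"
proof -
  have "F (x + \<alpha>0 *\<^sub>R p) \<le> F x + \<alpha>0 * (p \<bullet> d + \<alpha>0 * K / 2 * (norm p)\<^sup>2)"
    using upper[of "\<alpha>0 *\<^sub>R p"] by (simp add: power_mult_distrib power2_eq_square algebra_simps)
  also have "\<dots> \<le> F x + \<alpha>0 * (\<beta> * (p \<bullet> g))"
    using dec \<alpha>0 by simp
  finally have "sufficient_decrease F x g p \<beta> \<alpha>0" by (simp add: sufficient_decrease_def mult.assoc)
  thus le: "\<alpha>0 \<le> \<alpha>" using step \<alpha>0 by (simp add: largest_step_def)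
  have "0 \<le> \<alpha> * \<beta>" using le \<alpha>0 \<beta> by simp
  from mult_left_mono[OF desc this] have "\<alpha> * \<beta> * (p \<bullet> g) \<le> - (\<alpha> * \<beta> * c * (F x - Fs))"
    by (simp add: mult.assoc)
  moreover have "F (x + \<alpha> *\<^sub>R p) \<le> F x + \<alpha> * \<beta> * (p \<bullet> g)"
    using step by (simp add: largest_step_def sufficient_decrease_def)
  ultimately show "F (x + \<alpha> *\<^sub>R p) - Fs \<le> (1 - \<alpha> * \<beta> * c) * (F x - Fs)"
    by (simp add: left_diff_distrib)
qed

lemma residual_norm_ge:
  assumes "inexact_direction H g \<theta>\<^sub>1 \<theta>\<^sub>2 p"
  shows "(1 - \<theta>\<^sub>1) * norm g \<le> norm (H *v p)"
proof -
  have "norm g \<le> norm (H *v p + g) + norm (H *v p)"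
    using norm_triangle_ineq4[of "H *v p + g" "H *v p"] by simp
  thus ?thesis using assms by (simp add: inexact_direction_def algebra_simps)
qed

text \<open>For small residuals, the components of the direction along the exact Newton step and along the
  residual are compared in the inner product induced by \<open>H\<close>; this gains a factor \<open>\<kappa>t\<close>.\<close>

lemma inexact_newton_descent:
  fixes H :: "real^'d^'d"
  assumes H: "pos_semidef H" "pos_semidef (\<Lambda> *\<^sub>R mat 1 - H)" and \<mu>: "0 < \<mu>" "\<And>v. \<mu> * (norm v)\<^sup>2 \<le> v \<bullet> (H *v v)"
    and \<Lambda>: "0 < \<Lambda>" and r: "norm (H *v p + g) \<le> \<theta> * norm g" and \<theta>: "0 \<le> \<theta>" "\<theta>\<^sup>2 \<le> \<mu> / (3 * \<Lambda>)"
  shows "2 / 5 * (norm g)\<^sup>2 / \<Lambda> \<le> - (p \<bullet> g)"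
proof -
  note sym = pos_semidef_symmetric[OF H(1)]
  have "inj ((*v) H)"
  proof (rule linear_injective_0[THEN iffD2, OF matrix_vector_mul_linear], intro allI impI)
    fix v assume "H *v v = 0"
    hence "\<mu> * (norm v)\<^sup>2 \<le> 0" using \<mu>(2)[of v] by simp
    thus "v = 0" using \<mu>(1) by (simp add: mult_le_0_iff)
  qed
  hence "surj ((*v) H)" by (intro linear_injective_imp_surjective) auto
  then obtain y where y: "H *v y = g" by (metis surjD)
  \<comment> \<open>\<open>- y\<close> is the exact Newton step and \<open>z\<close> the deviation
    of \<open>p\<close> from it; \<open>H\<close> maps \<open>z\<close> to the residual.\<close>
  define z where "z = p + y"
  have z: "H *v z = H *v p + g" by (simp add: z_def matrix_vector_right_distrib y)
  have py: "- (p \<bullet> g) = y \<bullet> (H *v y) - z \<bullet> (H *v y)"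
    by (simp add: z_def y inner_add_left)
  define a b where "a = y \<bullet> (H *v y)" and "b = z \<bullet> (H *v z)"
  have zHy: "z \<bullet> (H *v y) = y \<bullet> (H *v z)" using symmetric_inner[OF sym, of z y] by (simp add: inner_commute)
  \<comment> \<open>The ratio 3/5 approximates \<open>1 / sqrt 3\<close>, the best weight in Young's
    inequality when \<open>b\<close> is at most a third of
    \<open>(norm g)\<^sup>2 / \<Lambda>\<close>; then 1 - 3/10 - 5/18 remains, which exceeds
    2/5.\<close>
  have "0 \<le> (3 *\<^sub>R y - 5 *\<^sub>R z) \<bullet> (H *v (3 *\<^sub>R y - 5 *\<^sub>R z))" using H(1) by (simp only: pos_semidef_def)
  also have "\<dots> = 9 * a - 30 * (z \<bullet> (H *v y)) + 25 * b"
    by (simp add: a_def b_def matrix_vector_mult_diff_distrib matrix_vector_mult_scaleR inner_diff_left inner_diff_right zHy)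
  finally have cross: "z \<bullet> (H *v y) \<le> 3 / 10 * a + 5 / 6 * b" by simp
  have ga: "(norm g)\<^sup>2 / \<Lambda> \<le> a"
    using pos_semidef_norm_le(1)[OF H \<Lambda>, of y] \<Lambda> by (simp add: a_def y field_simps)
  have "b \<le> norm z * norm (H *v z)" unfolding b_def by (rule norm_cauchy_schwarz)
  moreover have "\<mu> * norm z \<le> norm (H *v z)"
  proof (cases "z = 0")
    case False
    have "\<mu> * norm z * norm z \<le> norm (H *v z) * norm z"
      using \<mu>(2)[of z] norm_cauchy_schwarz[of z "H *v z"] by (simp add: power2_eq_square mult_ac)
    thus ?thesis using False by simp
  qed simp
  ultimately have "\<mu> * b \<le> norm (H *v z) * norm (H *v z)"
  proof -
    assume b: "b \<le> norm z * norm (H *v z)" and z': "\<mu> * norm z \<le> norm (H *v z)"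
    have "\<mu> * b \<le> \<mu> * (norm z * norm (H *v z))" using b \<mu>(1) by (intro mult_left_mono) auto
    also have "\<dots> = \<mu> * norm z * norm (H *v z)" by simp
    also have "\<dots> \<le> norm (H *v z) * norm (H *v z)" using z' by (intro mult_right_mono) auto
    finally show ?thesis .
  qed
  also have "\<dots> \<le> (\<theta> * norm g)\<^sup>2" using r unfolding z by (simp add: power2_eq_square mult_mono')
  also have "\<dots> = \<theta>\<^sup>2 * (norm g)\<^sup>2" by (rule power_mult_distrib)
  also have "\<dots> \<le> \<mu> / (3 * \<Lambda>) * (norm g)\<^sup>2" by (intro mult_right_mono \<theta>) simp
  also have "\<dots> = \<mu> * (1 / 3 * ((norm g)\<^sup>2 / \<Lambda>))" by simp
  finally have "b \<le> 1 / 3 * ((norm g)\<^sup>2 / \<Lambda>)" using \<mu>(1) by (simp only: mult_le_cancel_left_pos)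
  moreover have "0 \<le> (norm g)\<^sup>2 / \<Lambda>" using \<Lambda> by simp
  ultimately have "z \<bullet> (H *v y) \<le> 3 / 10 * a + 5 / 18 * ((norm g)\<^sup>2 / \<Lambda>)" using cross by linarith
  hence "2 / 5 * ((norm g)\<^sup>2 / \<Lambda>) \<le> - (p \<bullet> g)"
    unfolding py a_def[symmetric] using ga \<open>0 \<le> (norm g)\<^sup>2 / \<Lambda>\<close> by argo
  thus ?thesis by simp
qed

text \<open>The cofactor of \<open>\<alpha> * \<beta>\<close> in the rate \<rho> of the
  theorem.\<close>

definition decrease_rate :: "real \<Rightarrow> real \<Rightarrow> real \<Rightarrow> real \<Rightarrow> real" where
  "decrease_rate \<kappa>t \<theta>\<^sub>1 \<theta>\<^sub>2 \<epsilon>\<^sub>1 = (if \<theta>\<^sub>1 \<le> sqrt ((1 - \<epsilon>\<^sub>1) / (4 * \<kappa>t)) then 4 / (9 * \<kappa>t)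
     else 8 * (1 - \<theta>\<^sub>2) * (1 - \<theta>\<^sub>1)\<^sup>2 * (1 - \<epsilon>\<^sub>1) / (9 * \<kappa>t\<^sup>2))"

text \<open>The first condition guarantees sufficient decrease for the step size
  \<open>(1 - \<theta>\<^sub>2) (1 - \<beta>) (1 - \<epsilon>\<^sub>1) / \<kappa>\<close>. Since the norm of the true gradient is at most
  \<open>5/4 norm g\<close>, the second one bounds the decrease below in terms of the optimality gap.\<close>

definition good_direction ::
  "real \<Rightarrow> real \<Rightarrow> real \<Rightarrow> real \<Rightarrow> real \<Rightarrow> real \<Rightarrow> real^'d \<Rightarrow> real^'d \<Rightarrow> real^'d \<Rightarrow> bool" where
  "good_direction \<gamma> \<kappa>t \<theta>\<^sub>1 \<theta>\<^sub>2 \<epsilon>\<^sub>1 \<beta> d g p \<longleftrightarrow>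
     p \<bullet> d + (1 - \<theta>\<^sub>2) * (1 - \<beta>) * (1 - \<epsilon>\<^sub>1) * \<gamma> / 2 * (norm p)\<^sup>2 \<le> \<beta> * (p \<bullet> g) \<and>
     decrease_rate \<kappa>t \<theta>\<^sub>1 \<theta>\<^sub>2 \<epsilon>\<^sub>1 * (25 / 32 * (norm g)\<^sup>2 / \<gamma>) \<le> - (p \<bullet> g)"

text \<open>The lower bound \<open>\<mu>\<close> on \<open>H\<close> is weaker than \<open>(1 - \<epsilon>\<^sub>1) \<gamma>\<close>: the constants in the
  statement leave room for it, and this makes up for \<open>\<delta>\<close> being spent on both samples.\<close>

lemma inexact_newton_direction:
  fixes H :: "real^'d^'d" and g d p :: "real^'d"
  assumes H: "pos_semidef H" "pos_semidef ((\<kappa>t * \<gamma>) *\<^sub>R mat 1 - H)"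
    and \<mu>: "\<mu> = (3 / 4 - \<epsilon>\<^sub>1 / 2) * \<gamma>" "\<And>v. \<mu> * (norm v)\<^sup>2 \<le> v \<bullet> (H *v v)"
    and par: "0 < \<gamma>" "1 \<le> \<kappa>t" "0 < \<theta>\<^sub>1" "\<theta>\<^sub>1 < 1" "0 < \<theta>\<^sub>2" "\<theta>\<^sub>2 < 1" "0 < \<epsilon>\<^sub>1" "\<epsilon>\<^sub>1 \<le> 1 / 2" "0 < \<epsilon>\<^sub>2" "0 < \<beta>" "\<beta> < 1"
    and \<sigma>: "\<sigma> \<ge> 4 * \<kappa>t / ((1 - \<theta>\<^sub>1) * (1 - \<theta>\<^sub>2) * (1 - \<beta>))"
    and g: "\<sigma> * \<epsilon>\<^sub>2 \<le> norm g" "norm (g - d) \<le> \<epsilon>\<^sub>2"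
    and p: "inexact_direction H g \<theta>\<^sub>1 \<theta>\<^sub>2 p"
  shows "good_direction \<gamma> \<kappa>t \<theta>\<^sub>1 \<theta>\<^sub>2 \<epsilon>\<^sub>1 \<beta> d g p"
proof -
  define \<Lambda> where "\<Lambda> = \<kappa>t * \<gamma>"
  define P where "P = (norm p)\<^sup>2"
  have \<Lambda>: "0 < \<Lambda>" using par by (simp add: \<Lambda>_def)
  have \<mu>0: "0 < \<mu>" using par by (simp add: \<mu>)

  have "(1 - \<theta>\<^sub>1) * norm g \<le> \<Lambda> * norm p"
    using residual_norm_ge[OF p] pos_semidef_norm_le(2)[OF H, of p] \<Lambda> unfolding \<Lambda>_def by linarith
  hence np: "(1 - \<theta>\<^sub>1) * norm g / \<Lambda> \<le> norm p" using \<Lambda> by (simp add: field_simps)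
  have curv: "(1 - \<theta>\<^sub>2) * (\<mu> * P) \<le> - (p \<bullet> g)"
  proof -
    have "(1 - \<theta>\<^sub>2) * (\<mu> * P) \<le> (1 - \<theta>\<^sub>2) * (p \<bullet> (H *v p))"
      unfolding P_def using par \<mu>(2)[of p] by (intro mult_left_mono) auto
    thus ?thesis using p by (simp add: inexact_direction_def algebra_simps)
  qed
  \<comment> \<open>The constant 4 in \<sigma> limits the cost
    \<open>\<epsilon>\<^sub>2 * norm p\<close> of the gradient error to a quarter of
    \<open>(1 - \<theta>\<^sub>2) * (1 - \<beta>) * \<gamma> * P\<close>.\<close>
  have "4 * \<kappa>t * \<epsilon>\<^sub>2 / ((1 - \<theta>\<^sub>1) * (1 - \<theta>\<^sub>2) * (1 - \<beta>)) \<le> \<sigma> * \<epsilon>\<^sub>2"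
    using mult_right_mono[OF \<sigma>, of \<epsilon>\<^sub>2] par by simp
  also have "\<dots> \<le> norm g" by (rule g)
  finally have "4 * \<kappa>t * \<epsilon>\<^sub>2 \<le> norm g * ((1 - \<theta>\<^sub>1) * (1 - \<theta>\<^sub>2) * (1 - \<beta>))"
    using par by (simp add: pos_divide_le_eq)
  also have "\<dots> = (1 - \<theta>\<^sub>2) * (1 - \<beta>) * ((1 - \<theta>\<^sub>1) * norm g)" by simp
  also have "\<dots> \<le> (1 - \<theta>\<^sub>2) * (1 - \<beta>) * (\<Lambda> * norm p)"
    using par \<open>(1 - \<theta>\<^sub>1) * norm g \<le> \<Lambda> * norm p\<close> by (intro mult_left_mono) auto
  finally have "\<kappa>t * (4 * \<epsilon>\<^sub>2) \<le> \<kappa>t * ((1 - \<theta>\<^sub>2) * (1 - \<beta>) * \<gamma> * norm p)" by (simp add: \<Lambda>_def mult_ac)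
  hence "4 * \<epsilon>\<^sub>2 \<le> (1 - \<theta>\<^sub>2) * (1 - \<beta>) * \<gamma> * norm p" using par by (subst (asm) mult_le_cancel_left_pos) auto
  from mult_right_mono[OF this, of "norm p"]
  have eps: "\<epsilon>\<^sub>2 * norm p \<le> (1 - \<theta>\<^sub>2) * (1 - \<beta>) * \<gamma> / 4 * P" by (simp add: P_def power2_eq_square mult.assoc)
  have "p \<bullet> d = p \<bullet> g - p \<bullet> (g - d)" by (simp add: inner_diff_right)
  also have "\<dots> \<le> p \<bullet> g + norm p * norm (g - d)"
    using Cauchy_Schwarz_ineq2[of p "g - d"] by linarith
  also have "\<dots> \<le> p \<bullet> g + \<epsilon>\<^sub>2 * norm p"
    using g(2) mult_left_mono[of "norm (g - d)" \<epsilon>\<^sub>2 "norm p"] by (simp add: mult.commute)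
  finally have "p \<bullet> d + (1 - \<theta>\<^sub>2) * (1 - \<beta>) * (1 - \<epsilon>\<^sub>1) * \<gamma> / 2 * P
     \<le> p \<bullet> g + (1 - \<theta>\<^sub>2) * (1 - \<beta>) * \<gamma> / 4 * P + (1 - \<theta>\<^sub>2) * (1 - \<beta>) * (1 - \<epsilon>\<^sub>1) * \<gamma> / 2 * P"
    using eps by simp
  \<comment> \<open>This dictates \<mu>: \<open>3/4 - \<epsilon>\<^sub>1/2\<close> is 1/4 for the
    gradient error plus \<open>(1 - \<epsilon>\<^sub>1)/2\<close> for the curvature of
    \<open>F\<close>.\<close>
  also have "\<dots> = p \<bullet> g + (1 - \<beta>) * ((1 - \<theta>\<^sub>2) * (\<mu> * P))"
    by (simp add: \<mu>(1) field_simps)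
  also have "\<dots> \<le> p \<bullet> g + (1 - \<beta>) * (- (p \<bullet> g))"
    using curv par by (intro add_left_mono mult_left_mono) auto
  finally have dec: "p \<bullet> d + (1 - \<theta>\<^sub>2) * (1 - \<beta>) * (1 - \<epsilon>\<^sub>1) * \<gamma> / 2 * (norm p)\<^sup>2 \<le> \<beta> * (p \<bullet> g)"
    by (simp add: P_def algebra_simps)
  have "decrease_rate \<kappa>t \<theta>\<^sub>1 \<theta>\<^sub>2 \<epsilon>\<^sub>1 * (25 / 32 * (norm g)\<^sup>2 / \<gamma>) \<le> - (p \<bullet> g)"
  proof (cases "\<theta>\<^sub>1 \<le> sqrt ((1 - \<epsilon>\<^sub>1) / (4 * \<kappa>t))")
    case True
    hence "\<theta>\<^sub>1\<^sup>2 \<le> (1 - \<epsilon>\<^sub>1) / (4 * \<kappa>t)"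
      using par real_sqrt_pow2[of "(1 - \<epsilon>\<^sub>1) / (4 * \<kappa>t)"] power_mono[OF True, of 2] by simp
    also have "\<dots> \<le> \<mu> / (3 * \<Lambda>)"
      using par by (simp add: \<mu>(1) \<Lambda>_def field_simps)
    finally have "2 / 5 * (norm g)\<^sup>2 / \<Lambda> \<le> - (p \<bullet> g)"
      using p par H by (intro inexact_newton_descent[OF _ _ \<mu>0 \<mu>(2) \<Lambda>, where \<theta> = \<theta>\<^sub>1])
         (auto simp: inexact_direction_def \<Lambda>_def)
    \<comment> \<open>25/72 is 4/9 times 25/32, below the 2/5 that the descent estimate
      provides.\<close>
    moreover have "decrease_rate \<kappa>t \<theta>\<^sub>1 \<theta>\<^sub>2 \<epsilon>\<^sub>1 * (25 / 32 * (norm g)\<^sup>2 / \<gamma>) = 25 / 72 * ((norm g)\<^sup>2 / \<Lambda>)"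
      using True par by (simp add: decrease_rate_def \<Lambda>_def)
    moreover have "0 \<le> (norm g)\<^sup>2 / \<Lambda>" using \<Lambda> by simp
    ultimately show ?thesis by (simp del: zero_le_divide_iff)
  next
    case False
    have "decrease_rate \<kappa>t \<theta>\<^sub>1 \<theta>\<^sub>2 \<epsilon>\<^sub>1 * (25 / 32 * (norm g)\<^sup>2 / \<gamma>)
       = (1 - \<theta>\<^sub>2) * (25 / 36 * (1 - \<epsilon>\<^sub>1) * \<gamma>) * ((1 - \<theta>\<^sub>1) * norm g / \<Lambda>)\<^sup>2"
    proof -
      have "8 * A * b\<^sup>2 * E / (9 * \<kappa>t\<^sup>2) * (25 / 32 * N\<^sup>2 / \<gamma>) = A * (25 / 36 * E * \<gamma>) * (b * N / (\<kappa>t * \<gamma>))\<^sup>2"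
        for A b E N :: real
        using par by (simp add: power2_eq_square field_simps)
      from this[of "1 - \<theta>\<^sub>2" "1 - \<theta>\<^sub>1" "1 - \<epsilon>\<^sub>1" "norm g"] show ?thesis
        using False unfolding decrease_rate_def \<Lambda>_def by (simp only: if_False)
    qed
    also have "\<dots> \<le> (1 - \<theta>\<^sub>2) * \<mu> * (norm p)\<^sup>2"
    proof (rule mult_mono)
      \<comment> \<open>25/36 is 8/9 times 25/32.\<close>
      have "25 / 36 * (1 - \<epsilon>\<^sub>1) \<le> 3 / 4 - \<epsilon>\<^sub>1 / 2" using par by simp
      hence "25 / 36 * (1 - \<epsilon>\<^sub>1) * \<gamma> \<le> \<mu>" unfolding \<mu>(1) using par by (intro mult_right_mono) auto
      thus "(1 - \<theta>\<^sub>2) * (25 / 36 * (1 - \<epsilon>\<^sub>1) * \<gamma>) \<le> (1 - \<theta>\<^sub>2) * \<mu>"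
        using par by (intro mult_left_mono) auto
      show "((1 - \<theta>\<^sub>1) * norm g / \<Lambda>)\<^sup>2 \<le> (norm p)\<^sup>2"
        using np par \<Lambda> by (intro power_mono) auto
    qed (use par \<mu>0 in auto)
    also have "\<dots> \<le> - (p \<bullet> g)" using curv by (simp add: P_def mult.assoc)
    finally show ?thesis .
  qed
  with dec show ?thesis by (simp only: good_direction_def simp_thms)
qed

text \<open>In dimension one \<open>p\<close> is \<open>- b\<close> times \<open>g\<close>, so the
  descent condition also bounds the length: \<open>(1 - \<theta>\<^sub>2) * (a * b) \<le> 1\<close>.
  With the factor 2/3 in the bound on \<open>a\<close>, the curvature term costs 1/2 * 3/2 = 3/4 of
  the available \<open>(1 - \<beta>) * b * |g|^2\<close>, leaving exactly 1/4 for the gradient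
  error. That error may reach \<open>w * \<epsilon>\<^sub>2\<close> for any
  \<open>w \<le> \<kappa>t\<close>, as \<sigma> contains the factor \<kappa>t.\<close>

lemma scalar_newton_direction:
  fixes H :: "real^'d^'d" and g d p :: "real^'d"
  assumes H: "\<And>v. H *v v = a *\<^sub>R v" "2 / 3 * (1 - \<epsilon>\<^sub>1) * \<gamma> \<le> a" "a \<le> \<kappa>t * \<gamma>"
    and one: "\<And>u v :: real^'d. u \<noteq> 0 \<Longrightarrow> \<exists>c. v = c *\<^sub>R u"
    and par: "0 < \<gamma>" "1 \<le> \<kappa>t" "0 < \<theta>\<^sub>1" "\<theta>\<^sub>1 < 1" "0 < \<theta>\<^sub>2" "\<theta>\<^sub>2 < 1" "0 < \<epsilon>\<^sub>1" "\<epsilon>\<^sub>1 \<le> 1 / 2" "0 < \<epsilon>\<^sub>2" "0 < \<beta>" "\<beta> < 1"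
    and \<sigma>: "\<sigma> \<ge> 4 * \<kappa>t / ((1 - \<theta>\<^sub>1) * (1 - \<theta>\<^sub>2) * (1 - \<beta>))"
    and g: "\<sigma> * \<epsilon>\<^sub>2 \<le> norm g" "g \<bullet> (g - d) \<le> w * \<epsilon>\<^sub>2 * norm g" "w \<le> \<kappa>t"
    and p: "inexact_direction H g \<theta>\<^sub>1 \<theta>\<^sub>2 p"
  shows "good_direction \<gamma> \<kappa>t \<theta>\<^sub>1 \<theta>\<^sub>2 \<epsilon>\<^sub>1 \<beta> d g p"
proof -
  have "0 < 2 / 3 * (1 - \<epsilon>\<^sub>1) * \<gamma>" using par by simp
  hence a0: "0 < a" using H(2) by linarith
  define N where "N = norm g"
  have "4 * \<kappa>t \<le> \<sigma> * ((1 - \<theta>\<^sub>1) * (1 - \<theta>\<^sub>2) * (1 - \<beta>))"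
    using \<sigma> par by (simp add: pos_divide_le_eq)
  moreover have "0 < (1 - \<theta>\<^sub>1) * (1 - \<theta>\<^sub>2) * (1 - \<beta>)" using par by simp
  ultimately have \<sigma>0: "0 < \<sigma>"
    using par zero_less_mult_pos2[of \<sigma> "(1 - \<theta>\<^sub>1) * (1 - \<theta>\<^sub>2) * (1 - \<beta>)"] by linarith
  have "(1 - \<theta>\<^sub>1) * (1 - \<theta>\<^sub>2) * (1 - \<beta>) \<le> 1 * 1 * (1 - \<beta>)"
    using par by (intro mult_mono) auto
  hence "\<sigma> * ((1 - \<theta>\<^sub>1) * (1 - \<theta>\<^sub>2) * (1 - \<beta>)) \<le> \<sigma> * (1 - \<beta>)"
    using \<sigma>0 by (intro mult_left_mono) auto
  with \<open>4 * \<kappa>t \<le> _\<close> have "4 * \<kappa>t \<le> \<sigma> * (1 - \<beta>)" by linarith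
  from mult_right_mono[OF this, of \<epsilon>\<^sub>2] have "4 * (\<kappa>t * \<epsilon>\<^sub>2) \<le> (1 - \<beta>) * (\<sigma> * \<epsilon>\<^sub>2)"
    using par by (simp add: mult_ac)
  also have "\<dots> \<le> (1 - \<beta>) * N" using g(1) par by (simp add: N_def)
  finally have w: "w * \<epsilon>\<^sub>2 \<le> (1 - \<beta>) * N / 4"
  proof -
    assume *: "4 * (\<kappa>t * \<epsilon>\<^sub>2) \<le> (1 - \<beta>) * N"
    have "w * \<epsilon>\<^sub>2 \<le> \<kappa>t * \<epsilon>\<^sub>2" using g(3) par by (intro mult_right_mono) auto
    with * show ?thesis by linarith
  qed
  have "0 < \<sigma> * \<epsilon>\<^sub>2" using \<sigma>0 par by simp
  hence N0: "0 < N" using g(1) unfolding N_def by linarith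
  hence "g \<noteq> 0" unfolding N_def by simp
  then obtain c where c: "p = c *\<^sub>R g" using one by blast
  define b where "b = - c"
  have pb: "p = - (b *\<^sub>R g)" by (simp add: c b_def)
  have gg: "g \<bullet> g = N * N" by (simp add: N_def dot_square_norm power2_eq_square)
  have pg: "p \<bullet> g = - (b * (N * N))" by (simp add: pb gg)
  have "H *v p + g = (1 - a * b) *\<^sub>R g" by (simp add: H(1) pb scaleR_diff_left)
  hence "\<bar>1 - a * b\<bar> * N \<le> \<theta>\<^sub>1 * N" using p by (simp add: inexact_direction_def N_def)
  hence "\<bar>1 - a * b\<bar> \<le> \<theta>\<^sub>1" using N0 by simp
  hence ab: "1 - \<theta>\<^sub>1 \<le> a * b" by linarith
  hence "0 < a * b" using par by linarith
  hence b0: "0 < b" using a0 by (rule zero_less_mult_pos)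
  have "p \<bullet> (H *v p) = a * (b * b) * (N * N)" by (simp add: H(1) pb gg)
  hence "- (b * (N * N)) \<le> - (1 - \<theta>\<^sub>2) * (a * (b * b) * (N * N))"
    using p by (simp add: inexact_direction_def pg)
  hence "(b * (N * N)) * ((1 - \<theta>\<^sub>2) * (a * b)) \<le> (b * (N * N)) * 1" by (simp add: algebra_simps)
  hence ab2: "(1 - \<theta>\<^sub>2) * (a * b) \<le> 1" using b0 N0 by (subst (asm) mult_le_cancel_left_pos) auto
  have "3 / 2 * (2 / 3 * (1 - \<epsilon>\<^sub>1) * \<gamma>) = (1 - \<epsilon>\<^sub>1) * \<gamma>" by simp
  hence "(1 - \<epsilon>\<^sub>1) * \<gamma> \<le> 3 / 2 * a" using H(2) by linarith
  hence "(1 - \<theta>\<^sub>2) * ((1 - \<epsilon>\<^sub>1) * \<gamma>) * b \<le> (1 - \<theta>\<^sub>2) * (3 / 2 * a) * b"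
    using par b0 by (intro mult_right_mono mult_left_mono) auto
  also have "\<dots> = 3 / 2 * ((1 - \<theta>\<^sub>2) * (a * b))" by simp
  also have "\<dots> \<le> 3 / 2" using ab2 by linarith
  finally have half: "(1 - \<theta>\<^sub>2) * (1 - \<epsilon>\<^sub>1) * \<gamma> * b \<le> 3 / 2" by (simp only: mult.assoc)
  have "p \<bullet> d = p \<bullet> g + b * (g \<bullet> (g - d))" by (simp add: pb inner_diff_right algebra_simps)
  also have "\<dots> \<le> p \<bullet> g + b * (w * \<epsilon>\<^sub>2 * N)"
    using g(2) b0 by (simp add: N_def)
  also have "\<dots> \<le> p \<bullet> g + b * ((1 - \<beta>) * N / 4 * N)"
    using w b0 N0 by (intro add_left_mono mult_left_mono mult_right_mono) auto
  finally have 1: "p \<bullet> d \<le> p \<bullet> g + (1 - \<beta>) * (b * (N * N)) / 4" by (simp add: mult_ac)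
  have "(norm p)\<^sup>2 = b * (b * (N * N))" by (simp add: pb N_def power_mult_distrib power2_eq_square mult_ac)
  hence "(1 - \<theta>\<^sub>2) * (1 - \<beta>) * (1 - \<epsilon>\<^sub>1) * \<gamma> / 2 * (norm p)\<^sup>2
      = (1 - \<beta>) * (b * (N * N)) / 2 * ((1 - \<theta>\<^sub>2) * (1 - \<epsilon>\<^sub>1) * \<gamma> * b)" by (simp add: mult_ac)
  also have "\<dots> \<le> (1 - \<beta>) * (b * (N * N)) / 2 * (3 / 2)"
    using half par b0 N0 by (intro mult_left_mono) auto
  finally have "p \<bullet> d + (1 - \<theta>\<^sub>2) * (1 - \<beta>) * (1 - \<epsilon>\<^sub>1) * \<gamma> / 2 * (norm p)\<^sup>2 \<le> p \<bullet> g + (1 - \<beta>) * (b * (N * N))"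
    using 1 by linarith
  hence dec: "p \<bullet> d + (1 - \<theta>\<^sub>2) * (1 - \<beta>) * (1 - \<epsilon>\<^sub>1) * \<gamma> / 2 * (norm p)\<^sup>2 \<le> \<beta> * (p \<bullet> g)"
    by (simp add: pg left_diff_distrib)
  have "(1 - \<theta>\<^sub>1) / (\<kappa>t * \<gamma>) \<le> (1 - \<theta>\<^sub>1) / a" using H(3) a0 par by (intro divide_left_mono) auto
  also have "\<dots> \<le> b" using ab a0 by (simp add: field_simps)
  finally have "(1 - \<theta>\<^sub>1) / (\<kappa>t * \<gamma>) * (N * N) \<le> b * (N * N)" by (intro mult_right_mono) auto
  hence desc: "(1 - \<theta>\<^sub>1) / \<kappa>t * (N\<^sup>2 / \<gamma>) \<le> - (p \<bullet> g)" by (simp add: pg power2_eq_square)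
  have "decrease_rate \<kappa>t \<theta>\<^sub>1 \<theta>\<^sub>2 \<epsilon>\<^sub>1 * (25 / 32) \<le> (1 - \<theta>\<^sub>1) / \<kappa>t"
  proof (cases "\<theta>\<^sub>1 \<le> sqrt ((1 - \<epsilon>\<^sub>1) / (4 * \<kappa>t))")
    case True
    \<comment> \<open>The threshold is at most 1/2 because \<open>\<kappa>t \<ge> 1\<close>, which
      keeps \<open>1 - \<theta>\<^sub>1\<close> above 25/72.\<close>
    also have "sqrt ((1 - \<epsilon>\<^sub>1) / (4 * \<kappa>t)) \<le> sqrt ((1 / 2)\<^sup>2)"
      using par by (intro real_sqrt_le_mono) (simp add: field_simps power2_eq_square)
    finally have "\<theta>\<^sub>1 \<le> 1 / 2" by simp
    hence "25 / 72 / \<kappa>t \<le> (1 - \<theta>\<^sub>1) / \<kappa>t" using par by (intro divide_right_mono) auto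
    thus ?thesis using True by (simp add: decrease_rate_def)
  next
    case False
    have "(1 - \<theta>\<^sub>2) * ((1 - \<theta>\<^sub>1) * (1 - \<epsilon>\<^sub>1)) * (25 / 36 / \<kappa>t) \<le> 1 * (1 * 1) * 1"
      using par by (intro mult_mono) auto
    hence "(1 - \<theta>\<^sub>1) / \<kappa>t * ((1 - \<theta>\<^sub>2) * ((1 - \<theta>\<^sub>1) * (1 - \<epsilon>\<^sub>1)) * (25 / 36 / \<kappa>t)) \<le> (1 - \<theta>\<^sub>1) / \<kappa>t * 1"
      using par by (intro mult_left_mono) auto
    moreover have "decrease_rate \<kappa>t \<theta>\<^sub>1 \<theta>\<^sub>2 \<epsilon>\<^sub>1 * (25 / 32)
      = (1 - \<theta>\<^sub>1) / \<kappa>t * ((1 - \<theta>\<^sub>2) * ((1 - \<theta>\<^sub>1) * (1 - \<epsilon>\<^sub>1)) * (25 / 36 / \<kappa>t))"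
    proof -
      have "8 * A * b\<^sup>2 * E / (9 * \<kappa>t\<^sup>2) * (25 / 32) = b / \<kappa>t * (A * (b * E) * (25 / 36 / \<kappa>t))" for A b E :: real
        using par by (simp add: power2_eq_square field_simps)
      from this[of "1 - \<theta>\<^sub>2" "1 - \<theta>\<^sub>1" "1 - \<epsilon>\<^sub>1"] show ?thesis
        using False unfolding decrease_rate_def by (simp only: if_False)
    qed
    ultimately show ?thesis by linarith
  qed
  from mult_right_mono[OF this, of "N\<^sup>2 / \<gamma>"] desc par
  have "decrease_rate \<kappa>t \<theta>\<^sub>1 \<theta>\<^sub>2 \<epsilon>\<^sub>1 * (25 / 32 * (norm g)\<^sup>2 / \<gamma>) \<le> - (p \<bullet> g)"
    by (simp add: N_def mult_ac)
  with dec show ?thesis by (simp only: good_direction_def simp_thms)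
qed

subsection \<open>Combining the failure probabilities\<close>

text \<open>A rational lower bound for the exponential, its [1/1] Pade approximant, reduces success
  bounds to polynomial inequalities.\<close>

lemma exp_minus_ge_Pade:
  assumes "0 \<le> (L::real)" shows "(2 - L) / (2 + L) \<le> exp (- L)"
proof -
  let ?f = "\<lambda>x::real. 2 + x - (2 - x) * exp x"
  have "?f 0 \<le> ?f L"
  proof (rule DERIV_nonneg_imp_nondecreasing[OF assms])
    fix x :: real assume "0 \<le> x" "x \<le> L"
    have "(?f has_real_derivative (1 - (1 - x) * exp x)) (at x)"
      by (auto intro!: derivative_eq_intros simp: algebra_simps)
    moreover have "(1 - x) * exp x \<le> exp (- x) * exp x"
      using exp_ge_add_one_self[of "- x"] by (intro mult_right_mono) auto
    hence "0 \<le> 1 - (1 - x) * exp x" by (simp flip: exp_add)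
    ultimately show "\<exists>y. (?f has_real_derivative y) (at x) \<and> 0 \<le> y" by blast
  qed
  hence "(2 - L) * exp L * exp (- L) \<le> (2 + L) * exp (- L)" by (intro mult_right_mono) auto
  hence "2 - L \<le> (2 + L) * exp (- L)" by (simp add: mult.assoc flip: exp_add)
  thus ?thesis using assms by (simp add: field_simps)
qed

text \<open>For \<open>L \<ge> 1\<close> the failures may be added: relative to
  \<open>exp (- L)\<close> they are at most \<open>exp (- 3/20)\<close> and
  \<open>exp (- 3)\<close>, hence at most 20/23 and 1/8.\<close>

lemma success_bound_small_delta:
  assumes L: "1 \<le> L" and a: "a \<le> exp (- (23 / 20 * L))" and b: "0 \<le> a" "0 \<le> b" "b \<le> exp (- (4 * L))"
  shows "1 - exp (- L) \<le> (1 - a) * (1 - (b::real))"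
proof -
  have "exp (- (3 / 20 * L)) \<le> exp (- (3 / 20 :: real))" using L by simp
  also have "\<dots> \<le> 20 / 23" using exp_ge_add_one_self[of "3 / 20"] by (simp add: exp_minus field_simps)
  finally have 1: "exp (- (3 / 20 * L)) \<le> 20 / 23" .
  have "exp (- (3 * L)) \<le> exp (- 3 :: real)" using L by simp
  also have "\<dots> \<le> 1 / 8" using exp_lower_Taylor_quadratic[of 3] by (simp add: exp_minus field_simps)
  finally have "exp (- (3 / 20 * L)) + exp (- (3 * L)) \<le> 1" using 1 by simp
  from mult_left_mono[OF this, of "exp (- L)"]
  have "exp (- L) * exp (- (3 / 20 * L)) + exp (- L) * exp (- (3 * L)) \<le> exp (- L)"
    by (simp add: distrib_left)
  hence "a + b \<le> exp (- L)" using a b by (simp flip: exp_add add: algebra_simps)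
  moreover have "0 \<le> a * b" using b by simp
  moreover have "(1 - a) * (1 - b) = 1 - a - b + a * b" by (simp add: algebra_simps)
  ultimately show ?thesis by linarith
qed

lemma success_bound_mono:
  assumes "1 - (y::real) \<le> (1 - A) * (1 - B)" "a \<le> A" "A \<le> 1" "b \<le> B" "B \<le> 1"
  shows "1 - y \<le> (1 - a) * (1 - b)"
  using mult_mono[of "1 - A" "1 - a" "1 - B" "1 - b"] assms by simp

lemma chebyshev_factor:
  assumes "0 \<le> (t::real)" shows "1 - 1 / (1 + t)\<^sup>2 = t * (2 + t) / (1 + t)\<^sup>2"
proof -
  have "0 < (1 + t)\<^sup>2" using assms by simp
  moreover have "(1 + t)\<^sup>2 - 1 = t * (2 + t)" by (simp add: power2_eq_square algebra_simps)
  ultimately show ?thesis by (metis diff_divide_distrib divide_self less_irrefl)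
qed

text \<open>The factor 91/100 stands for dimension at least two. The Pade bound leaves an inequality
  in \<open>t\<close> alone, which becomes cubic when \<open>16 - t * t\<close> is replaced by 8,
  its least value for \<open>L \<le> 1\<close>.\<close>

lemma success_bound_large_delta:
  assumes L: "0 < L" "L \<le> 1" and t: "t = sqrt (8 * L)"
    and a: "a \<le> 91 / 100 * exp (- (23 / 20 * L))" and b: "b \<le> 1 / (1 + t)\<^sup>2"
  shows "1 - exp (- L) \<le> (1 - a) * (1 - (b::real))"
proof -
  have t2: "t * t = 8 * L" using L by (simp add: t)
  have t0: "0 < t" using L by (simp add: t)
  have "t\<^sup>2 \<le> 3\<^sup>2" using t2 L by (simp add: power2_eq_square)
  hence t3: "t \<le> 3" by (rule power2_le_imp_le) simp
  define y where "y = exp (- L)"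
  define A where "A = (91 / 100) / (1 + 3 / 20 * L)"
  have y: "0 < y" "y \<le> 1" using L by (simp_all add: y_def)
  have A: "0 < A" "A \<le> 1" using L by (simp_all add: A_def)
  have "exp (- (3 / 20 * L)) \<le> 1 / (1 + 3 / 20 * L)"
    using exp_ge_add_one_self[of "3 / 20 * L"] L by (simp add: exp_minus field_simps)
  from mult_left_mono[OF this, of "91 / 100 * y"] y
  have "91 / 100 * (y * exp (- (3 / 20 * L))) \<le> A * y" by (simp add: A_def mult_ac)
  hence aA: "a \<le> A * y" using a by (simp add: y_def flip: exp_add)
  have "78 / 1000 + 163 / 10000 * (8 * L) \<le> (9 / 100 + 3 / 20 * L) / (23 / 20)"
    using L by (simp add: field_simps)
  also have "\<dots> \<le> (9 / 100 + 3 / 20 * L) / (1 + 3 / 20 * L)"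
    using L by (intro divide_left_mono) auto
  also have "\<dots> = 1 - A" using L by (simp add: A_def field_simps)
  finally have A1: "78 / 1000 + 163 / 10000 * (t * t) \<le> 1 - A" unfolding t2 .
  \<comment> \<open>The cubic is smallest near \<open>t = 13/10\<close>; expanding around that point
    leaves a linear remainder that is positive up to \<open>t = 3\<close>.\<close>
  have "0 \<le> 1304 / 10000 * ((t - 13 / 10) * (t - 13 / 10) * (t + 26 / 10))"
    "0 \<le> 2608 / 10000 * ((t - 13 / 10) * (t - 13 / 10))" using t0 by simp_all
  moreover have "8 * ((78 / 1000 + 163 / 10000 * (t * t)) * (t + 2)) - 2 * t
      = 1304 / 10000 * ((t - 13 / 10) * (t - 13 / 10) * (t + 26 / 10))
       + 2608 / 10000 * ((t - 13 / 10) * (t - 13 / 10)) + (2342704 / 10000000 - 36792 / 1000000 * t)"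
    by (simp add: field_simps)
  moreover have "0 \<le> 2342704 / 10000000 - 36792 / 1000000 * t" using t3 by simp
  ultimately have "2 * t \<le> 8 * ((78 / 1000 + 163 / 10000 * (t * t)) * (t + 2))"
    by linarith
  also have "\<dots> \<le> 8 * ((1 - A) * (t + 2))" using A1 t0 by (intro mult_left_mono mult_right_mono) auto
  also have "\<dots> \<le> (16 - t * t) * ((1 - A) * (t + 2))"
    using t2 L A t0 by (intro mult_right_mono) auto
  finally have "2 * t * t \<le> (16 - t * t) * ((1 - A) * (t + 2)) * t" using t0 by (intro mult_right_mono) auto
  hence "16 + t * t \<le> (16 - t * t) * (1 + (1 - A) * (t * (t + 2)))" by (simp add: algebra_simps)
  moreover have "0 < 16 + t * t" by (simp add: add_pos_nonneg)
  ultimately have "1 \<le> (16 - t * t) * (1 + (1 - A) * (t * (t + 2))) / (16 + t * t)"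
    by (simp only: le_divide_eq_1_pos)
  hence "1 \<le> (16 - t * t) / (16 + t * t) * (1 + (1 - A) * (t * (t + 2)))"
    by (simp only: times_divide_eq_left)
  also have "(16 - t * t) / (16 + t * t) = (2 - L) / (2 + L)" unfolding t2 using L by (simp add: field_simps)
  also have "(2 - L) / (2 + L) * (1 + (1 - A) * (t * (t + 2))) \<le> y * (1 + (1 - A) * (t * (t + 2)))"
    using exp_minus_ge_Pade[of L] L A t0 by (intro mult_right_mono) (auto simp: y_def)
  finally have "1 \<le> y * ((1 + t)\<^sup>2 - A * (t * (2 + t)))" by (simp add: power2_eq_square algebra_simps)
  hence le: "1 / (1 + t)\<^sup>2 \<le> y * (1 - A * (t * (2 + t) / (1 + t)\<^sup>2))"
    using t0 by (simp add: field_simps)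
  define B where "B = 1 / (1 + t)\<^sup>2"
  have "B \<le> y * (1 - A * (1 - B))"
    using le t0 by (simp only: B_def chebyshev_factor less_imp_le)
  hence "1 - y \<le> (1 - A * y) * (1 - B)" by (simp add: algebra_simps)
  hence "1 - y \<le> (1 - A * y) * (1 - 1 / (1 + t)\<^sup>2)" by (simp only: B_def)
  moreover have "1 / (1 + t)\<^sup>2 \<le> 1" using t0 by simp
  moreover have "A * y \<le> 1" using A y by (simp add: mult_le_one)
  ultimately show ?thesis unfolding y_def[symmetric] by (intro success_bound_mono[OF _ aA _ b])
qed

text \<open>The Pade bound turns the claim into the polynomial inequality \<open>poly\<close>. Its
  constant term 9 must be beaten by \<open>46 * t\<close>, so \<open>t\<close> has to stay away from
  0, and 1/5 is enough.\<close>

lemma success_bound_scalar: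
  assumes L: "0 < L" "L \<le> 1" and t: "t = sqrt (8 * L)"
    and a: "a \<le> 9 / (9 + 4 * t\<^sup>2)" and b: "b \<le> 1 / (1 + t)\<^sup>2" and t5: "1 / 5 \<le> t"
  shows "1 - exp (- L) \<le> (1 - a) * (1 - (b::real))"
proof -
  have t2: "t * t = 8 * L" using L by (simp add: t)
  have t0: "0 < t" using t5 by simp
  have poly: "9 + 4 * (t * (t * t)) + 2 * (t * t * (t * t)) \<le> 46 * t + 19 * (t * t)"
  proof (cases "t \<le> 1")
    case True
    have "t * (t * t) \<le> t * 1" "t * t * (t * t) \<le> t * t * 1"
      using True t0 by (intro mult_left_mono mult_le_one, auto)+
    moreover have "1 / 5 * (1 / 5) \<le> t * t" using t5 by (intro mult_mono) auto
    ultimately show ?thesis using t5 by linarith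
  next
    case False
    have "t * (t * t) \<le> t * 8" "t * t * (t * t) \<le> t * t * 8"
      using t0 L t2 by (intro mult_left_mono, auto)+
    moreover have "1 * 1 \<le> t * t" using False by (intro mult_mono) auto
    ultimately show ?thesis using False by linarith
  qed
  have "2 * ((9 + 4 * (t * t)) * ((1 + t) * (1 + t))) \<le> (16 + t * t) * (4 * (t * (2 + t)))"
    using poly by (simp add: algebra_simps)
  hence "2 / (16 + t * t) \<le> 4 / (9 + 4 * (t * t)) * (t * (2 + t) / ((1 + t) * (1 + t)))"
    using t0 by (simp add: divide_simps add_pos_pos mult_ac)
  from mult_left_mono[OF this, of "t * t"]
  have *: "2 * (t * t) / (16 + t * t) \<le> 4 * (t * t) / (9 + 4 * (t * t)) * (t * (2 + t) / ((1 + t) * (1 + t)))"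
    using t0 by (simp add: mult_ac)
  have "1 - exp (- L) \<le> 1 - (2 - L) / (2 + L)" using exp_minus_ge_Pade[of L] L by simp
  also have "\<dots> = 2 * (t * t) / (16 + t * t)" unfolding t2 using L by (simp add: field_simps)
  also note *
  also have "4 * (t * t) / (9 + 4 * (t * t)) = 1 - 9 / (9 + 4 * t\<^sup>2)"
  proof -
    have "0 < 9 + 4 * t\<^sup>2" by (simp add: add_pos_nonneg)
    hence "1 - 9 / (9 + 4 * t\<^sup>2) = (9 + 4 * t\<^sup>2 - 9) / (9 + 4 * t\<^sup>2)"
      by (metis diff_divide_distrib divide_self less_irrefl)
    thus ?thesis by (simp add: power2_eq_square)
  qed
  also have "t * (2 + t) / ((1 + t) * (1 + t)) = 1 - 1 / (1 + t)\<^sup>2"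
    using chebyshev_factor[of t] t0 by (simp add: power2_eq_square)
  finally have "1 - exp (- L) \<le> (1 - 9 / (9 + 4 * t\<^sup>2)) * (1 - 1 / (1 + t)\<^sup>2)" .
  moreover have "9 / (9 + 4 * t\<^sup>2) \<le> 1" by (subst divide_le_eq_1_pos) (auto simp: add_pos_nonneg)
  ultimately show ?thesis using t0 by (intro success_bound_mono[OF _ a _ b]) auto
qed

text \<open>A constant Hessian success of 1/19 suffices for small \<open>t\<close>: the gradient
  success is about \<open>2 * t\<close>, while \<open>L\<close> is only
  \<open>t * t / 8\<close>.\<close>

lemma success_bound_scalar_dense:
  assumes L: "0 < L" and t: "t = sqrt (8 * L)"
    and a: "a \<le> 18 / 19" and b: "b \<le> 1 / (1 + t)\<^sup>2" and t5: "t \<le> 1 / 5"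
  shows "1 - exp (- L) \<le> (1 - a) * (1 - (b::real))"
proof -
  have t2: "t * t = 8 * L" using L by (simp add: t)
  have t0: "0 < t" using L by (simp add: t)
  have "(1 + t) * (1 + t) \<le> 6 / 5 * (6 / 5)" using t0 t5 by (intro mult_mono) auto
  hence "t * ((1 + t) * (1 + t)) \<le> 1 / 5 * (36 / 25)" using t0 t5 by (intro mult_mono) auto
  hence "19 * (t * ((1 + t) * (1 + t))) \<le> 8 * (2 + t)" using t0 by simp
  hence "t / 8 \<le> 1 / 19 * ((2 + t) / ((1 + t) * (1 + t)))"
    using t0 by (simp add: divide_simps add_pos_pos mult_ac)
  from mult_left_mono[OF this, of t] t0
  have "L \<le> (1 - 18 / 19) * (1 - 1 / (1 + t)\<^sup>2)"
    using chebyshev_factor[of t] t2 by (simp add: power2_eq_square)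
  moreover have "1 - exp (- L) \<le> L" using exp_ge_add_one_self[of "- L"] by simp
  ultimately have "1 - exp (- L) \<le> (1 - 18 / 19) * (1 - 1 / (1 + t)\<^sup>2)" by linarith
  thus ?thesis using t0 by (intro success_bound_mono[OF _ a _ b]) auto
qed

text \<open>A constant gradient success of 4/9 suffices: the Hessian success is about
  \<open>32/9 * L\<close>, and 128/81 exceeds 1 with room for the error at small
  \<open>t\<close>.\<close>

lemma success_bound_scalar_sparse:
  assumes L: "0 < L" and t: "t = sqrt (8 * L)"
    and a: "a \<le> 9 / (9 + 4 * t\<^sup>2)" and b: "b \<le> 5 / 9" and t5: "t \<le> 1 / 5"
  shows "1 - exp (- L) \<le> (1 - a) * (1 - (b::real))"
proof -
  have t2: "t\<^sup>2 = 8 * L" using L by (simp add: t)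
  have t0: "0 < t" using L by (simp add: t)
  have "t\<^sup>2 \<le> (1 / 5)\<^sup>2" using t0 t5 by (intro power_mono) auto
  hence "9 * (9 + 4 * t\<^sup>2) \<le> 128" by (simp add: power2_eq_square)
  hence "9 * (9 + 32 * L) \<le> 128" unfolding t2 by simp
  hence "L * (9 * (9 + 32 * L)) \<le> L * 128" using L by (intro mult_left_mono) auto
  hence "L \<le> (1 - 9 / (9 + 4 * t\<^sup>2)) * (1 - 5 / 9)"
    unfolding t2 using L by (simp add: field_simps)
  moreover have "1 - exp (- L) \<le> L" using exp_ge_add_one_self[of "- L"] by simp
  ultimately have "1 - exp (- L) \<le> (1 - 9 / (9 + 4 * t\<^sup>2)) * (1 - 5 / 9)" by linarith
  moreover have "9 / (9 + 4 * t\<^sup>2) \<le> 1" by (subst divide_le_eq_1_pos) (auto simp: add_pos_nonneg)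
  ultimately show ?thesis by (intro success_bound_mono[OF _ a _ b]) auto
qed

section \<open>Constants of the Chernoff bound\<close>

lemma ln_5_3_le: "ln (5 / 3 :: real) \<le> 512 / 1000"
proof -
  have "(5 / 3 :: real) \<le> (1 + 8 / 125 + (8 / 125)\<^sup>2 / 2) ^ 8" by (simp add: eval_nat_numeral)
  also have "\<dots> \<le> exp (8 / 125) ^ 8" using exp_lower_Taylor_quadratic[of "8 / 125"] by (intro power_mono) auto
  also have "\<dots> = exp (512 / 1000)" by (simp flip: exp_of_nat_mult)
  finally have "ln (5 / 3 :: real) \<le> ln (exp (512 / 1000))" by (subst ln_le_cancel_iff) auto
  thus ?thesis by (simp only: ln_exp)
qed

text \<open>One parameter \<open>ln (5 / 3)\<close> serves all \<epsilon> up to 1/2; it is optimal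
  where \<open>3/4 - \<epsilon>/2\<close> equals 3/5. The factor 23/20 is limited by \<epsilon> =
  1/2, where 0.512/2 - 2/5 = -0.144 only just stays below -23/40 * 1/4 = -0.14375.\<close>

lemma chernoff_exponent:
  assumes "0 < \<epsilon>" "\<epsilon> \<le> (1 / 2 :: real)" and h: "2 * l / \<epsilon>\<^sup>2 \<le> h" and "0 \<le> h"
  shows "ln (5 / 3) * ((3 / 4 - \<epsilon> / 2) * h) - (1 - exp (- ln (5 / 3))) * h \<le> - (23 / 20 * l)"
proof -
  have "ln (5 / 3) * (3 / 4 - \<epsilon> / 2) \<le> 512 / 1000 * (3 / 4 - \<epsilon> / 2)"
    using ln_5_3_le assms by (intro mult_right_mono) auto
  moreover have "0 \<le> (1 / 2 - \<epsilon>) * (575 / 1000 * \<epsilon> + 315 / 10000)" using assms by simp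
  moreover have "(1 / 2 - \<epsilon>) * (575 / 1000 * \<epsilon> + 315 / 10000) = 256 / 1000 * \<epsilon> + 1575 / 100000 - 575 / 1000 * (\<epsilon> * \<epsilon>)"
    by (simp add: field_simps)
  ultimately have "ln (5 / 3) * (3 / 4 - \<epsilon> / 2) - 2 / 5 \<le> - (575 / 1000 * (\<epsilon> * \<epsilon>))"
    by argo
  from mult_right_mono[OF this \<open>0 \<le> h\<close>]
  have "ln (5 / 3) * ((3 / 4 - \<epsilon> / 2) * h) - 2 / 5 * h \<le> - (575 / 1000 * (\<epsilon> * \<epsilon> * h))"
    by (simp add: algebra_simps)
  also have "2 * l \<le> \<epsilon> * \<epsilon> * h" using h assms by (simp add: field_simps power2_eq_square)
  hence "- (575 / 1000 * (\<epsilon> * \<epsilon> * h)) \<le> - (23 / 20 * l)" by simp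
  finally have "ln (5 / 3) * ((3 / 4 - \<epsilon> / 2) * h) - 2 / 5 * h \<le> - (23 / 20 * l)" .
  moreover have "1 - exp (- ln (5 / 3)) = (2 / 5 :: real)" by (simp add: exp_minus)
  ultimately show ?thesis by (simp only:)
qed

lemma dimension_factor:
  assumes "0 < (p::real)"
  shows "p * exp (- (23 / 20 * (ln p + L))) = exp (- (3 / 20 * ln p)) * exp (- (23 / 20 * L))"
proof -
  have "p * exp (- (23 / 20 * (ln p + L))) = exp (ln p) * exp (- (23 / 20 * (ln p + L)))" using assms by simp
  also have "\<dots> = exp (- (3 / 20 * ln p)) * exp (- (23 / 20 * L))"
    by (simp add: algebra_simps flip: exp_add)
  finally show ?thesis .
qed

text \<open>The surplus 3/20 in the exponent outweighs the dimension and leaves \<open>p\<close> to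
  the power -3/20. In dimension one this gains nothing, hence the separate treatment.\<close>

lemma dimension_gain:
  assumes "2 \<le> (p::real)"
  shows "p * exp (- (23 / 20 * (ln p + L))) \<le> 91 / 100 * exp (- (23 / 20 * L))"
proof -
  have "p * exp (- (23 / 20 * (ln p + L))) = exp (- (3 / 20 * ln p)) * exp (- (23 / 20 * L))"
    using assms by (intro dimension_factor) simp
  also have "exp (- (3 / 20 * ln p)) \<le> exp (- (1 / 10))"
  proof -
    have "2 / 3 \<le> ln (2::real)" by (rule ln2_ge_two_thirds)
    also have "ln 2 \<le> ln p" using assms by simp
    finally show ?thesis by simp
  qed
  also have "exp (- (1 / 10)) \<le> (91 / 100 :: real)"
    using exp_ge_add_one_self[of "1 / 10"] by (simp add: exp_minus field_simps)
  finally show ?thesis by simp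
qed

subsection \<open>One iteration of the algorithm\<close>

text \<open>Independence multiplies the success probabilities; adding failures instead would lose
  the product term, which is decisive for \<delta> near 1.\<close>

lemma pair_prob_ge:
  assumes "\<And>S T. S \<in> set_pmf M \<Longrightarrow> T \<in> set_pmf N \<Longrightarrow> S \<notin> A \<Longrightarrow> T \<notin> B \<Longrightarrow> (S, T) \<in> E"
  shows "(1 - measure_pmf.prob M A) * (1 - measure_pmf.prob N B) \<le> measure_pmf.prob (pair_pmf M N) E"
proof -
  have c: "1 - measure_pmf.prob p A = measure_pmf.prob p ((- A) \<inter> set_pmf p)" for p :: "'c pmf" and A
    using measure_pmf.prob_compl[of A p] by (simp add: measure_Int_set_pmf Compl_eq_Diff_UNIV)
  have "(1 - measure_pmf.prob M A) * (1 - measure_pmf.prob N B)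
      = measure_pmf.prob (pair_pmf M N) (((- A) \<inter> set_pmf M) \<times> ((- B) \<inter> set_pmf N))"
    unfolding c by (rule measure_pmf_prob_product[symmetric]) (auto intro: countable_subset[OF Int_lower2])
  also have "\<dots> \<le> measure_pmf.prob (pair_pmf M N) E"
    using assms by (intro measure_pmf.finite_measure_mono) auto
  finally show ?thesis .
qed

text \<open>The deterministic part of the argument. The constant 25/32 in
  \<open>good_direction\<close> is half the square of the 5/4 in \<open>cont\<close>, the half
  coming from \<open>gap\<close>.\<close>

lemma iteration_holds:
  fixes F :: "real^'d \<Rightarrow> real"
  assumes upper: "\<And>p. F (x + p) \<le> F x + p \<bullet> d + K / 2 * (norm p)\<^sup>2"
    and gap: "F x - Fs \<le> (norm d)\<^sup>2 / (2 * \<gamma>)"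
    and par: "0 < \<gamma>" "\<gamma> \<le> K" "\<kappa> = K / \<gamma>" "1 \<le> \<kappa>t" "0 < \<theta>\<^sub>1" "\<theta>\<^sub>1 < 1" "0 < \<theta>\<^sub>2" "\<theta>\<^sub>2 < 1"
      "0 < \<epsilon>\<^sub>1" "\<epsilon>\<^sub>1 \<le> 1 / 2" "0 < \<beta>" "\<beta> < 1" "1 \<le> \<alpha>max"
    and stop: "norm g < \<sigma> * \<epsilon>\<^sub>2 \<Longrightarrow> norm d < (1 + \<sigma>) * \<epsilon>\<^sub>2"
    and cont: "\<sigma> * \<epsilon>\<^sub>2 \<le> norm g \<Longrightarrow> norm d \<le> 5 / 4 * norm g"
    and dir: "\<And>p. \<sigma> * \<epsilon>\<^sub>2 \<le> norm g \<Longrightarrow> inexact_direction H g \<theta>\<^sub>1 \<theta>\<^sub>2 p \<Longrightarrow>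
        good_direction \<gamma> \<kappa>t \<theta>\<^sub>1 \<theta>\<^sub>2 \<epsilon>\<^sub>1 \<beta> d g p"
  shows "(norm g < \<sigma> * \<epsilon>\<^sub>2 \<longrightarrow> norm d < (1 + \<sigma>) * \<epsilon>\<^sub>2) \<and>
     (\<not> norm g < \<sigma> * \<epsilon>\<^sub>2 \<longrightarrow>
        (\<forall>p \<alpha> \<rho>. inexact_direction H g \<theta>\<^sub>1 \<theta>\<^sub>2 p \<longrightarrow>
           largest_step F x g p \<beta> \<alpha>max \<alpha> \<longrightarrow>
           \<rho> = (if \<theta>\<^sub>1 \<le> sqrt ((1 - \<epsilon>\<^sub>1) / (4 * \<kappa>t))
                then 4 * \<alpha> * \<beta> / (9 * \<kappa>t)
                else 8 * \<alpha> * \<beta> * (1 - \<theta>\<^sub>2) * (1 - \<theta>\<^sub>1)\<^sup>2 * (1 - \<epsilon>\<^sub>1) / (9 * \<kappa>t\<^sup>2)) \<longrightarrow>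
           F (x + \<alpha> *\<^sub>R p) - Fs \<le> (1 - \<rho>) * (F x - Fs) \<and>
           \<alpha> \<ge> (1 - \<theta>\<^sub>2) * (1 - \<beta>) * (1 - \<epsilon>\<^sub>1) / \<kappa>))"
proof (intro conjI impI allI)
  assume "norm g < \<sigma> * \<epsilon>\<^sub>2" thus "norm d < (1 + \<sigma>) * \<epsilon>\<^sub>2" by (rule stop)
next
  fix p \<alpha> \<rho>
  assume ng: "\<not> norm g < \<sigma> * \<epsilon>\<^sub>2" and p: "inexact_direction H g \<theta>\<^sub>1 \<theta>\<^sub>2 p"
    and step: "largest_step F x g p \<beta> \<alpha>max \<alpha>"
    and \<rho>: "\<rho> = (if \<theta>\<^sub>1 \<le> sqrt ((1 - \<epsilon>\<^sub>1) / (4 * \<kappa>t))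
                then 4 * \<alpha> * \<beta> / (9 * \<kappa>t)
                else 8 * \<alpha> * \<beta> * (1 - \<theta>\<^sub>2) * (1 - \<theta>\<^sub>1)\<^sup>2 * (1 - \<epsilon>\<^sub>1) / (9 * \<kappa>t\<^sup>2))"
  have g: "\<sigma> * \<epsilon>\<^sub>2 \<le> norm g" using ng by simp
  define \<alpha>0 where "\<alpha>0 = (1 - \<theta>\<^sub>2) * (1 - \<beta>) * (1 - \<epsilon>\<^sub>1) / \<kappa>"
  define c where "c = decrease_rate \<kappa>t \<theta>\<^sub>1 \<theta>\<^sub>2 \<epsilon>\<^sub>1"
  have c: "0 \<le> c" using par by (simp add: c_def decrease_rate_def)
  have \<rho>c: "\<rho> = \<alpha> * \<beta> * c" by (simp add: \<rho> c_def decrease_rate_def mult_ac)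
  have \<kappa>: "1 \<le> \<kappa>" using par by simp
  have "(1 - \<theta>\<^sub>2) * (1 - \<beta>) * (1 - \<epsilon>\<^sub>1) \<le> 1 * 1 * 1" using par by (intro mult_mono) auto
  hence "\<alpha>0 \<le> 1" unfolding \<alpha>0_def using \<kappa> by (subst pos_divide_le_eq) auto
  moreover have "0 < \<alpha>0" unfolding \<alpha>0_def using par(5-12) \<kappa> by (intro divide_pos_pos mult_pos_pos) auto
  ultimately have \<alpha>0: "0 < \<alpha>0" "\<alpha>0 \<le> \<alpha>max" using par by auto
  have "\<alpha>0 * K = (1 - \<theta>\<^sub>2) * (1 - \<beta>) * (1 - \<epsilon>\<^sub>1) * \<gamma>" using par by (simp add: \<alpha>0_def)
  hence dec': "p \<bullet> d + \<alpha>0 * K / 2 * (norm p)\<^sup>2 \<le> \<beta> * (p \<bullet> g)" using dir[OF g p] by (simp add: good_direction_def)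
  have "(norm d)\<^sup>2 \<le> (5 / 4 * norm g)\<^sup>2" using cont[OF g] by (intro power_mono) auto
  hence "(norm d)\<^sup>2 / (2 * \<gamma>) \<le> (5 / 4 * norm g)\<^sup>2 / (2 * \<gamma>)" using par by (intro divide_right_mono) auto
  hence "F x - Fs \<le> 25 / 32 * (norm g)\<^sup>2 / \<gamma>" using gap by (simp add: power2_eq_square)
  from mult_left_mono[OF this c] have desc': "c * (F x - Fs) \<le> - (p \<bullet> g)"
    using dir[OF g p] unfolding c_def good_direction_def by linarith
  note concl = iteration_conclusion[OF upper step \<alpha>0 _ dec' desc']
  show "F (x + \<alpha> *\<^sub>R p) - Fs \<le> (1 - \<rho>) * (F x - Fs)" unfolding \<rho>c using concl(1) par by simp
  show "\<alpha> \<ge> (1 - \<theta>\<^sub>2) * (1 - \<beta>) * (1 - \<epsilon>\<^sub>1) / \<kappa>" using concl(2) par by (simp add: \<alpha>0_def)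
qed

text \<open>Chebyshev's and McDiarmid's bounds, and one for an asymmetric error along a direction
  \<open>u\<close> that does not degenerate as \<open>t\<close> tends to 0.\<close>

lemma gradient_sample_bounds:
  fixes v :: "nat \<Rightarrow> 'b::real_inner"
  assumes n: "n \<ge> 1" and \<mu>: "\<mu> = (1 / real n) *\<^sub>R (\<Sum>j=1..n. v j)"
    and G: "\<And>j. j \<in> {1..n} \<Longrightarrow> norm (v j) \<le> G" and \<epsilon>: "0 < \<epsilon>"
    and L: "0 < L" "t = sqrt (8 * L)" and s: "G\<^sup>2 / \<epsilon>\<^sup>2 * (1 + t)\<^sup>2 \<le> real s"
  shows "iid_prob n s {S. \<epsilon> < norm (sample_mean v S - \<mu>)} \<le> 1 / (1 + t)\<^sup>2"
    and "iid_prob n s {S. \<epsilon> < norm (sample_mean v S - \<mu>)} \<le> exp (- (4 * L))"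
    and "norm u = 1 \<Longrightarrow> iid_prob n s
        {S. \<not> (- \<epsilon> < u \<bullet> (sample_mean v S - \<mu>) \<and> u \<bullet> (sample_mean v S - \<mu>) \<le> 2 * \<epsilon>)} \<le> 5 / 9"
proof -
  let ?p = "draw With_Replacement n s"
  have t0: "0 < t" using L by simp
  have "norm (v 1) \<le> G" using G n by simp
  hence "0 \<le> G" using norm_ge_zero order_trans by blast
  let ?P = "measure_pmf.prob ?p"
  let ?D = "{S. \<epsilon> < norm (sample_mean v S - \<mu>)}" and ?U = "{S. \<not> (- \<epsilon> < u \<bullet> (sample_mean v S - \<mu>) \<and> u \<bullet> (sample_mean v S - \<mu>) \<le> 2 * \<epsilon>)}"
  have "?P ?D \<le> 1 / (1 + t)\<^sup>2 \<and> ?P ?D \<le> exp (- (4 * L)) \<and> (norm u = 1 \<longrightarrow> ?P ?U \<le> 5 / 9)"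
  proof (cases "G = 0")
    \<comment> \<open>Here the sample may be empty, with mean 0; as all \<open>v j\<close> vanish,
      there is no error.\<close>
    case True
    hence v0: "v j = 0" if "j \<in> {1..n}" for j using G[OF that] by simp
    have "sample_mean v S - \<mu> = 0" if "S \<in> samples With_Replacement n s" for S
    proof -
      have "(\<Sum>j\<leftarrow>S. v j) = (\<Sum>j\<leftarrow>S. 0)" using that v0 by (intro arg_cong[where f = sum_list] map_cong) auto
      moreover have "(\<Sum>j=1..n. v j) = 0" using v0 by (intro sum.neutral) auto
      ultimately show ?thesis by (simp add: sample_mean_def \<mu>)
    qed
    hence zero: "?P B = 0" if "\<And>S. sample_mean v S - \<mu> = 0 \<Longrightarrow> S \<notin> B" for B
      using prob_draw_le_expectation[OF n, of With_Replacement s "\<lambda>_. 0" B 1] that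
      by (simp add: measure_le_0_iff)
    have "?P ?D = 0"
      using \<epsilon> by (intro zero) simp
    moreover have "?P ?U = 0"
      using \<epsilon> by (intro zero) (simp del: right_minus_eq)
    ultimately show ?thesis
      using t0 by simp
  next
    case False
    hence G0: "0 < G" using \<open>0 \<le> G\<close> by simp
    have "0 < G\<^sup>2 / \<epsilon>\<^sup>2 * (1 + t)\<^sup>2" using G0 \<epsilon> t0 by simp
    hence s1: "1 \<le> s" using s by (cases s) auto
    have Gs: "G\<^sup>2 / real s \<le> \<epsilon>\<^sup>2 * (1 / (1 + t)\<^sup>2)"
    proof -
      have "0 < (1 + t)\<^sup>2" using t0 by simp
      thus ?thesis using s s1 \<epsilon> by (simp add: field_simps)
    qed
    have avg: "(\<Sum>j=1..n. (norm (v j))\<^sup>2) / real n \<le> G\<^sup>2"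
    proof -
      have "(\<Sum>j=1..n. (norm (v j))\<^sup>2) \<le> (\<Sum>j=1..n. G\<^sup>2)" using G by (intro sum_mono power_mono) auto
      thus ?thesis using n by (simp add: field_simps)
    qed
    have "measure_pmf.expectation ?p (\<lambda>S. (norm (sample_mean v S - \<mu>))\<^sup>2) \<le> G\<^sup>2 / real s"
      unfolding expectation_sample_mean_deviation[OF n s1 \<mu>]
      using avg zero_le_power2[of "norm \<mu>"] by (intro divide_right_mono) (linarith, simp)
    hence var: "measure_pmf.expectation ?p (\<lambda>S. (norm (sample_mean v S - \<mu>))\<^sup>2) \<le> \<epsilon>\<^sup>2 * (1 / (1 + t)\<^sup>2)"
      using Gs by simp
    have "?P ?D
        \<le> measure_pmf.expectation ?p (\<lambda>S. (norm (sample_mean v S - \<mu>))\<^sup>2) / \<epsilon>\<^sup>2"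
      using n \<epsilon> by (intro prob_draw_le_expectation) (auto intro: power_mono)
    also have "\<dots> \<le> \<epsilon>\<^sup>2 * (1 / (1 + t)\<^sup>2) / \<epsilon>\<^sup>2" using var by (intro divide_right_mono) auto
    finally have 1: "?P ?D \<le> 1 / (1 + t)\<^sup>2" using \<epsilon> by simp
    \<comment> \<open>The prescribed size makes \<open>(1 + t) * G / sqrt (real s)\<close> at most
      \<epsilon>, so an excess of \<open>t\<close> times the expected deviation is allowed;
      McDiarmid's exponent is then \<open>t^2 / 2 = 4 * L\<close>.\<close>
    define \<tau> where "\<tau> = t * (G / sqrt (real s))"
    have \<tau>: "0 < \<tau>" using t0 G0 s1 by (simp add: \<tau>_def)
    have "(G / \<epsilon> * (1 + t))\<^sup>2 \<le> real s" using s by (simp add: power_mult_distrib power_divide)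
    hence "G / \<epsilon> * (1 + t) \<le> sqrt (real s)" by (rule real_le_rsqrt)
    hence "G / sqrt (real s) + \<tau> \<le> \<epsilon>" using \<epsilon> s1 by (simp add: \<tau>_def field_simps)
    hence "?P ?D \<le> exp (- \<tau>\<^sup>2 * real s / (2 * G\<^sup>2))"
      by (intro prob_sample_mean_deviation[OF n s1 \<mu> G G0 \<tau>])
    also have "- \<tau>\<^sup>2 * real s / (2 * G\<^sup>2) = - (4 * L)"
    proof -
      have "\<tau>\<^sup>2 * real s / (2 * G\<^sup>2) = t\<^sup>2 / 2"
        using G0 s1 by (simp add: \<tau>_def power_mult_distrib power_divide)
      also have "\<dots> = 4 * L" using L by simp
      finally show ?thesis by simp
    qed
    finally have 2: "?P ?D \<le> exp (- (4 * L))" .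
    have 3: "?P ?U \<le> 5 / 9" if u: "norm u = 1"
    proof -
      define w where "w j = u \<bullet> v j" for j
      \<comment> \<open>The interval of admissible errors has its centre at
        \<open>\<epsilon> / 2\<close>. The second moment about it is at most
        \<open>5/4 * \<epsilon>^2\<close> and the half-length is \<open>3/2 * \<epsilon>\<close>,
        hence 5/9.\<close>
      define c where "c = u \<bullet> \<mu> + \<epsilon> / 2"
      have w\<mu>: "u \<bullet> \<mu> = (\<Sum>j=1..n. w j) / real n" by (simp add: \<mu> w_def inner_sum_right)
      have "(\<Sum>j=1..n. (w j)\<^sup>2) / real n \<le> (\<Sum>j=1..n. (norm (v j))\<^sup>2) / real n"
      proof (intro divide_right_mono sum_mono)
        fix j
        have "\<bar>w j\<bar> \<le> norm (v j)" using Cauchy_Schwarz_ineq2[of u "v j"] u by (simp add: w_def)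
        thus "(w j)\<^sup>2 \<le> (norm (v j))\<^sup>2" using abs_le_square_iff[of "w j" "norm (v j)"] by simp
      qed simp
      hence wG: "(\<Sum>j=1..n. (w j)\<^sup>2) / real n - (u \<bullet> \<mu>)\<^sup>2 \<le> G\<^sup>2"
        using avg zero_le_power2[of "u \<bullet> \<mu>"] by linarith
      have "1 / (1 + t)\<^sup>2 \<le> 1" using t0 by simp
      hence "\<epsilon>\<^sup>2 * (1 / (1 + t)\<^sup>2) \<le> \<epsilon>\<^sup>2 * 1" by (intro mult_left_mono) auto
      hence "G\<^sup>2 / real s \<le> \<epsilon>\<^sup>2" using Gs by simp
      moreover have "((\<Sum>j=1..n. (w j)\<^sup>2) / real n - (u \<bullet> \<mu>)\<^sup>2) / real s \<le> G\<^sup>2 / real s"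
        using wG by (intro divide_right_mono) auto
      moreover have cc: "(u \<bullet> \<mu> - c)\<^sup>2 = \<epsilon>\<^sup>2 / 4" by (simp add: c_def power_divide)
      ultimately have E: "measure_pmf.expectation ?p (\<lambda>S. ((\<Sum>j\<leftarrow>S. w j) / real s - c)\<^sup>2) \<le> 5 / 4 * \<epsilon>\<^sup>2"
        unfolding expectation_sample_mean_sq[OF n s1 w\<mu>] cc by linarith
      have "?P ?U
        \<le> measure_pmf.expectation ?p (\<lambda>S. ((\<Sum>j\<leftarrow>S. w j) / real s - c)\<^sup>2) / (3 / 2 * \<epsilon>)\<^sup>2"
      proof (rule prob_draw_le_expectation[OF n])
        fix S assume S: "S \<in> samples With_Replacement n s"
          "S \<in> {S. \<not> (- \<epsilon> < u \<bullet> (sample_mean v S - \<mu>) \<and> u \<bullet> (sample_mean v S - \<mu>) \<le> 2 * \<epsilon>)}"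
        have "(\<Sum>j\<leftarrow>S. w j) = u \<bullet> (\<Sum>j\<leftarrow>S. v j)" by (induction S) (auto simp: w_def inner_add_right)
        hence "(\<Sum>j\<leftarrow>S. w j) / real s = u \<bullet> sample_mean v S" using S by (simp add: sample_mean_def)
        hence "(\<Sum>j\<leftarrow>S. w j) / real s - c = u \<bullet> (sample_mean v S - \<mu>) - \<epsilon> / 2"
          by (simp add: c_def inner_diff_right)
        hence "\<bar>3 / 2 * \<epsilon>\<bar> \<le> \<bar>(\<Sum>j\<leftarrow>S. w j) / real s - c\<bar>" using S(2) \<epsilon> by auto
        thus "(3 / 2 * \<epsilon>)\<^sup>2 \<le> ((\<Sum>j\<leftarrow>S. w j) / real s - c)\<^sup>2" by (simp only: abs_le_square_iff)
      qed (use \<epsilon> in auto)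
      also have "\<dots> \<le> (5 / 4 * \<epsilon>\<^sup>2) / (3 / 2 * \<epsilon>)\<^sup>2" using E by (intro divide_right_mono) auto
      also have "\<dots> = 5 / 9" using \<epsilon> by (simp add: power_mult_distrib power2_eq_square)
      finally show ?thesis .
    qed
    show ?thesis
      using 1 2 3 by blast
  qed
  thus "?P ?D \<le> 1 / (1 + t)\<^sup>2" "?P ?D \<le> exp (- (4 * L))" "norm u = 1 \<Longrightarrow> ?P ?U \<le> 5 / 9" by blast+
qed

lemma hessian_sample_bound:
  fixes A :: "nat \<Rightarrow> real^'d^'d"
  assumes n: "n \<ge> 1" "s \<ge> 1" "m = Without_Replacement \<Longrightarrow> s \<le> n"
    and A: "\<And>j. j \<in> {1..n} \<Longrightarrow> pos_semidef (A j) \<and> pos_semidef (M *\<^sub>R mat 1 - A j)"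
    and \<gamma>: "pos_semidef ((1 / real n) *\<^sub>R (\<Sum>j=1..n. A j) - \<gamma> *\<^sub>R mat 1)" "0 < \<gamma>" "\<gamma> \<le> M"
    and \<epsilon>: "0 < \<epsilon>" "\<epsilon> \<le> 1 / 2" and h: "2 * l / \<epsilon>\<^sup>2 \<le> real s * \<gamma> / M"
  shows "draw_prob m n s
      {S. \<exists>v. norm v = 1 \<and> v \<bullet> (((1 / real s) *\<^sub>R (\<Sum>j\<leftarrow>S. A j)) *v v) \<le> (3 / 4 - \<epsilon> / 2) * \<gamma>}
    \<le> real CARD('d) * exp (- (23 / 20 * l))"
proof -
  have M: "0 < M" using \<gamma> by simp
  define Y where "Y j = (1 / M) *\<^sub>R A j" for j
  define \<nu> where "\<nu> = \<gamma> / M"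
  have Y: "pos_semidef (Y j) \<and> pos_semidef (mat 1 - Y j)" if "j \<in> {1..n}" for j
  proof -
    have "mat 1 - Y j = (1 / M) *\<^sub>R (M *\<^sub>R mat 1 - A j)" using M by (simp add: Y_def scaleR_diff_right)
    thus ?thesis using A[OF that] M by (simp add: Y_def pos_semidef_scaleR)
  qed
  have "(1 / real n) *\<^sub>R (\<Sum>j=1..n. Y j) - \<nu> *\<^sub>R mat 1
      = (1 / M) *\<^sub>R ((1 / real n) *\<^sub>R (\<Sum>j=1..n. A j) - \<gamma> *\<^sub>R mat 1)"
    by (simp add: Y_def \<nu>_def scaleR_diff_right scaleR_sum_right[symmetric] mult.commute)
  hence \<nu>: "pos_semidef ((1 / real n) *\<^sub>R (\<Sum>j=1..n. Y j) - \<nu> *\<^sub>R mat 1)" "0 \<le> \<nu>" "\<nu> \<le> 1"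
    using \<gamma> M by (simp_all add: pos_semidef_scaleR \<nu>_def)
  have "(v \<bullet> (((1 / real s) *\<^sub>R (\<Sum>j\<leftarrow>S. A j)) *v v) \<le> (3 / 4 - \<epsilon> / 2) * \<gamma>)
      \<longleftrightarrow> (v \<bullet> ((\<Sum>j\<leftarrow>S. Y j) *v v) \<le> (3 / 4 - \<epsilon> / 2) * (\<nu> * real s))" for v S
  proof -
    have e: "(\<Sum>j\<leftarrow>S. Y j) = (1 / M) *\<^sub>R (\<Sum>j\<leftarrow>S. A j)" by (induction S) (auto simp: Y_def scaleR_add_right)
    define X where "X = v \<bullet> ((\<Sum>j\<leftarrow>S. A j) *v v)"
    have e1: "v \<bullet> ((\<Sum>j\<leftarrow>S. Y j) *v v) = X / M"
      unfolding e X_def by (simp add: scaleR_matrix_vector_assoc[symmetric])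
    have e2: "v \<bullet> (((1 / real s) *\<^sub>R (\<Sum>j\<leftarrow>S. A j)) *v v) = X / real s"
      unfolding X_def by (simp add: scaleR_matrix_vector_assoc[symmetric])
    define r where "r = 3 / 4 - \<epsilon> / 2"
    show ?thesis unfolding r_def[symmetric] e1 e2 using M n by (simp add: \<nu>_def field_simps)
  qed
  hence "{S. \<exists>v. norm v = 1 \<and> v \<bullet> (((1 / real s) *\<^sub>R (\<Sum>j\<leftarrow>S. A j)) *v v) \<le> (3 / 4 - \<epsilon> / 2) * \<gamma>}
      = {S. \<exists>v. norm v = 1 \<and> v \<bullet> ((\<Sum>j\<leftarrow>S. Y j) *v v) \<le> (3 / 4 - \<epsilon> / 2) * (\<nu> * real s)}" by simp
  moreover have "draw_prob m n s {S. \<exists>v. norm v = 1 \<and> v \<bullet> ((\<Sum>j\<leftarrow>S. Y j) *v v) \<le> (3 / 4 - \<epsilon> / 2) * (\<nu> * real s)}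
      \<le> real CARD('d) * exp (ln (5 / 3) * ((3 / 4 - \<epsilon> / 2) * (\<nu> * real s)) - (1 - exp (- ln (5 / 3))) * \<nu> * real s)"
    by (rule matrix_chernoff[OF n(1,3) Y \<nu>]) auto
  moreover have "ln (5 / 3) * ((3 / 4 - \<epsilon> / 2) * (\<nu> * real s)) - (1 - exp (- ln (5 / 3))) * (\<nu> * real s) \<le> - (23 / 20 * l)"
    using h \<gamma>(2) M by (intro chernoff_exponent \<epsilon>) (simp_all add: \<nu>_def mult.commute)
  ultimately show ?thesis
    by (smt (verit) exp_le_cancel_iff mult.assoc mult_left_mono of_nat_0_le_iff)
qed

text \<open>\<open>trace\<close> serves as the single entry: it is linear in the matrix and needs no
  choice of an index.\<close>

lemma one_dimensional:
  assumes "CARD('d) = 1"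
  shows "(M :: real^'d^'d) *v v = trace M *\<^sub>R v"
    and "(u :: real^'d) \<noteq> 0 \<Longrightarrow> \<exists>c. w = c *\<^sub>R u"
    and "trace (mat 1 :: real^'d^'d) = 1"
proof -
  obtain i :: 'd where i: "UNIV = {i}" using assms by (rule card_1_singletonE)
  hence all: "j = i" for j :: 'd by auto
  show "M *v v = trace M *\<^sub>R v"
    unfolding vec_eq_iff
  proof
    fix k show "(M *v v) $ k = (trace M *\<^sub>R v) $ k"
      unfolding all[of k] by (simp add: matrix_vector_mult_def trace_def i)
  qed
  show "trace (mat 1 :: real^'d^'d) = 1" using assms by (simp add: trace_I)
  assume "u \<noteq> 0"
  hence "u $ i \<noteq> 0" using all by (metis vec_eq_iff zero_index)
  hence "w $ k = ((w $ i / u $ i) *\<^sub>R u) $ k" for k unfolding all[of k] by simp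
  hence "w = (w $ i / u $ i) *\<^sub>R u" unfolding vec_eq_iff by blast
  thus "\<exists>c. w = c *\<^sub>R u" by blast
qed

text \<open>As \<open>4 \<le> \<sigma>\<close>, the error is at most a quarter of
  \<open>norm g\<close> unless the iteration stops, hence 5/4. The factor 1 in the last claim is the
  \<open>w\<close> of \<open>scalar_newton_direction\<close>.\<close>

lemma gradient_close:
  fixes g d :: "'b::real_inner"
  assumes "norm (g - d) \<le> \<epsilon>" "4 \<le> \<sigma>" "0 < \<epsilon>"
  shows "norm g < \<sigma> * \<epsilon> \<Longrightarrow> norm d < (1 + \<sigma>) * \<epsilon>"
    and "\<sigma> * \<epsilon> \<le> norm g \<Longrightarrow> norm d \<le> 5 / 4 * norm g"
    and "g \<bullet> (g - d) \<le> 1 * \<epsilon> * norm g"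
proof -
  have dg: "norm d \<le> norm g + \<epsilon>"
    using norm_triangle_ineq2[of d g] assms(1) by (simp add: norm_minus_commute)
  show "norm g < \<sigma> * \<epsilon> \<Longrightarrow> norm d < (1 + \<sigma>) * \<epsilon>" using dg by (simp add: distrib_right)
  show "\<sigma> * \<epsilon> \<le> norm g \<Longrightarrow> norm d \<le> 5 / 4 * norm g"
  proof -
    assume "\<sigma> * \<epsilon> \<le> norm g"
    moreover have "4 * \<epsilon> \<le> \<sigma> * \<epsilon>" using assms(2,3) by (intro mult_right_mono) auto
    ultimately show ?thesis using dg by linarith
  qed
  have "g \<bullet> (g - d) \<le> norm g * norm (g - d)" by (rule norm_cauchy_schwarz)
  also have "\<dots> \<le> norm g * \<epsilon>" using assms by (intro mult_left_mono) auto
  finally show "g \<bullet> (g - d) \<le> 1 * \<epsilon> * norm g" by (simp add: mult.commute)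
qed

text \<open>In dimension one, an overestimated gradient is less harmful than an underestimated one.\<close>

lemma gradient_close_one_sided:
  fixes g d u :: "'b::real_inner"
  assumes g: "g = (u \<bullet> g) *\<^sub>R u" and d: "d = norm d *\<^sub>R u" and u: "norm u = 1"
    and z: "- \<epsilon> < u \<bullet> (g - d)" "u \<bullet> (g - d) \<le> 2 * \<epsilon>" and \<sigma>: "4 \<le> \<sigma>" "0 < \<epsilon>"
  shows "norm g < \<sigma> * \<epsilon> \<Longrightarrow> norm d < (1 + \<sigma>) * \<epsilon>"
    and "\<sigma> * \<epsilon> \<le> norm g \<Longrightarrow> norm d \<le> 5 / 4 * norm g"
    and "\<sigma> * \<epsilon> \<le> norm g \<Longrightarrow> g \<bullet> (g - d) \<le> 2 * \<epsilon> * norm g"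
proof -
  define y where "y = u \<bullet> g"
  have uu: "u \<bullet> u = 1" using u by (simp add: dot_square_norm)
  have ud: "u \<bullet> d = norm d" using arg_cong[OF d, of "\<lambda>z. u \<bullet> z"] uu by simp
  have ng: "norm g = \<bar>y\<bar>" using arg_cong[OF g, of norm] u by (simp add: y_def)
  have dy: "norm d < y + \<epsilon>" using z(1) ud by (simp add: inner_diff_right y_def)
  hence dg: "norm d < norm g + \<epsilon>" using ng by simp
  show "norm g < \<sigma> * \<epsilon> \<Longrightarrow> norm d < (1 + \<sigma>) * \<epsilon>" using dg by (simp add: distrib_right)
  have \<sigma>\<epsilon>: "4 * \<epsilon> \<le> \<sigma> * \<epsilon>" using \<sigma> by (intro mult_right_mono) auto
  show "\<sigma> * \<epsilon> \<le> norm g \<Longrightarrow> norm d \<le> 5 / 4 * norm g" using dg \<sigma>\<epsilon> by simp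
  assume big: "\<sigma> * \<epsilon> \<le> norm g"
  have "- \<epsilon> < y" using dy norm_ge_zero[of d] by linarith
  \<comment> \<open>This settles the sign of \<open>y\<close>: its absolute value is at least
    \<open>4 * \<epsilon>\<close>, but \<open>y\<close> exceeds \<open>- \<epsilon>\<close>.\<close>
  hence y: "y = norm g" using big \<sigma>\<epsilon> \<sigma>(2) ng by linarith
  have "g \<bullet> (g - d) = y * (u \<bullet> (g - d))" by (subst (1) g) (simp add: y_def)
  also have "\<dots> \<le> y * (2 * \<epsilon>)" using z(2) y by (intro mult_left_mono) auto
  finally show "g \<bullet> (g - d) \<le> 2 * \<epsilon> * norm g" using y by (simp add: mult.commute)
qed

lemma sample_mean_psd_bounds:
  fixes A :: "nat \<Rightarrow> real^'d^'d"
  assumes S: "length S = s" "s \<ge> 1"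
    and A: "\<And>j. j \<in> set S \<Longrightarrow> pos_semidef (A j) \<and> pos_semidef (Ks j *\<^sub>R mat 1 - A j)"
    and K: "(\<Sum>j\<leftarrow>S. Ks j) \<le> real s * M"
  shows "pos_semidef (sample_mean A S)" "pos_semidef (M *\<^sub>R mat 1 - sample_mean A S)"
proof -
  have H: "sample_mean A S = (1 / real s) *\<^sub>R (\<Sum>j\<leftarrow>S. A j)" using S by (simp add: sample_mean_def)
  show "pos_semidef (sample_mean A S)"
    unfolding H using A by (intro pos_semidef_scaleR pos_semidef_sum_list) auto
  have "(\<Sum>j\<leftarrow>S. Ks j *\<^sub>R mat 1 - A j) = (\<Sum>j\<leftarrow>S. Ks j) *\<^sub>R mat 1 - (\<Sum>j\<leftarrow>S. A j)"
    by (induction S) (auto simp: scaleR_add_left)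
  hence "M *\<^sub>R mat 1 - sample_mean A S
      = (1 / real s) *\<^sub>R (\<Sum>j\<leftarrow>S. Ks j *\<^sub>R mat 1 - A j) + (M - (\<Sum>j\<leftarrow>S. Ks j) / real s) *\<^sub>R mat 1"
    unfolding H by (simp add: scaleR_diff_right scaleR_diff_left)
  also have "pos_semidef \<dots>"
    using A K S by (intro pos_semidef_add pos_semidef_scaleR pos_semidef_sum_list pos_semidef_mat_1)
                   (auto simp: field_simps)
  finally show "pos_semidef (M *\<^sub>R mat 1 - sample_mean A S)" .
qed

text \<open>The reason for the two meanings of \<kappa>t: repeated draws may all hit the largest
  value, distinct ones at worst the \<open>s\<close> largest.\<close>

lemma sample_sum_le:
  assumes "\<And>j. j \<in> {1..n} \<Longrightarrow> 0 < Ks j" and "S \<in> samples m n s" "s \<ge> 1"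
  shows "(\<Sum>j\<leftarrow>S. Ks j) \<le> real s * (case m of With_Replacement \<Rightarrow> avg_largest Ks n 1 | Without_Replacement \<Rightarrow> avg_largest Ks n s)"
proof (cases m)
  case With_Replacement
  have "set S \<subseteq> {1..n}" "length S = s" using assms With_Replacement by auto
  moreover have "set S \<subseteq> {1..n} \<Longrightarrow> (\<Sum>j\<leftarrow>S. Ks j) \<le> real (length S) * avg_largest Ks n 1"
  proof (induction S)
    case (Cons j S)
    thus ?case using le_avg_largest_1[of j n Ks] by (simp add: distrib_right)
  qed simp
  ultimately show ?thesis using With_Replacement by simp
next
  case Without_Replacement
  have S: "set S \<subseteq> {1..n}" "length S = s" "distinct S" using assms Without_Replacement by auto
  hence "(\<Sum>j\<leftarrow>S. Ks j) = (\<Sum>j\<in>set S. Ks j)" by (simp add: sum_list_distinct_conv_sum_set)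
  also have "\<dots> \<le> real s * avg_largest Ks n s"
    using S assms by (intro sum_le_avg_largest) (auto simp: distinct_card)
  finally show ?thesis using Without_Replacement by simp
qed

theorem theorem8:
  fixes f :: "nat \<Rightarrow> real ^ 'd \<Rightarrow> real" and F :: "real ^ 'd \<Rightarrow> real"
    and n s\<^sub>H s\<^sub>g :: nat and m :: sampling
    and Ks :: "nat \<Rightarrow> real" and K \<gamma> \<kappa> \<kappa>t :: real and \<kappa>q :: "nat \<Rightarrow> real"
    and x xstar :: "real ^ 'd"
    and \<theta>\<^sub>1 \<theta>\<^sub>2 \<delta> \<epsilon>\<^sub>1 \<epsilon>\<^sub>2 \<beta> \<alpha>max \<sigma> G :: real
  assumes n: "n \<ge> 1"
    and f: "\<And>i. i \<in> {1..n} \<Longrightarrow> twice_differentiable (f i)"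
    and F: "F = (\<lambda>y. (1 / real n) * (\<Sum>i=1..n. f i y))"
    and Ks_pos: "\<And>i. i \<in> {1..n} \<Longrightarrow> 0 < Ks i"
    and hess_f: "\<And>i y. i \<in> {1..n} \<Longrightarrow>
           0 \<preceq> hessian (f i) y \<and> hessian (f i) y \<preceq> Ks i *\<^sub>R mat 1"
    and \<gamma>: "0 < \<gamma>" "\<gamma> \<le> K"
    and hess_F: "\<And>y. \<gamma> *\<^sub>R mat 1 \<preceq> hessian F y \<and> hessian F y \<preceq> K *\<^sub>R mat 1"
    and xstar: "is_arg_min F (\<lambda>_. True) xstar"
    and \<kappa>: "\<kappa> = K / \<gamma>"
    and \<kappa>q: "\<kappa>q = (\<lambda>q. avg_largest Ks n q / \<gamma>)"
    and \<kappa>t: "\<kappa>t = (case m of With_Replacement \<Rightarrow> \<kappa>q 1 | Without_Replacement \<Rightarrow> \<kappa>q s\<^sub>H)"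
    and \<theta>\<^sub>1: "0 < \<theta>\<^sub>1" "\<theta>\<^sub>1 < 1"
    and \<theta>\<^sub>2: "0 < \<theta>\<^sub>2" "\<theta>\<^sub>2 < 1"
    and \<delta>: "0 < \<delta>" "\<delta> < 1"
    and \<epsilon>\<^sub>1: "0 < \<epsilon>\<^sub>1" "\<epsilon>\<^sub>1 \<le> 1 / 2"
    and \<epsilon>\<^sub>2: "0 < \<epsilon>\<^sub>2" "\<epsilon>\<^sub>2 < 1"
    and \<beta>: "0 < \<beta>" "\<beta> < 1"
    and \<alpha>max: "\<alpha>max \<ge> 1"
    and \<sigma>: "\<sigma> \<ge> 4 * \<kappa>t / ((1 - \<theta>\<^sub>1) * (1 - \<theta>\<^sub>2) * (1 - \<beta>))"
    and s\<^sub>H: "real s\<^sub>H \<ge> 2 * \<kappa>q 1 * ln (real CARD('d) / \<delta>) / \<epsilon>\<^sub>1\<^sup>2"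
    and s\<^sub>H_le: "m = Without_Replacement \<Longrightarrow> s\<^sub>H \<le> n"
    and G: "\<And>i. i \<in> {1..n} \<Longrightarrow> norm (grad (f i) x) \<le> G"
    and s\<^sub>g: "real s\<^sub>g \<ge> G\<^sup>2 / \<epsilon>\<^sub>2\<^sup>2 * (1 + sqrt (8 * ln (1 / \<delta>)))\<^sup>2"
  shows "measure_pmf.prob (pair_pmf (draw m n s\<^sub>H) (draw With_Replacement n s\<^sub>g))
           {(S\<^sub>H, S\<^sub>g).
              let H = sample_mean (\<lambda>j. hessian (f j) x) S\<^sub>H;
                  g = sample_mean (\<lambda>j. grad (f j) x) S\<^sub>g
              in (norm g < \<sigma> * \<epsilon>\<^sub>2 \<longrightarrow> norm (grad F x) < (1 + \<sigma>) * \<epsilon>\<^sub>2) \<and>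
                 (\<not> norm g < \<sigma> * \<epsilon>\<^sub>2 \<longrightarrow>
                    (\<forall>p \<alpha> \<rho>. inexact_direction H g \<theta>\<^sub>1 \<theta>\<^sub>2 p \<longrightarrow>
                       largest_step F x g p \<beta> \<alpha>max \<alpha> \<longrightarrow>
                       \<rho> = (if \<theta>\<^sub>1 \<le> sqrt ((1 - \<epsilon>\<^sub>1) / (4 * \<kappa>t))
                            then 4 * \<alpha> * \<beta> / (9 * \<kappa>t)
                            else 8 * \<alpha> * \<beta> * (1 - \<theta>\<^sub>2) * (1 - \<theta>\<^sub>1)\<^sup>2 * (1 - \<epsilon>\<^sub>1) / (9 * \<kappa>t\<^sup>2)) \<longrightarrow>
                       F (x + \<alpha> *\<^sub>R p) - F xstar \<le> (1 - \<rho>) * (F x - F xstar) \<and>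
                       \<alpha> \<ge> (1 - \<theta>\<^sub>2) * (1 - \<beta>) * (1 - \<epsilon>\<^sub>1) / \<kappa>))}
         \<ge> 1 - \<delta>"
proof -
  define d where "d = grad F x"
  define A where "A j = hessian (f j) x" for j
  define K1 where "K1 = avg_largest Ks n 1"
  define \<Lambda> where "\<Lambda> = (case m of With_Replacement \<Rightarrow> avg_largest Ks n 1 | Without_Replacement \<Rightarrow> avg_largest Ks n s\<^sub>H)"
  define L where "L = ln (1 / \<delta>)"
  define t where "t = sqrt (8 * L)"
  define l where "l = ln (real CARD('d)) + L"
  have L0: "0 < L" using \<delta> by (simp add: L_def)
  have \<delta>L: "\<delta> = exp (- L)" using \<delta> by (simp add: L_def ln_div)
  have card: "1 \<le> real CARD('d)" using zero_less_card_finite[where 'a = 'd] by linarith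
  have l0: "0 < l" using L0 card by (simp add: l_def add_nonneg_pos)
  have l: "ln (real CARD('d) / \<delta>) = l" using \<delta> card by (simp add: l_def L_def ln_div)

  note F_avg = average_derivatives[OF f F]
  have upper: "F (x + p) \<le> F x + p \<bullet> d + K / 2 * (norm p)\<^sup>2" for p
    unfolding d_def using F_avg(3) hess_F by (intro quadratic_upper_bound) auto
  have gap: "F x - F xstar \<le> (norm d)\<^sup>2 / (2 * \<gamma>)"
    unfolding d_def using F_avg(3) hess_F \<gamma> by (intro gap_le_grad_norm) auto
  have A: "pos_semidef (A j) \<and> pos_semidef (Ks j *\<^sub>R mat 1 - A j)" if "j \<in> {1..n}" for j
    using hess_f[OF that, of x] by (simp add: A_def loewner_le_def)
  have mean: "pos_semidef ((1 / real n) *\<^sub>R (\<Sum>j=1..n. A j) - \<gamma> *\<^sub>R mat 1)"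
    using hess_F[of x] F_avg(2)[of x] by (simp add: A_def loewner_le_def)

  \<comment> \<open>The mean Hessian lies between \<gamma> and the mean of \<open>Ks\<close> times
    the identity; comparing traces gives the scalar inequality behind
    \<open>\<kappa>t \<ge> 1\<close>.\<close>
  have \<gamma>_mean: "\<gamma> \<le> (\<Sum>j=1..n. Ks j) / real n"
  proof -
    have "pos_semidef ((1 / real n) *\<^sub>R (\<Sum>j=1..n. Ks j *\<^sub>R mat 1 - A j) + ((1 / real n) *\<^sub>R (\<Sum>j=1..n. A j) - \<gamma> *\<^sub>R mat 1))"
      using A mean by (intro pos_semidef_add pos_semidef_scaleR pos_semidef_sum) auto
    also have "(1 / real n) *\<^sub>R (\<Sum>j=1..n. Ks j *\<^sub>R mat 1 - A j) + ((1 / real n) *\<^sub>R (\<Sum>j=1..n. A j) - \<gamma> *\<^sub>R mat 1)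
        = ((\<Sum>j=1..n. Ks j) / real n - \<gamma>) *\<^sub>R mat 1"
      by (simp add: sum_subtractf scaleR_diff_right scaleR_diff_left flip: scaleR_sum_left)
    finally have "0 \<le> trace (((\<Sum>j=1..n. Ks j) / real n - \<gamma>) *\<^sub>R mat 1 :: real^'d^'d)"
      by (rule pos_semidef_trace_nonneg)
    thus ?thesis using card by (simp add: trace_scaleR trace_I zero_le_mult_iff)
  qed
  have \<gamma>K1: "\<gamma> \<le> K1"
    using \<gamma>_mean avg_largest_ge_mean[of 1 n Ks] n by (simp add: K1_def)
  have K1: "0 < K1" using \<gamma>K1 \<gamma> by simp
  have A1: "pos_semidef (A j) \<and> pos_semidef (K1 *\<^sub>R mat 1 - A j)" if "j \<in> {1..n}" for j
  proof -
    have "K1 *\<^sub>R mat 1 - A j = (Ks j *\<^sub>R mat 1 - A j) + (K1 - Ks j) *\<^sub>R mat 1" by (simp add: scaleR_diff_left)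
    also have "pos_semidef \<dots>"
      using A[OF that] le_avg_largest_1[OF that, of Ks]
      by (intro pos_semidef_add pos_semidef_scaleR pos_semidef_mat_1) (auto simp: K1_def)
    finally show ?thesis using A[OF that] by blast
  qed

  have sH: "2 * (K1 / \<gamma>) * l / \<epsilon>\<^sub>1\<^sup>2 \<le> real s\<^sub>H" using s\<^sub>H by (simp add: \<kappa>q K1_def l)
  moreover have "0 < 2 * (K1 / \<gamma>) * l / \<epsilon>\<^sub>1\<^sup>2" using K1 \<gamma> l0 \<epsilon>\<^sub>1 by simp
  \<comment> \<open>The prescribed size is strictly positive, so the Hessian sample is not empty and
    dividing by its size is meaningful.\<close>
  ultimately have s1: "1 \<le> s\<^sub>H" by (cases s\<^sub>H) auto
  have h: "2 * l / \<epsilon>\<^sub>1\<^sup>2 \<le> real s\<^sub>H * \<gamma> / K1"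
    using sH K1 \<gamma> \<epsilon>\<^sub>1 by (simp add: field_simps)
  have \<Lambda>: "\<Lambda> = \<kappa>t * \<gamma>" using \<gamma> by (simp add: \<Lambda>_def \<kappa>t \<kappa>q split: sampling.split)
  have \<gamma>\<Lambda>: "\<gamma> \<le> \<Lambda>" and K1\<Lambda>: "K1 \<le> real s\<^sub>H * \<Lambda>"
  proof -
    show "\<gamma> \<le> \<Lambda>"
      using \<gamma>K1 \<gamma>_mean avg_largest_ge_mean[OF s1, of n Ks] s\<^sub>H_le by (cases m) (auto simp: \<Lambda>_def K1_def)
    show "K1 \<le> real s\<^sub>H * \<Lambda>"
      using avg_largest_1_le[of n Ks, OF Ks_pos s1] s\<^sub>H_le K1 s1
      by (cases m) (auto simp: \<Lambda>_def K1_def mult_le_cancel_right1)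
  qed
  have \<kappa>t1: "1 \<le> \<kappa>t" using \<gamma>\<Lambda> \<gamma> unfolding \<Lambda> by simp
  have \<sigma>4: "4 \<le> \<sigma>"
  proof -
    have "(1 - \<theta>\<^sub>1) * (1 - \<theta>\<^sub>2) * (1 - \<beta>) \<le> 1 * 1 * 1" using \<theta>\<^sub>1 \<theta>\<^sub>2 \<beta> by (intro mult_mono) auto
    moreover have "0 < (1 - \<theta>\<^sub>1) * (1 - \<theta>\<^sub>2) * (1 - \<beta>)" using \<theta>\<^sub>1 \<theta>\<^sub>2 \<beta> by simp
    ultimately have "4 * \<kappa>t / 1 \<le> 4 * \<kappa>t / ((1 - \<theta>\<^sub>1) * (1 - \<theta>\<^sub>2) * (1 - \<beta>))"
      using \<kappa>t1 by (intro divide_left_mono) auto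
    thus ?thesis using \<sigma> \<kappa>t1 by linarith
  qed
  have H: "pos_semidef (sample_mean A S)" "pos_semidef ((\<kappa>t * \<gamma>) *\<^sub>R mat 1 - sample_mean A S)"
    "sample_mean A S = (1 / real s\<^sub>H) *\<^sub>R (\<Sum>j\<leftarrow>S. A j)" if S: "S \<in> samples m n s\<^sub>H" for S
  proof -
    have len: "length S = s\<^sub>H" "set S \<subseteq> {1..n}" using S by (cases m; simp)+
    show "sample_mean A S = (1 / real s\<^sub>H) *\<^sub>R (\<Sum>j\<leftarrow>S. A j)" using len by (simp add: sample_mean_def)
    have AS: "pos_semidef (A j) \<and> pos_semidef (Ks j *\<^sub>R mat 1 - A j)" if "j \<in> set S" for j
      using A that len(2) by blast
    have "(\<Sum>j\<leftarrow>S. Ks j) \<le> real s\<^sub>H * (\<kappa>t * \<gamma>)"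
      using sample_sum_le[of n Ks, OF Ks_pos S s1] unfolding \<Lambda>_def[symmetric] \<Lambda> .
    thus "pos_semidef (sample_mean A S)" "pos_semidef ((\<kappa>t * \<gamma>) *\<^sub>R mat 1 - sample_mean A S)"
      using sample_mean_psd_bounds[of S s\<^sub>H A Ks "\<kappa>t * \<gamma>", OF len(1) s1 AS] by simp_all
  qed

  define v where "v j = grad (f j) x" for j
  have d: "d = (1 / real n) *\<^sub>R (\<Sum>j=1..n. v j)" unfolding d_def v_def by (rule F_avg(1))
  have vG: "norm (v j) \<le> G" if "j \<in> {1..n}" for j using G[OF that] by (simp add: v_def)
  have sg: "G\<^sup>2 / \<epsilon>\<^sub>2\<^sup>2 * (1 + t)\<^sup>2 \<le> real s\<^sub>g" using s\<^sub>g by (simp add: t_def L_def)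
  define Bg where "Bg = {S. \<epsilon>\<^sub>2 < norm (sample_mean v S - d)}"
  have bad_g: "iid_prob n s\<^sub>g Bg \<le> 1 / (1 + t)\<^sup>2"
    "iid_prob n s\<^sub>g Bg \<le> exp (- (4 * L))"
    unfolding Bg_def by (rule gradient_sample_bounds[OF n d vG \<epsilon>\<^sub>2(1) L0 t_def sg]; assumption)+
  define E where "E = {(S\<^sub>H, S\<^sub>g).
              let H = sample_mean (\<lambda>j. hessian (f j) x) S\<^sub>H;
                  g = sample_mean (\<lambda>j. grad (f j) x) S\<^sub>g
              in (norm g < \<sigma> * \<epsilon>\<^sub>2 \<longrightarrow> norm (grad F x) < (1 + \<sigma>) * \<epsilon>\<^sub>2) \<and>
                 (\<not> norm g < \<sigma> * \<epsilon>\<^sub>2 \<longrightarrow>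
                    (\<forall>p \<alpha> \<rho>. inexact_direction H g \<theta>\<^sub>1 \<theta>\<^sub>2 p \<longrightarrow>
                       largest_step F x g p \<beta> \<alpha>max \<alpha> \<longrightarrow>
                       \<rho> = (if \<theta>\<^sub>1 \<le> sqrt ((1 - \<epsilon>\<^sub>1) / (4 * \<kappa>t))
                            then 4 * \<alpha> * \<beta> / (9 * \<kappa>t)
                            else 8 * \<alpha> * \<beta> * (1 - \<theta>\<^sub>2) * (1 - \<theta>\<^sub>1)\<^sup>2 * (1 - \<epsilon>\<^sub>1) / (9 * \<kappa>t\<^sup>2)) \<longrightarrow>
                       F (x + \<alpha> *\<^sub>R p) - F xstar \<le> (1 - \<rho>) * (F x - F xstar) \<and>
                       \<alpha> \<ge> (1 - \<theta>\<^sub>2) * (1 - \<beta>) * (1 - \<epsilon>\<^sub>1) / \<kappa>))}"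
  let ?P = "measure_pmf.prob (pair_pmf (draw m n s\<^sub>H) (draw With_Replacement n s\<^sub>g)) E"
  have E_I: "(S, T) \<in> E"
    if "norm (sample_mean v T) < \<sigma> * \<epsilon>\<^sub>2 \<Longrightarrow> norm d < (1 + \<sigma>) * \<epsilon>\<^sub>2"
      "\<sigma> * \<epsilon>\<^sub>2 \<le> norm (sample_mean v T) \<Longrightarrow> norm d \<le> 5 / 4 * norm (sample_mean v T)"
      "\<And>p. \<sigma> * \<epsilon>\<^sub>2 \<le> norm (sample_mean v T) \<Longrightarrow> inexact_direction (sample_mean A S) (sample_mean v T) \<theta>\<^sub>1 \<theta>\<^sub>2 p \<Longrightarrow>
        good_direction \<gamma> \<kappa>t \<theta>\<^sub>1 \<theta>\<^sub>2 \<epsilon>\<^sub>1 \<beta> d (sample_mean v T) p"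
    for S T
    unfolding E_def mem_Collect_eq prod.case Let_def v_def[symmetric, abs_def] A_def[symmetric, abs_def] d_def[symmetric]
    by (rule iteration_holds[OF upper gap \<gamma> \<kappa> \<kappa>t1 \<theta>\<^sub>1 \<theta>\<^sub>2 \<epsilon>\<^sub>1 \<beta> \<alpha>max that])
  have supp: "S \<in> samples m n s\<^sub>H" if "S \<in> set_pmf (draw m n s\<^sub>H)" for S
    using that n s\<^sub>H_le by (simp add: draw_def set_pmf_of_set samples_nonempty finite_samples)

  define Bd where "Bd = {S. \<exists>v. norm v = 1 \<and> v \<bullet> (((1 / real s\<^sub>H) *\<^sub>R (\<Sum>j\<leftarrow>S. A j)) *v v) \<le> (3 / 4 - \<epsilon>\<^sub>1 / 2) * \<gamma>}"
  have general: "(1 - draw_prob m n s\<^sub>H Bd) * (1 - iid_prob n s\<^sub>g Bg)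
      \<le> ?P"
  proof (rule pair_prob_ge)
    fix S T assume S: "S \<in> set_pmf (draw m n s\<^sub>H)" "S \<notin> Bd" and T: "T \<notin> Bg"
    note HS = H[OF supp[OF S(1)]]
    have lower: "(3 / 4 - \<epsilon>\<^sub>1 / 2) * \<gamma> * (norm v)\<^sup>2 \<le> v \<bullet> (sample_mean A S *v v)" for v
    proof (cases "v = 0")
      case False
      define w where "w = (1 / norm v) *\<^sub>R v"
      have w: "norm w = 1" "v = norm v *\<^sub>R w" using False by (simp_all add: w_def)
      have "(3 / 4 - \<epsilon>\<^sub>1 / 2) * \<gamma> \<le> w \<bullet> (sample_mean A S *v w)"
        using S(2) w(1) unfolding Bd_def HS(3) by (auto simp: not_le intro: less_imp_le)
      hence "(norm v)\<^sup>2 * ((3 / 4 - \<epsilon>\<^sub>1 / 2) * \<gamma>) \<le> (norm v)\<^sup>2 * (w \<bullet> (sample_mean A S *v w))"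
        by (intro mult_left_mono) auto
      also have "\<dots> = v \<bullet> (sample_mean A S *v v)"
        using False by (simp add: w_def matrix_vector_mult_scaleR power2_eq_square)
      finally show ?thesis by (simp add: mult.commute)
    qed simp
    have gd: "norm (sample_mean v T - d) \<le> \<epsilon>\<^sub>2" using T by (simp add: Bg_def)
    show "(S, T) \<in> E"
      using gradient_close(1,2)[OF gd \<sigma>4 \<epsilon>\<^sub>2(1)]
        inexact_newton_direction[OF HS(1,2) refl lower \<gamma>(1) \<kappa>t1 \<theta>\<^sub>1 \<theta>\<^sub>2 \<epsilon>\<^sub>1 \<epsilon>\<^sub>2(1) \<beta> \<sigma> _ gd]
      by (intro E_I)
  qed
  have bad_H: "draw_prob m n s\<^sub>H Bd \<le> real CARD('d) * exp (- (23 / 20 * (ln (real CARD('d)) + L)))"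
    unfolding Bd_def l_def[symmetric]
    by (rule hessian_sample_bound[OF n s1 s\<^sub>H_le A1 mean \<gamma>(1) \<gamma>K1 \<epsilon>\<^sub>1 h])

  have "1 - exp (- L) \<le> ?P"
  \<comment> \<open>The split is at \<delta> = 1/e: below it McDiarmid's bound controls the
    gradient, above it second moments, which are stronger for small \<open>L\<close>.\<close>
  proof (cases "1 \<le> L")
    case True
    have "exp (- (3 / 20 * ln (real CARD('d)))) \<le> 1" using card by simp
    hence "real CARD('d) * exp (- (23 / 20 * (ln (real CARD('d)) + L))) \<le> exp (- (23 / 20 * L))"
      using card by (subst dimension_factor) (auto intro: mult_left_le_one_le)
    hence "draw_prob m n s\<^sub>H Bd \<le> exp (- (23 / 20 * L))" using bad_H by simp
    from success_bound_small_delta[OF True this _ _ bad_g(2)] show ?thesis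
      using general by simp
  next
    case L1: False
    show ?thesis
    proof (cases "CARD('d) = 1")
      case False
      hence "2 \<le> real CARD('d)" using card by linarith
      hence "draw_prob m n s\<^sub>H Bd \<le> 91 / 100 * exp (- (23 / 20 * L))"
        using bad_H dimension_gain[of "real CARD('d)" L] by linarith
      from success_bound_large_delta[OF L0 _ t_def this bad_g(1)] show ?thesis
        using general L1 by simp
    next
      case one: True
      note one_d = one_dimensional[OF one]
      define r where "r = 2 / 3 * (1 - \<epsilon>\<^sub>1)"
      define B1 where "B1 = {S. (\<Sum>j\<leftarrow>S. trace (A j)) / real s\<^sub>H \<le> r * \<gamma>}"
      define a where "a = draw_prob m n s\<^sub>H B1"
      have r: "0 \<le> r" "r < 1" using \<epsilon>\<^sub>1 by (simp_all add: r_def)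
      have dir: "(S, T) \<in> E" if S: "S \<in> set_pmf (draw m n s\<^sub>H)" "S \<notin> B1" and w: "w \<le> \<kappa>t"
        and T: "norm (sample_mean v T) < \<sigma> * \<epsilon>\<^sub>2 \<Longrightarrow> norm d < (1 + \<sigma>) * \<epsilon>\<^sub>2"
          "\<sigma> * \<epsilon>\<^sub>2 \<le> norm (sample_mean v T) \<Longrightarrow> norm d \<le> 5 / 4 * norm (sample_mean v T)"
          "\<sigma> * \<epsilon>\<^sub>2 \<le> norm (sample_mean v T) \<Longrightarrow>
            sample_mean v T \<bullet> (sample_mean v T - d) \<le> w * \<epsilon>\<^sub>2 * norm (sample_mean v T)" for S T w
      proof -
        note HS = H[OF supp[OF S(1)]]
        have "(\<Sum>j\<leftarrow>S. trace (A j)) = trace (\<Sum>j\<leftarrow>S. A j)"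
          by (induction S) (simp_all add: trace_add trace_0[simplified])
        hence "trace (sample_mean A S) = (\<Sum>j\<leftarrow>S. trace (A j)) / real s\<^sub>H"
          unfolding HS(3) by (simp add: trace_scaleR)
        hence lo: "2 / 3 * (1 - \<epsilon>\<^sub>1) * \<gamma> \<le> trace (sample_mean A S)"
          using S(2) by (simp add: B1_def r_def)
        have "0 \<le> trace ((\<kappa>t * \<gamma>) *\<^sub>R mat 1 - sample_mean A S)" using HS(2) by (rule pos_semidef_trace_nonneg)
        hence hi: "trace (sample_mean A S) \<le> \<kappa>t * \<gamma>" by (simp add: trace_sub trace_scaleR one_d(3))
        show ?thesis
          using T(1,2) scalar_newton_direction[OF one_d(1) lo hi one_d(2) \<gamma>(1) \<kappa>t1 \<theta>\<^sub>1 \<theta>\<^sub>2 \<epsilon>\<^sub>1 \<epsilon>\<^sub>2(1) \<beta> \<sigma> _ T(3) w]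
          by (intro E_I)
      qed
      have two_sided: "(1 - a) * (1 - iid_prob n s\<^sub>g Bg)
          \<le> ?P"
        unfolding a_def
      proof (rule pair_prob_ge)
        fix S T assume S: "S \<in> set_pmf (draw m n s\<^sub>H)" "S \<notin> B1" and T: "T \<notin> Bg"
        have gd: "norm (sample_mean v T - d) \<le> \<epsilon>\<^sub>2" using T by (simp add: Bg_def)
        show "(S, T) \<in> E"
          by (rule dir[OF S \<kappa>t1]) (rule gradient_close[OF gd \<sigma>4 \<epsilon>\<^sub>2(1)]; assumption)+
      qed
      have trA: "0 \<le> trace (A j) \<and> trace (A j) \<le> K1" if "j \<in> {1..n}" for j
        using pos_semidef_trace_nonneg[of "A j"] pos_semidef_trace_nonneg[of "K1 *\<^sub>R mat 1 - A j"] A1[OF that]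
        by (simp add: trace_sub trace_scaleR one_d(3))
      have tr_mean: "\<gamma> \<le> (\<Sum>j=1..n. trace (A j)) / real n"
        using pos_semidef_trace_nonneg[OF mean] by (simp add: trace_sub trace_scaleR trace_sum one_d(3))
      define q where "q = real s\<^sub>H * \<gamma> / K1"
      have q0: "0 < q" using s1 \<gamma> K1 by (simp add: q_def)
      have a: "a \<le> 1 / (1 + q * (1 - r)\<^sup>2)"
        unfolding a_def B1_def q_def
        by (rule prob_sample_mean_lower[OF n s1 s\<^sub>H_le trA \<gamma>(1) tr_mean r])
      have "l = L" by (simp add: l_def one)
      have a1: "a \<le> 9 / (9 + 4 * t\<^sup>2)"
      proof -
        \<comment> \<open>As \<open>\<epsilon>\<^sub>1 \<le> 1/2\<close>, this is at least
          \<open>4/3 * \<epsilon>\<^sub>1\<close>; its square cancels the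
          \<open>\<epsilon>\<^sub>1\<^sup>2\<close> in the sample size and leaves
          \<open>32/9 * L = 4/9 * t^2\<close>.\<close>
        have "1 - r = 1 / 3 + 2 / 3 * \<epsilon>\<^sub>1" by (simp add: r_def field_simps)
        hence "4 * \<epsilon>\<^sub>1 / 3 \<le> 1 - r" using \<epsilon>\<^sub>1 by simp
        hence "(4 * \<epsilon>\<^sub>1 / 3)\<^sup>2 \<le> (1 - r)\<^sup>2" using \<epsilon>\<^sub>1 by (intro power_mono) auto
        hence "2 * L / \<epsilon>\<^sub>1\<^sup>2 * (4 * \<epsilon>\<^sub>1 / 3)\<^sup>2 \<le> q * (1 - r)\<^sup>2"
          using h L0 q0 unfolding \<open>l = L\<close> q_def[symmetric] by (intro mult_mono) auto
        moreover have "2 * L / \<epsilon>\<^sub>1\<^sup>2 * (4 * \<epsilon>\<^sub>1 / 3)\<^sup>2 = 4 * t\<^sup>2 / 9"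
          using \<epsilon>\<^sub>1 L0 by (simp add: t_def power_mult_distrib power_divide)
        ultimately have "1 / (1 + q * (1 - r)\<^sup>2) \<le> 1 / (1 + 4 * t\<^sup>2 / 9)"
          using q0 by (intro divide_left_mono) (auto intro!: mult_pos_pos add_pos_nonneg)
        also have "\<dots> = 9 / (9 + 4 * t\<^sup>2)"
        proof -
          have "0 < 9 + 4 * t\<^sup>2" by (simp add: add_pos_nonneg)
          thus ?thesis by (simp add: divide_eq_eq eq_divide_eq)
        qed
        finally show ?thesis using a by simp
      qed
      \<comment> \<open>Away from \<open>t = 0\<close> Cantelli's and Chebyshev's bounds suffice.
        Near 0 one success probability must be constant: that of the Hessian for
        \<open>q \<ge> 1/2\<close>, that of the gradient otherwise.\<close>
      consider "1 / 5 \<le> t" | "t \<le> 1 / 5" "1 / 2 \<le> q" | "t \<le> 1 / 5" "q < 1 / 2" by linarith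
      thus ?thesis
      proof cases
        case 1
        thus ?thesis
          using success_bound_scalar[OF L0 _ t_def a1 bad_g(1)] L1 two_sided by simp
      next
        case 2
        \<comment> \<open>Cantelli's bound becomes 1 / (1 + 1/2 * 1/9) = 18/19.\<close>
        have "(1 / 3)\<^sup>2 \<le> (1 - r)\<^sup>2" using \<epsilon>\<^sub>1 by (intro power_mono) (auto simp: r_def)
        hence "1 / 2 * (1 / 3)\<^sup>2 \<le> q * (1 - r)\<^sup>2" using 2 by (intro mult_mono) auto
        hence "1 / (1 + q * (1 - r)\<^sup>2) \<le> 1 / (1 + 1 / 2 * (1 / 3)\<^sup>2)"
          using q0 by (intro divide_left_mono) (auto intro!: mult_pos_pos add_pos_nonneg simp: power2_eq_square)
        hence "a \<le> 18 / 19" using a by (simp add: power2_eq_square)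
        from success_bound_scalar_dense[OF L0 t_def this bad_g(1) 2(1)] show ?thesis
          using two_sided by simp
      next
        case 3
        \<comment> \<open>Few draws force bad conditioning: as \<open>K1\<close> is at most
          \<open>s\<^sub>H * \<Lambda>\<close>, \<kappa>t exceeds 2, and the gradient may err by
          \<open>2 * \<epsilon>\<^sub>2\<close>.\<close>
        have "real s\<^sub>H * \<gamma> * 2 < K1" using 3 K1 by (simp add: q_def field_simps)
        hence "real s\<^sub>H * (2 * \<gamma>) < real s\<^sub>H * \<Lambda>" using K1\<Lambda> by simp
        hence "2 * \<gamma> < \<Lambda>" using s1 by (subst (asm) mult_less_cancel_left_pos) auto
        hence \<kappa>t2: "2 \<le> \<kappa>t" using \<gamma> unfolding \<Lambda> by simp
        obtain u :: "real^'d" where u: "norm u = 1" "d = norm d *\<^sub>R u"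
        proof (cases "d = 0")
          case True
          \<comment> \<open>If \<open>d = 0\<close>, any unit vector will do;
            \<open>undefined\<close> is just some index.\<close>
          thus ?thesis by (intro that[of "axis undefined 1"]) auto
        next
          case False
          thus ?thesis by (intro that[of "(1 / norm d) *\<^sub>R d"]) auto
        qed
        define B2 where "B2 = {S. \<not> (- \<epsilon>\<^sub>2 < u \<bullet> (sample_mean v S - d) \<and> u \<bullet> (sample_mean v S - d) \<le> 2 * \<epsilon>\<^sub>2)}"
        have "(1 - a) * (1 - iid_prob n s\<^sub>g B2)
          \<le> ?P"
          unfolding a_def
        proof (rule pair_prob_ge)
          fix S T assume S: "S \<in> set_pmf (draw m n s\<^sub>H)" "S \<notin> B1" and T: "T \<notin> B2"
          have "u \<noteq> 0" using u by auto
          then obtain c where c: "sample_mean v T = c *\<^sub>R u" using one_d(2) by blast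
          have g: "sample_mean v T = (u \<bullet> sample_mean v T) *\<^sub>R u"
            using u(1) by (simp add: c dot_square_norm)
          have z: "- \<epsilon>\<^sub>2 < u \<bullet> (sample_mean v T - d)" "u \<bullet> (sample_mean v T - d) \<le> 2 * \<epsilon>\<^sub>2"
            using T by (simp_all add: B2_def)
          show "(S, T) \<in> E"
            by (rule dir[OF S \<kappa>t2]) (rule gradient_close_one_sided[OF g u(2) u(1) z \<sigma>4 \<epsilon>\<^sub>2(1)]; assumption)+
        qed
        moreover have "iid_prob n s\<^sub>g B2 \<le> 5 / 9"
          unfolding B2_def by (rule gradient_sample_bounds(3)[OF n d vG \<epsilon>\<^sub>2(1) L0 t_def sg u(1)])
        ultimately show ?thesis
          using success_bound_scalar_sparse[OF L0 t_def a1 _ 3(1)] by (meson order_trans)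
      qed
    qed
  qed
  thus ?thesis unfolding E_def \<delta>L[symmetric] .
qed

end
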